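(* Assume the Riemann Hypothesis. Let $C_n$ be the coefficients in the Laurent expansion of the secondary zeta function $Z(s)$ about $s=1$, and let $E_2(T)$ be the Brent (BPT) remainder for the function $\log^n(t)/t$, both as described in the context. Then $$C_n=\lim_{T\to\infty}(-1)^n\left\{\sum_{0<\gamma<T}\frac{\log^n(\gamma)}{\gamma}-\frac{1}{2\pi(n+1)(n+2)}\log^{n+1}(T)\log\left(\frac{T^{n+1}}{(2\pi)^{n+2}}\right)-\frac{\log^n(T)}{T}\left[N(T)-\frac78-\frac{T}{2\pi}\log\left(\frac{T}{2\pi}\right)+\frac{T}{2\pi}\right]+E_2(T)\right\}$$ for $n\ge 0$.
   Context: The Riemann Hypothesis (RH) is assumed: the non-trivial zeros of the Riemann zeta function are $\rho=\tfrac12+i\gamma$ with $\gamma$ real. Sums over $\gamma>0$ or $0<\gamma<T$ run over the positive imaginary parts of these zeros, counted with multiplicity, and $N(T)=\sum_{0<\gamma<T}1$ is the zero-counting function, with $T$ taken not equal to any $\gamma$. The notation $\log^k(x)$ means $(\log x)^k$, and $\log^0(x)=1$. The secondary zeta function is $Z(s)=\sum_{\gamma>0}\gamma^{-s}$, absolutely convergent for $\Re(s)>1$. It extends to $\mathbb{C}\setminus\{1,-1,-3,-5,\ldots\}$, with a double pole at $s=1$ and simple poles at the negative odd integers. The numbers $C_n$ are defined by its Laurent expansion about $s=1$, $$Z(s)=\frac{1}{2\pi(s-1)^2}-\frac{\log(2\pi)}{2\pi(s-1)}+\sum_{n=0}^{\infty}C_n\frac{(s-1)^n}{n!}.$$ The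 remainder $E_2(T)$, which depends on $n$, is as follows. Put $L(T)=\frac78+\frac{T}{2\pi}\log\left(\frac{T}{2\pi}\right)-\frac{T}{2\pi}$ and $$A(T)=\frac{1}{2\pi}\int_1^T\frac{\log^n(t)\log(t/2\pi)}{t}\,dt=\frac{1}{2\pi(n+1)(n+2)}\log^{n+1}(T)\log\left(\frac{T^{n+1}}{(2\pi)^{n+2}}\right).$$ Let $E(T)$ be the error term in $\sum_{0<\gamma<T}\frac{\log^n(\gamma)}{\gamma}-A(T)=(-1)^nC_n-E(T)$. Applying Brent's (BPT) theorem on sums over zeros with $\phi(t)=\log^n(t)/t$ gives $$E(T)=-\frac{\log^n(T)}{T}\left[N(T)-L(T)\right]+E_2(T),$$ where for large $T$ $$E_2(T)<2(A_0+A_1\log T)\left|\frac{n\log^{n-1}(T)}{T^2}-\frac{\log^n(T)}{T^2}\right|+(A_1+A_2)\frac{\log^n(T)}{T^2},$$ with $A_0=2.067$, $A_1=0.059$, $A_2=0.007$ (the term $n\log^{n-1}(T)$ is $0$ when $n=0$), and hence $E_2(T)=O\left(\log^{n+1}(T)/T^2\right)$. *)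

theory Defs
  imports "HOL-Complex_Analysis.Complex_Analysis"
begin

(* Analytic continuation from Re z > 1 to the complement of an exceptional set P.
   The value at s is read off from any continuation to a punctured half-plane
   {Re z > a} - P that contains s. For countable P these regions are connected and nested,
   so the value does not depend on the choice (continuation_eq), and wherever a
   single-valued continuation to all of -P exists, it is recovered.
   Values at points of P carry no meaning. *)
definition continuation :: "complex set \<Rightarrow> (complex \<Rightarrow> complex) \<Rightarrow> complex \<Rightarrow> complex" where
  "continuation P f s =
     (SOME w. \<exists>g a. a < Re s \<and> g holomorphic_on ({z. Re z > a} - P) \<and>
                    (\<forall>z. Re z > 1 \<longrightarrow> g z = f z) \<and> w = g s)"

lemma continuation_eq:
  assumes P: "countable P" "closed P"
    and g: "g holomorphic_on ({z. Re z > a} - P)" "\<And>z. Re z > 1 \<Longrightarrow> g z = f z"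
    and s: "Re s > a" "s \<notin> P"
  shows "continuation P f s = g s"
proof -
  have *: "w = g s" if "\<exists>h b. b < Re s \<and> h holomorphic_on ({z. Re z > b} - P) \<and>
                    (\<forall>z. Re z > 1 \<longrightarrow> h z = f z) \<and> w = h s" for w
  proof -
    from that obtain h b where h: "b < Re s" "h holomorphic_on ({z. Re z > b} - P)"
      "\<And>z. Re z > 1 \<Longrightarrow> h z = f z" "w = h s" by blast
    define c where "c = max a b"
    have op: "open {z. Re z > d}" for d
      by (simp add: open_halfspace_Re_gt)
    have conn: "connected {z. Re z > d}" for d
      by (simp add: convex_connected convex_halfspace_Re_gt)
    have "h s = g s"
    proof (rule analytic_continuation_open
        [where f = h and g = g and z = s and
         s = "{z. Re z > max 1 c} - P" and s' = "{z. Re z > c} - P"])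
      show "{z. Re z > max 1 c} - P \<noteq> {}"
      proof
        assume "{z. Re z > max 1 c} - P = {}"
        hence "{z. Re z > max 1 c} \<subseteq> P" by blast
        hence "countable {z. Re z > max 1 c}" using P(1) countable_subset by blast
        thus False using uncountable_halfspace_Re_gt by blast
      qed
      show "connected ({z. Re z > c} - P)"
        by (rule connected_open_diff_countable) (use op conn P(1) in auto)
      show "h holomorphic_on ({z. Re z > c} - P)"
        by (rule holomorphic_on_subset[OF h(2)]) (auto simp: c_def)
      show "g holomorphic_on ({z. Re z > c} - P)"
        by (rule holomorphic_on_subset[OF g(1)]) (auto simp: c_def)
      show "open ({z. Re z > max 1 c} - P)" "open ({z. Re z > c} - P)"
        using op P(2) by (blast intro: open_Diff)+
    qed (use g h s in \<open>auto simp: c_def\<close>)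
    thus ?thesis using h(4) by simp
  qed
  show ?thesis
    unfolding continuation_def
  proof (rule some_equality)
    show "\<exists>h b. b < Re s \<and> h holomorphic_on ({z. Re z > b} - P) \<and>
            (\<forall>z. Re z > 1 \<longrightarrow> h z = f z) \<and> g s = h s"
      by (intro exI[of _ g] exI[of _ a] conjI allI impI refl) (fact s(1) | fact g(1) | erule g(2))+
  qed (fact *)
qed

definition riemann_zeta :: "complex \<Rightarrow> complex" where
  "riemann_zeta = continuation {1} (\<lambda>s. \<Sum>n. of_nat (Suc n) powr (-s))"

definition nontrivial_zeros :: "complex set" where
  "nontrivial_zeros =
     {s. s \<noteq> 1 \<and> riemann_zeta s = 0 \<and> (\<forall>k::nat. s \<noteq> - 2 * of_nat (Suc k))}"

definition riemann_hypothesis :: bool where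
  "riemann_hypothesis \<longleftrightarrow> (\<forall>\<rho>\<in>nontrivial_zeros. Re \<rho> = 1 / 2)"

definition ordinates :: "real set" where
  "ordinates = {Im \<rho> |\<rho>. \<rho> \<in> nontrivial_zeros \<and> Im \<rho> > 0}"

(* the sum of \<phi>(\<gamma>) over 0 < \<gamma> < T; zorder supplies the multiplicities *)
definition zero_sum :: "(real \<Rightarrow> real) \<Rightarrow> real \<Rightarrow> real" where
  "zero_sum \<phi> T = (\<Sum>\<rho>\<in>{\<rho>\<in>nontrivial_zeros. 0 < Im \<rho> \<and> Im \<rho> < T}.
                     of_int (zorder riemann_zeta \<rho>) * \<phi> (Im \<rho>))"

definition zero_count :: "real \<Rightarrow> real" where
  "zero_count T = zero_sum (\<lambda>_. 1) T"

definition secondary_zeta :: "complex \<Rightarrow> complex" where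
  "secondary_zeta = continuation (insert 1 {- (2 * of_nat k + 1) |k::nat. True})
     (\<lambda>s. \<Sum>\<^sub>\<infinity>\<rho>\<in>{\<rho>\<in>nontrivial_zeros. Im \<rho> > 0}.
            of_int (zorder riemann_zeta \<rho>) * of_real (Im \<rho>) powr (-s))"

definition secondary_zeta_coeff :: "nat \<Rightarrow> complex" where
  "secondary_zeta_coeff n = fact n * fls_nth (laurent_expansion secondary_zeta 1) (int n)"

definition smooth_count :: "real \<Rightarrow> real" where
  "smooth_count T = 7 / 8 + T / (2 * pi) * ln (T / (2 * pi)) - T / (2 * pi)"

(* The remainder in the theorem of Brent, Platt and Trudgian on sums over zeros.
   With L = smooth_count, so that L'(t) = log(t/2pi)/2pi, and Q = N - L, Stieltjes integration
   by parts gives, for T < U not ordinates,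
     (sum of \<phi>(\<gamma>) over T < \<gamma> < U) - (integral of \<phi> L' over [T,U])
       = \<phi>(U) Q(U) - \<phi>(T) Q(T) - (integral of \<phi>' Q over [T,U]),
   and the last term becomes the remainder as U tends to infinity. *)
definition bpt_remainder :: "(real \<Rightarrow> real) \<Rightarrow> real \<Rightarrow> real" where
  "bpt_remainder \<phi> T = - integral {T..} (\<lambda>t. deriv \<phi> t * (zero_count t - smooth_count t))"

end

theory Submission
  imports Defs
begin

text \<open>
  Write N for the counting function of the ordinates, L for its smooth approximation, Q = N - L,
  and \<phi>(t) = log^n(t) / t. The sum of \<phi> over the ordinates below T is a Stieltjes integral
  against dN = dL + dQ; integrating the dQ part by parts gives \<phi>(T) Q(T), minus the integral of
  \<phi>' Q up to T, plus terms at the left end point. The bracket in the theorem removes the integral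
  against dL and the term \<phi>(T) Q(T), and its last summand completes the integral of \<phi>' Q to a
  half-line. Hence, once that integral converges, the bracket does not depend on T at all
  (bracket_constant), and the theorem says that this constant is (-1)^n times the coefficient C_n.

  The same integration by parts with \<phi>(t) = t^(-s) gives, for Re s > 1,
  Z(s) = polar part + finite sum + constant + s times the Mellin transform of Q at -s - 1. If
  Q(t) = O(t^(9/10)), this is a continuation of Z to Re s > 9/10 (secondary_zeta_eq), and expanding
  t^(-w) in powers of w log t under the integral sign identifies its Taylor coefficients at s = 1
  with the constants above (regular_part_expansion).

  It remains to bound Q. Let xi be the completed zeta function, centred at 1/2. Under the Riemann
  hypothesis its zeros lie on the imaginary axis, so that the modulus of a zero is the absolute
  value of an ordinate, and Jensen's formula on the circle |z| = R expresses the sum of log(R/\<gamma>)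
  over \<gamma> < R by the mean of log |xi| over that circle. By the functional equation and Stirling's
  formula, log |xi| is known up to O(log R) where |Re z| >= 3/2. On the two remaining arcs only the
  upper bound survives, and the lower values are controlled in the mean by Poisson's formula with a
  base point close to these arcs, at the cost of O(sqrt R log R) (xi_circle_mean). This determines
  the integral of N(t)/t over [0,R] with an error O(R^(3/5)); as N is monotone, differencing over a
  step of length R^(4/5) gives N itself with an error O(R^(9/10)) (zero_count_estimate). No
  argument-principle count is needed.

  The functional equation comes from the Mellin transform of 1/(e^x - 1) - 1/x + 1/2, evaluated
  by the geometric series for s > 1 and by the partial fraction expansion for -1 < s < 0.
\<close>

section \<open>The zeta function in the right half-plane\<close>

text \<open>
  The difference (s - 1) (n^(-s) - \<integral> x^(-s) dx over [n,n+1]) with n = k + 1. The second and third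
  summands telescope, and the whole is O(n^(-Re s - 1)), so that its sum converges for Re s > 0.
\<close>
definition em_term :: "nat \<Rightarrow> complex \<Rightarrow> complex" where
  "em_term k s = (s - 1) * of_nat (Suc k) powr (-s) - of_nat (Suc k) powr (1 - s)
                   + of_nat (Suc (Suc k)) powr (1 - s)"

text \<open>
  The function (s - 1) zeta(s) on the half-plane Re s > 0, free of the pole at 1.
\<close>
definition zeta_reg :: "complex \<Rightarrow> complex" where
  "zeta_reg s = 1 + (\<Sum>k. em_term k s)"

lemma norm_of_nat_powr: "n > 0 \<Longrightarrow> norm (of_nat n powr s :: complex) = real n powr Re s"
  using norm_powr_real_powr[of "of_nat n :: complex" s] by simp

lemma norm_em_term_le:
  assumes "Re s \<ge> 0"
  shows "norm (em_term k s) \<le> norm (s - 1) * norm s * real (Suc k) powr (- Re s - 1)"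
proof -
  define a b :: complex where "a = of_nat (Suc k)" and "b = of_nat (Suc (Suc k))"
  \<comment> \<open>The function z^(1-s) and its first two derivatives, for the Taylor formula on [k+1,k+2].\<close>
  define f where "f = (\<lambda>i. case i of 0 \<Rightarrow> (\<lambda>z::complex. z powr (1 - s))
       | Suc 0 \<Rightarrow> (\<lambda>z. (1 - s) * z powr (- s))
       | Suc (Suc _) \<Rightarrow> (\<lambda>z. (1 - s) * (- s) * z powr (- s - 1)))"
  have seg: "\<exists>x::real. z = of_real x \<and> x \<ge> real (Suc k)" if "z \<in> closed_segment a b" for z
  proof -
    have "a = of_real (real (Suc k))" "b = of_real (real (Suc (Suc k)))" by (auto simp: a_def b_def)
    with that have "z \<in> of_real ` closed_segment (real (Suc k)) (real (Suc (Suc k)))"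
      by (simp only: closed_segment_of_real)
    thus ?thesis by (auto simp: closed_segment_eq_real_ivl)
  qed
  have "norm (f 0 b - (\<Sum>i\<le>1. f i a * (b - a) ^ i / fact i))
     \<le> (norm (s - 1) * norm s * real (Suc k) powr (- Re s - 1)) * norm (b - a) ^ Suc 1 / fact 1"
  proof (rule complex_Taylor)
    fix i :: nat and x assume x: "x \<in> closed_segment a b" and i: "i \<le> 1"
    from seg[OF x] obtain y where y: "x = of_real y" "y \<ge> real (Suc k)" by blast
    hence "x \<notin> \<real>\<^sub>\<le>\<^sub>0" by (simp add: complex_nonpos_Reals_iff)
    thus "(f i has_field_derivative f (Suc i) x) (at x within closed_segment a b)"
      using i by (cases i) (auto simp: f_def intro!: derivative_eq_intros)
  next
    fix x assume x: "x \<in> closed_segment a b"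
    from seg[OF x] obtain y where y: "x = of_real y" "y \<ge> real (Suc k)" by blast
    have "norm (x powr (-s - 1)) = y powr (- Re s - 1)"
      using y by (subst y(1), subst norm_powr_real_powr) auto
    also have "\<dots> \<le> real (Suc k) powr (- Re s - 1)"
      using y assms by (intro powr_mono2') auto
    finally show "cmod (f (Suc 1) x) \<le> norm (s - 1) * norm s * real (Suc k) powr (- Re s - 1)"
      by (simp add: f_def norm_mult norm_minus_commute mult_left_mono)
  qed auto
  moreover have "b - a = 1" by (simp add: a_def b_def)
  moreover have "f 0 b - (\<Sum>i\<le>1. f i a * (b - a) ^ i / fact i) = em_term k s"
    unfolding \<open>b - a = 1\<close> by (simp add: f_def em_term_def a_def b_def algebra_simps)
  ultimately show ?thesis by simp
qed

lemma summable_Suc_powr: "a > 1 \<Longrightarrow> summable (\<lambda>k. real (Suc k) powr (- a))"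
  by (subst summable_Suc_iff) (simp add: summable_real_powr_iff)

lemma summable_em_term: "Re s > 0 \<Longrightarrow> summable (\<lambda>k. norm (em_term k s))"
proof (rule summable_comparison_test')
  assume "Re s > 0"
  thus "summable (\<lambda>k. norm (s - 1) * norm s * real (Suc k) powr (- (Re s + 1)))"
    by (intro summable_mult summable_Suc_powr) auto
  show "norm (norm (em_term n s)) \<le> norm (s - 1) * norm s * real (Suc n) powr (- (Re s + 1))" for n
    using norm_em_term_le[of s n] \<open>Re s > 0\<close> by (simp del: of_nat_Suc)
qed

lemma holomorphic_em_term: "em_term k holomorphic_on A"
  unfolding em_term_def by (intro holomorphic_intros)

lemma holomorphic_zeta_reg: "zeta_reg holomorphic_on {s. Re s > 0}"
proof -
  have "(\<lambda>s. \<Sum>k. em_term k s) holomorphic_on {s. Re s > 0}"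
  proof (rule holomorphic_uniform_sequence[where f = "\<lambda>n s. \<Sum>k<n. em_term k s"])
    show "open {s. Re s > 0}" by (rule open_halfspace_Re_gt)
    show "(\<lambda>s. \<Sum>k<n. em_term k s) holomorphic_on {s. 0 < Re s}" for n
      by (intro holomorphic_intros holomorphic_em_term)
    fix x assume x: "x \<in> {s. Re s > 0}"
    define d where "d = Re x / 2"
    have d: "d > 0" using x by (simp add: d_def)
    have re: "Re z \<ge> d" and nm: "norm z \<le> norm x + d" "norm (z - 1) \<le> norm x + d + 1"
      if "z \<in> cball x d" for z
    proof -
      have "norm (x - z) \<le> d" using that by (simp add: dist_norm)
      moreover have "\<bar>Re (x - z)\<bar> \<le> norm (x - z)" by (rule abs_Re_le_cmod)
      ultimately show "Re z \<ge> d" by (simp add: d_def)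
      show "norm z \<le> norm x + d"
        using \<open>norm (x - z) \<le> d\<close> norm_triangle_ineq2[of z x] by (simp add: norm_minus_commute)
      thus "norm (z - 1) \<le> norm x + d + 1" using norm_triangle_ineq4[of z 1] by simp
    qed
    have "uniform_limit (cball x d) (\<lambda>n s. \<Sum>k<n. em_term k s) (\<lambda>s. \<Sum>k. em_term k s) sequentially"
    proof (rule Weierstrass_m_test)
      show "norm (em_term n z) \<le> (norm x + d + 1) * (norm x + d) * real (Suc n) powr (- (d + 1))"
        if "z \<in> cball x d" for n z
      proof -
        have "norm (em_term n z) \<le> norm (z - 1) * norm z * real (Suc n) powr (- Re z - 1)"
          using re[OF that] d by (intro norm_em_term_le) auto
        also have "\<dots> \<le> (norm x + d + 1) * (norm x + d) * real (Suc n) powr (- (d + 1))"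
          using nm[OF that] re[OF that] d by (intro mult_mono powr_mono) auto
        finally show ?thesis .
      qed
      show "summable (\<lambda>n. (norm x + d + 1) * (norm x + d) * real (Suc n) powr (- (d + 1)))"
        using d by (intro summable_mult summable_Suc_powr) auto
    qed
    moreover have "cball x d \<subseteq> {s. Re s > 0}" using re d by force
    ultimately show "\<exists>d>0. cball x d \<subseteq> {s. 0 < Re s} \<and>
           uniform_limit (cball x d) (\<lambda>n s. \<Sum>k<n. em_term k s) (\<lambda>s. \<Sum>k. em_term k s) sequentially"
      using d by blast
  qed
  thus ?thesis unfolding zeta_reg_def[abs_def] by (intro holomorphic_intros)
qed

lemma summable_zeta:
  assumes "Re s > 1"
  shows "summable (\<lambda>n. norm (of_nat (Suc n) powr (-s) :: complex))"
proof -
  have "(\<lambda>n. norm (of_nat (Suc n) powr (-s) :: complex)) = (\<lambda>n. real (Suc n) powr (- Re s))"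
    by (intro ext) (simp only: norm_of_nat_powr zero_less_Suc uminus_complex.sel)
  thus ?thesis using summable_Suc_powr[OF assms] by (simp only:)
qed

lemma zeta_reg_eq:
  assumes s: "Re s > 1"
  shows "zeta_reg s = (s - 1) * (\<Sum>n. of_nat (Suc n) powr (-s))"
proof -
  have s1: "summable (\<lambda>n. of_nat (Suc n) powr (-s) :: complex)"
    by (rule summable_norm_cancel[OF summable_zeta[OF s]])
  have lim: "(\<lambda>n. of_nat (Suc n) powr (1 - s) :: complex) \<longlonglongrightarrow> 0"
  proof (rule tendsto_norm_zero_cancel)
    have "(\<lambda>n. real (Suc n) powr (1 - Re s)) \<longlonglongrightarrow> 0"
      using s by (intro tendsto_neg_powr filterlim_compose[OF filterlim_real_sequentially filterlim_Suc]) auto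
    thus "(\<lambda>n. norm (of_nat (Suc n) powr (1 - s) :: complex)) \<longlonglongrightarrow> 0"
      by (simp only: norm_of_nat_powr zero_less_Suc minus_complex.sel one_complex.sel)
  qed
  have "(\<lambda>n. of_nat (Suc (Suc n)) powr (1 - s) - of_nat (Suc n) powr (1 - s) :: complex) sums (0 - of_nat (Suc 0) powr (1 - s))"
    by (rule telescope_sums[OF lim])
  hence t: "(\<lambda>n. of_nat (Suc (Suc n)) powr (1 - s) - of_nat (Suc n) powr (1 - s) :: complex) sums (-1)"
    by simp
  have "(\<lambda>n. (s - 1) * of_nat (Suc n) powr (-s) +
          (of_nat (Suc (Suc n)) powr (1 - s) - of_nat (Suc n) powr (1 - s))) sums
        ((s - 1) * (\<Sum>n. of_nat (Suc n) powr (-s)) + (-1))"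
    by (intro sums_add sums_mult summable_sums s1 t)
  also have "(\<lambda>n. (s - 1) * of_nat (Suc n) powr (-s) +
          (of_nat (Suc (Suc n)) powr (1 - s) - of_nat (Suc n) powr (1 - s))) = (\<lambda>n. em_term n s)"
    unfolding em_term_def by (intro ext) (simp only: diff_add_eq add_diff_eq)
  finally have "suminf (\<lambda>n. em_term n s) = (s - 1) * (\<Sum>n. of_nat (Suc n) powr (-s)) + (-1)"
    by (rule sums_unique[symmetric])
  thus ?thesis unfolding zeta_reg_def by (simp only: add.commute[of 1] add.assoc) simp
qed

lemma zeta_reg_1: "zeta_reg 1 = 1"
  by (simp add: zeta_reg_def em_term_def del: of_nat_Suc)

lemma riemann_zeta_eq:
  assumes "Re s > 0" "s \<noteq> 1"
  shows "riemann_zeta s = zeta_reg s / (s - 1)"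
  unfolding riemann_zeta_def
proof (rule continuation_eq)
  show "(\<lambda>s. zeta_reg s / (s - 1)) holomorphic_on ({z. Re z > 0} - {1})"
    by (intro holomorphic_intros holomorphic_on_subset[OF holomorphic_zeta_reg]) auto
  show "zeta_reg z / (z - 1) = (\<Sum>n. of_nat (Suc n) powr (-z))" if "Re z > 1" for z
    using zeta_reg_eq[OF that] that by (cases "z = 1") (simp_all del: of_nat_Suc)
qed (use assms in auto)

lemma norm_zeta_reg_le: "\<exists>C\<ge>1. \<forall>s. Re s \<ge> 1/2 \<longrightarrow> norm (zeta_reg s) \<le> C * (norm s + 1) ^ 2"
proof -
  define S where "S = (\<Sum>k. real (Suc k) powr (- (3/2)))"
  have S: "summable (\<lambda>k. real (Suc k) powr (- (3/2)))" by (rule summable_Suc_powr) auto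
  have S0: "S \<ge> 0" unfolding S_def by (intro suminf_nonneg S) auto
  have "norm (zeta_reg s) \<le> (1 + S) * (norm s + 1) ^ 2" if s: "Re s \<ge> 1/2" for s
  proof -
    have n1: "norm (s - 1) \<le> norm s + 1" using norm_triangle_ineq4[of s 1] by simp
    have "norm (\<Sum>k. em_term k s) \<le> (\<Sum>k. norm (s - 1) * norm s * real (Suc k) powr (- (3/2)))"
    proof (rule order.trans[OF summable_norm suminf_le])
      show "norm (em_term n s) \<le> norm (s - 1) * norm s * real (Suc n) powr (- (3/2))" for n
        using s by (intro order.trans[OF norm_em_term_le] mult_left_mono powr_mono) auto
    qed (use s in \<open>auto intro!: summable_em_term summable_mult S simp del: of_nat_Suc\<close>)
    also have "\<dots> = norm (s - 1) * norm s * S" unfolding S_def by (rule suminf_mult[OF S])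
    also have "\<dots> \<le> (norm s + 1) * (norm s + 1) * S" using n1 S0 by (intro mult_right_mono mult_mono) auto
    finally have "norm (\<Sum>k. em_term k s) \<le> S * (norm s + 1) ^ 2" by (simp add: power2_eq_square mult_ac)
    moreover have "norm (zeta_reg s) \<le> 1 + norm (\<Sum>k. em_term k s)"
      unfolding zeta_reg_def using norm_triangle_ineq[of 1 "\<Sum>k. em_term k s"] by simp
    moreover have "1 \<le> (norm s + 1) ^ 2" by (simp add: one_le_power)
    ultimately have "norm (zeta_reg s) \<le> (norm s + 1) ^ 2 + S * (norm s + 1) ^ 2" by linarith
    thus ?thesis by (simp add: distrib_right)
  qed
  thus ?thesis using S0 by (intro exI[of _ "1 + S"]) auto
qed

text \<open>
  The value at 1/2 is needed as the centre value in Jensen's formula. The terms of the series are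
  real there and bounded below by those of a telescoping series with sum -1/2.
\<close>
lemma zeta_reg_half: "zeta_reg (1/2) \<noteq> 0"
proof -
  define g where "g = (\<lambda>k. sqrt (real (Suc (Suc k))) - sqrt (real (Suc k)) - 1 / (2 * sqrt (real (Suc k))))"
  have pw: "of_nat n powr (1/2 :: complex) = of_real (sqrt (real n))" for n
  proof -
    have "of_nat n powr (1/2 :: complex) = of_real (real n) powr of_real (1/2)" by simp
    also have "\<dots> = of_real (real n powr (1/2))" by (rule powr_of_real) auto
    finally show ?thesis by (simp add: powr_half_sqrt)
  qed
  have pw': "of_nat n powr (- (1/2) :: complex) = of_real (1 / sqrt (real n))" for n
    by (simp add: powr_minus pw field_simps)
  have em: "em_term k (1/2) = of_real (g k)" for k
  proof -
    have "em_term k (1/2) = (1/2 - 1) * of_nat (Suc k) powr (- (1/2)) - of_nat (Suc k) powr (1/2) + of_nat (Suc (Suc k)) powr (1/2)"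
      by (simp add: em_term_def)
    also have "\<dots> = (1/2 - 1) * of_real (1 / sqrt (real (Suc k))) - of_real (sqrt (real (Suc k))) + of_real (sqrt (real (Suc (Suc k))))"
      by (simp only: pw pw')
    also have "\<dots> = of_real (g k)" unfolding g_def by simp
    finally show ?thesis .
  qed
  have gb: "g k \<ge> (1/2) * (1 / sqrt (real (Suc (Suc k))) - 1 / sqrt (real (Suc k)))" for k
  proof -
    define u v where "u = sqrt (real (Suc k))" and "v = sqrt (real (Suc (Suc k)))"
    have uv: "u > 0" "v > u" by (auto simp: u_def v_def)
    have "v\<^sup>2 - u\<^sup>2 = 1" by (simp add: u_def v_def)
    hence *: "(v - u) * (v + u) = 1" by (simp add: algebra_simps power2_eq_square)
    have "(v - u) * (v + u) \<le> (v - u) * (2 * v)" using uv by (intro mult_left_mono) auto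
    hence "v - u \<ge> 1 / (2 * v)" using * uv by (simp add: field_simps)
    thus ?thesis unfolding g_def u_def[symmetric] v_def[symmetric] by (simp add: field_simps)
  qed
  have lim: "(\<lambda>n. 1 / sqrt (real (Suc n))) \<longlonglongrightarrow> 0"
    by (intro tendsto_divide_0[OF tendsto_const] filterlim_at_top_imp_at_infinity filterlim_compose[OF sqrt_at_top] filterlim_compose[OF filterlim_real_sequentially filterlim_Suc])
  have "(\<lambda>k. (1/2) * (1 / sqrt (real (Suc (Suc k))) - 1 / sqrt (real (Suc k)))) sums ((1/2) * (0 - 1 / sqrt (real (Suc 0))))"
    by (intro sums_mult telescope_sums[OF lim])
  hence t: "(\<lambda>k. (1/2) * (1 / sqrt (real (Suc (Suc k))) - 1 / sqrt (real (Suc k)))) sums (- 1/2)" by simp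
  have sg: "summable g"
  proof -
    have "summable (\<lambda>k. norm (em_term k (1/2)))" by (rule summable_em_term) auto
    hence "summable (\<lambda>k. \<bar>g k\<bar>)" by (simp add: em)
    thus ?thesis using summable_rabs_cancel by blast
  qed
  have "suminf g \<ge> -1/2" using suminf_le[OF gb _ sg] t by (auto simp: sums_iff)
  moreover have "zeta_reg (1/2) = of_real (1 + suminf g)"
    by (simp add: zeta_reg_def em suminf_of_real[OF sg])
  ultimately show ?thesis by (simp only: of_real_eq_0_iff)
qed

lemma norm_zeta_reg_ge:
  assumes "Re s \<ge> 2"
  shows "norm (zeta_reg s) \<ge> norm (s - 1) / 4"
proof -
  have sm: "summable (\<lambda>n. norm (of_nat (Suc n) powr (-s) :: complex))"
    using assms by (intro summable_zeta) auto
  have sm': "summable (\<lambda>n. norm (of_nat (Suc (Suc n)) powr (-s) :: complex))"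
    using sm by (subst summable_Suc_iff)
  have pi2: "(\<lambda>n. 1 / real (Suc n) ^ 2) sums (pi\<^sup>2 / 6)" using inverse_squares_sums by (simp add: add_ac)
  hence pi2': "(\<lambda>n. 1 / real (Suc (Suc n)) ^ 2) sums (pi\<^sup>2 / 6 - 1)"
    by (subst sums_Suc_iff) simp
  have "pi\<^sup>2 \<le> 3.2\<^sup>2" using pi_less_4 pi_approx by (intro power_mono) auto
  hence pb: "pi\<^sup>2 / 6 - 1 \<le> 3/4" by (simp add: power2_eq_square)
  have "(\<Sum>n. of_nat (Suc n) powr (-s) :: complex) = 1 + (\<Sum>n. of_nat (Suc (Suc n)) powr (-s))"
    using suminf_split_head[OF summable_norm_cancel[OF sm]] by (simp add: algebra_simps)
  moreover have "norm (\<Sum>n. of_nat (Suc (Suc n)) powr (-s) :: complex) \<le> (\<Sum>n. 1 / real (Suc (Suc n)) ^ 2)"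
  proof (rule order.trans[OF summable_norm[OF sm'] suminf_le[OF _ sm' sums_summable[OF pi2']]])
    fix n
    have "norm (of_nat (Suc (Suc n)) powr (-s) :: complex) \<le> real (Suc (Suc n)) powr (- 2)"
      unfolding norm_of_nat_powr[OF zero_less_Suc] using assms by (intro powr_mono) auto
    also have "real (Suc (Suc n)) powr (- 2) = 1 / real (Suc (Suc n)) ^ 2"
      by (simp add: powr_minus field_simps powr_numeral del: of_nat_Suc)
    finally show "norm (of_nat (Suc (Suc n)) powr (-s) :: complex) \<le> 1 / real (Suc (Suc n)) ^ 2" .
  qed
  moreover have "(\<Sum>n. 1 / real (Suc (Suc n)) ^ 2) \<le> 3/4" using pi2' pb by (simp add: sums_iff)
  moreover have "norm (1 + (\<Sum>n. of_nat (Suc (Suc n)) powr (-s))) \<ge> 1 - norm (\<Sum>n. of_nat (Suc (Suc n)) powr (-s) :: complex)"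
    by (metis norm_diff_ineq norm_one)
  ultimately have "norm (\<Sum>n. of_nat (Suc n) powr (-s) :: complex) \<ge> 1/4"
    by (simp only:)
  hence "norm (s - 1) * norm (\<Sum>n. of_nat (Suc n) powr (-s) :: complex) \<ge> norm (s - 1) * (1/4)"
    by (intro mult_left_mono) auto
  moreover have "Re s > 1" using assms by simp
  ultimately show ?thesis by (simp only: zeta_reg_eq norm_mult mult_1_right times_divide_eq_right)
qed

section \<open>Mellin transforms as power series\<close>

lemma sum_exp_le: "0 \<le> (x::real) \<Longrightarrow> (\<Sum>k<n. x ^ k / fact k) \<le> exp x"
proof -
  assume "0 \<le> x"
  have "(\<lambda>k. x ^ k / fact k) sums exp x" using exp_converges[of x] by (simp add: field_simps)
  thus ?thesis using \<open>0 \<le> x\<close> sum_le_suminf[of "\<lambda>k. x ^ k / fact k" "{..<n}"] by (auto simp: sums_iff)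
qed

text \<open>
  Expansion of an exponential integral into its moments, by dominated convergence of the
  exponential series.
\<close>
lemma exp_moment_expansion:
  fixes f :: "'a \<Rightarrow> complex" and g :: "'a \<Rightarrow> real"
  assumes f: "f \<in> borel_measurable M" and g: "g \<in> borel_measurable M"
    and int: "integrable M (\<lambda>x. norm (f x) * exp (r * \<bar>g x\<bar>))" and w: "norm w \<le> r"
  shows "integrable M (\<lambda>x. f x * exp (w * of_real (g x)))"
    and "(\<lambda>k. (\<integral>x. f x * of_real (g x) ^ k \<partial>M) / fact k * w ^ k) sums (\<integral>x. f x * exp (w * of_real (g x)) \<partial>M)"
proof -
  define h where "h = (\<lambda>k x. f x * ((w * of_real (g x)) ^ k / fact k))"
  have hm: "h k \<in> borel_measurable M" for k unfolding h_def using f g by measurable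
  have hn: "(\<Sum>k<n. norm (h k x)) \<le> norm (f x) * exp (r * \<bar>g x\<bar>)" for n x
  proof -
    have "(\<Sum>k<n. norm (h k x)) = norm (f x) * (\<Sum>k<n. (norm w * \<bar>g x\<bar>) ^ k / fact k)"
      by (simp add: h_def norm_mult norm_divide norm_power sum_distrib_left)
    also have "\<dots> \<le> norm (f x) * exp (norm w * \<bar>g x\<bar>)"
      by (intro mult_left_mono sum_exp_le) auto
    also have "\<dots> \<le> norm (f x) * exp (r * \<bar>g x\<bar>)"
      using w by (intro mult_left_mono) (auto intro: mult_right_mono)
    finally show ?thesis .
  qed
  have hn1: "norm (h k x) \<le> norm (f x) * exp (r * \<bar>g x\<bar>)" for k x
    using hn[of x "Suc k"] sum_nonneg[of "{..<k}" "\<lambda>k. norm (h k x)"] by simp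
  have hi: "integrable M (h k)" for k
    by (rule Bochner_Integration.integrable_bound[OF int hm]) (use hn1 in \<open>auto intro!: AE_I2\<close>)
  have he: "(\<lambda>k. h k x) sums (f x * exp (w * of_real (g x)))" for x
    unfolding h_def using exp_converges[of "w * of_real (g x)"]
    by (intro sums_mult) (simp add: scaleR_conv_of_real field_simps)
  have s1: "AE x in M. summable (\<lambda>k. norm (h k x))"
  proof (rule AE_I2)
    fix x show "summable (\<lambda>k. norm (h k x))"
      by (rule bounded_imp_summable[where B = "norm (f x) * exp (r * \<bar>g x\<bar>)"])
         (use hn[where n = "Suc m" for m] in \<open>auto simp: lessThan_Suc_atMost\<close>)
  qed
  have s2: "summable (\<lambda>k. \<integral>x. norm (h k x) \<partial>M)"
  proof (rule bounded_imp_summable)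
    show "(\<Sum>k\<le>n. \<integral>x. norm (h k x) \<partial>M) \<le> (\<integral>x. norm (f x) * exp (r * \<bar>g x\<bar>) \<partial>M)" for n
    proof -
      have "(\<Sum>k\<le>n. \<integral>x. norm (h k x) \<partial>M) = (\<integral>x. (\<Sum>k\<le>n. norm (h k x)) \<partial>M)"
        by (rule Bochner_Integration.integral_sum[symmetric]) (use hi in auto)
      also have "\<dots> \<le> (\<integral>x. norm (f x) * exp (r * \<bar>g x\<bar>) \<partial>M)"
        by (rule integral_mono) (use hi hn[where n = "Suc n"] int in \<open>auto simp: lessThan_Suc_atMost\<close>)
      finally show ?thesis .
    qed
  qed (auto intro!: integral_nonneg_AE)
  have eq: "(\<lambda>x. \<Sum>k. h k x) = (\<lambda>x. f x * exp (w * of_real (g x)))"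
    using he by (auto simp: sums_iff)
  show "integrable M (\<lambda>x. f x * exp (w * of_real (g x)))"
    using integrable_suminf[OF hi s1 s2] by (simp add: eq)
  have "(\<lambda>k. \<integral>x. h k x \<partial>M) sums (\<integral>x. f x * exp (w * of_real (g x)) \<partial>M)"
    using sums_integral[OF hi s1 s2] by (simp add: eq)
  moreover have "(\<integral>x. h k x \<partial>M) = (\<integral>x. f x * of_real (g x) ^ k \<partial>M) / fact k * w ^ k" for k
  proof -
    have "(\<integral>x. h k x \<partial>M) = (\<integral>x. (w ^ k / fact k) * (f x * of_real (g x) ^ k) \<partial>M)"
      by (intro Bochner_Integration.integral_cong) (auto simp: h_def power_mult_distrib)
    also have "\<dots> = (w ^ k / fact k) * (\<integral>x. f x * of_real (g x) ^ k \<partial>M)" by simp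
    finally show ?thesis by simp
  qed
  ultimately show "(\<lambda>k. (\<integral>x. f x * of_real (g x) ^ k \<partial>M) / fact k * w ^ k) sums (\<integral>x. f x * exp (w * of_real (g x)) \<partial>M)"
    by simp
qed

lemma integrable_lebesgue_on_iff:
  fixes f :: "real \<Rightarrow> 'a :: euclidean_space"
  assumes "S \<in> sets lebesgue"
  shows "integrable (lebesgue_on S) f \<longleftrightarrow> f absolutely_integrable_on S"
  unfolding set_integrable_def using assms by (subst integrable_restrict_space) auto

lemma of_real_powr_add_exp:
  assumes "x > 0"
  shows "(of_real x :: complex) powr (s + w) = of_real x powr s * exp (w * of_real (ln x))"
  using assms by (simp add: powr_def exp_add distrib_right Ln_of_real)

text \<open>
  Taylor expansion of the Mellin transform of u over S at s, with the logarithmic moments as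
  coefficients. Absolute convergence at Re s + r and Re s - r dominates exp (r |ln x|) on both
  sides of x = 1.
\<close>
lemma mellin_expansion:
  fixes u :: "real \<Rightarrow> real"
  assumes S: "S \<in> sets lebesgue" "S \<subseteq> {0<..}"
    and int: "(\<lambda>x. u x * x powr (Re s + r)) absolutely_integrable_on S"
             "(\<lambda>x. u x * x powr (Re s - r)) absolutely_integrable_on S"
    and r: "r \<ge> 0" and w: "norm w \<le> r"
  shows "(\<lambda>x. of_real (u x) * of_real x powr (s + w)) absolutely_integrable_on S"
    and "(\<lambda>k. integral S (\<lambda>x. of_real (u x) * of_real x powr s * of_real (ln x) ^ k) / fact k * w ^ k) sums
           integral S (\<lambda>x. of_real (u x) * of_real x powr (s + w))"
proof -
  let ?M = "lebesgue_on S"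
  define f where "f = (\<lambda>x. complex_of_real (u x) * of_real x powr s)"
  have sp: "space ?M = S" using S by (simp add: space_restrict_space)
  have pos: "x > 0" if "x \<in> space ?M" for x using that S sp by auto
  have [measurable]: "(\<lambda>x. x) \<in> borel_measurable ?M"
    by (intro measurable_restrict_space1 measurable_completion) simp
  have um: "u \<in> borel_measurable ?M"
  proof -
    have "(\<lambda>x. u x * x powr (Re s + r)) \<in> borel_measurable ?M"
      using int(1) integrable_lebesgue_on_iff[OF S(1)] by (metis borel_measurable_integrable)
    hence "(\<lambda>x. (u x * x powr (Re s + r)) * x powr (- (Re s + r))) \<in> borel_measurable ?M"
      by measurable
    thus ?thesis
      by (rule measurable_cong[THEN iffD1, rotated]) (use pos in \<open>auto simp: mult.assoc powr_add[symmetric] simp del: minus_add_distrib\<close>)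
  qed
  have gm: "ln \<in> borel_measurable ?M" by measurable
  have fm: "f \<in> borel_measurable ?M"
  proof -
    have "(\<lambda>x. complex_of_real (u x) * exp (s * of_real (ln x))) \<in> borel_measurable ?M"
      using um by measurable
    thus ?thesis
      by (rule measurable_cong[THEN iffD1, rotated]) (use pos in \<open>auto simp: f_def powr_def Ln_of_real\<close>)
  qed
  have nf: "norm (f x) = \<bar>u x\<bar> * x powr (Re s)" if "x \<in> space ?M" for x
    using pos[OF that] by (simp add: f_def norm_mult norm_powr_real_powr)
  have "integrable ?M (\<lambda>x. \<bar>u x * x powr (Re s + r)\<bar> + \<bar>u x * x powr (Re s - r)\<bar>)"
    using int integrable_lebesgue_on_iff[OF S(1)]
    by (intro Bochner_Integration.integrable_add integrable_abs) auto
  hence I: "integrable ?M (\<lambda>x. norm (f x) * exp (r * \<bar>ln x\<bar>))"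
  proof (rule Bochner_Integration.integrable_bound)
    show "(\<lambda>x. norm (f x) * exp (r * \<bar>ln x\<bar>)) \<in> borel_measurable ?M" using fm by measurable
    show "AE x in ?M. norm (norm (f x) * exp (r * \<bar>ln x\<bar>))
            \<le> norm (\<bar>u x * x powr (Re s + r)\<bar> + \<bar>u x * x powr (Re s - r)\<bar>)"
    proof (rule AE_I2)
      fix x assume x: "x \<in> space ?M"
      have "exp (r * \<bar>ln x\<bar>) \<le> x powr r + x powr (-r)"
        using pos[OF x] by (cases "ln x \<ge> 0") (auto simp: powr_def)
      hence "\<bar>u x\<bar> * x powr (Re s) * exp (r * \<bar>ln x\<bar>) \<le> \<bar>u x\<bar> * x powr (Re s) * (x powr r + x powr (-r))"
        by (intro mult_left_mono) auto
      also have "\<dots> = \<bar>u x * x powr (Re s + r)\<bar> + \<bar>u x * x powr (Re s - r)\<bar>"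
        using powr_add[of x "Re s" r] powr_add[of x "Re s" "-r"] by (simp add: abs_mult algebra_simps)
      finally show "norm (norm (f x) * exp (r * \<bar>ln x\<bar>))
            \<le> norm (\<bar>u x * x powr (Re s + r)\<bar> + \<bar>u x * x powr (Re s - r)\<bar>)"
        using nf[OF x] by (simp add: abs_mult)
    qed
  qed
  have cong: "f x * exp (w * of_real (ln x)) = of_real (u x) * of_real x powr (s + w)" if "x \<in> S" for x
    using that S by (auto simp: f_def of_real_powr_add_exp)
  note E = exp_moment_expansion[OF fm gm I w]
  have E1: "integrable ?M (\<lambda>x. of_real (u x) * complex_of_real x powr (s + w))"
    using E(1) by (subst (asm) Bochner_Integration.integrable_cong[OF refl cong]) (auto simp: sp)
  thus "(\<lambda>x. of_real (u x) * complex_of_real x powr (s + w)) absolutely_integrable_on S"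
    using integrable_lebesgue_on_iff[OF S(1)] by blast
  have I2: "(\<integral>x. f x * exp (w * of_real (ln x)) \<partial>?M) = integral S (\<lambda>x. of_real (u x) * of_real x powr (s + w))"
    using lebesgue_integral_eq_integral[OF E1 S(1)]
      Bochner_Integration.integral_cong[OF refl cong, of ?M] sp by simp
  have I3: "(\<integral>x. f x * of_real (ln x) ^ k \<partial>?M) / fact k * w ^ k
       = integral S (\<lambda>x. of_real (u x) * of_real x powr s * of_real (ln x) ^ k) / fact k * w ^ k" for k
  \<comment> \<open>For w = 0 and k > 0 both sides vanish, and the k-th moment need not exist.\<close>
  proof (cases "w = 0 \<and> k > 0")
    case False
    have "integrable ?M (\<lambda>x. f x * of_real (ln x) ^ k)"
    proof (cases "k = 0")
      case True
      show ?thesis unfolding True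
        by (rule Bochner_Integration.integrable_bound[OF I])
           (use fm r in \<open>auto intro!: AE_I2 simp: mult_le_cancel_left1\<close>)
    next
      case k: False
      with False have "norm w > 0" by simp
      with w have r: "r > 0" by linarith
      have "integrable ?M (\<lambda>x. fact k / r ^ k * (norm (f x) * exp (r * \<bar>ln x\<bar>)))"
        using I by simp
      thus ?thesis
      proof (rule Bochner_Integration.integrable_bound)
        show "AE x in ?M. norm (f x * of_real (ln x) ^ k) \<le> norm (fact k / r ^ k * (norm (f x) * exp (r * \<bar>ln x\<bar>)))"
        proof (rule AE_I2)
          fix x
          have "(r * \<bar>ln x\<bar>) ^ k / fact k \<le> (\<Sum>j<Suc k. (r * \<bar>ln x\<bar>) ^ j / fact j)"
            using r by (simp add: sum_nonneg)
          also have "\<dots> \<le> exp (r * \<bar>ln x\<bar>)" using r by (intro sum_exp_le) auto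
          finally have "\<bar>ln x\<bar> ^ k \<le> fact k / r ^ k * exp (r * \<bar>ln x\<bar>)"
            using r by (simp add: field_simps power_mult_distrib)
          hence "norm (f x) * \<bar>ln x\<bar> ^ k \<le> norm (f x) * (fact k / r ^ k * exp (r * \<bar>ln x\<bar>))"
            by (intro mult_left_mono) auto
          thus "norm (f x * of_real (ln x) ^ k) \<le> norm (fact k / r ^ k * (norm (f x) * exp (r * \<bar>ln x\<bar>)))"
            using r by (simp add: norm_mult norm_power algebra_simps)
        qed
      qed (use fm in measurable)
    qed
    from lebesgue_integral_eq_integral[OF this S(1)] show ?thesis by (simp add: f_def)
  qed auto
  show "(\<lambda>k. integral S (\<lambda>x. of_real (u x) * of_real x powr s * of_real (ln x) ^ k) / fact k * w ^ k) sums
           integral S (\<lambda>x. of_real (u x) * of_real x powr (s + w))"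
    using E(2) unfolding I2 I3 .
qed

lemma mellin_holomorphic:
  fixes u :: "real \<Rightarrow> real"
  assumes S: "S \<in> sets lebesgue" "S \<subseteq> {0<..}" and T: "open T"
    and int: "\<And>\<sigma>. \<sigma> \<in> T \<Longrightarrow> (\<lambda>x. u x * x powr \<sigma>) absolutely_integrable_on S"
  shows "(\<lambda>s. integral S (\<lambda>x. of_real (u x) * of_real x powr s)) holomorphic_on {s. Re s \<in> T}"
proof -
  let ?F = "\<lambda>s. integral S (\<lambda>x. of_real (u x) * complex_of_real x powr s)"
  have "?F field_differentiable at s" if s: "Re s \<in> T" for s
  proof -
    obtain r where r: "r > 0" "cball (Re s) r \<subseteq> T" using T s open_contains_cball by blast
    have "?F holomorphic_on ball s r"
    proof (rule power_series_holomorphic)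
      fix z assume z: "z \<in> ball s r"
      have "Re s + r \<in> T" "Re s - r \<in> T" using r by (auto simp: dist_norm)
      from mellin_expansion(2)[OF S int[OF this(1)] int[OF this(2)], of "z - s"] r z
      show "(\<lambda>k. (integral S (\<lambda>x. of_real (u x) * of_real x powr s * of_real (ln x) ^ k) / fact k) * (z - s) ^ k) sums ?F z"
        by (simp add: dist_norm norm_minus_commute)
    qed
    thus ?thesis using r by (intro holomorphic_on_imp_differentiable_at[of _ "ball s r"]) auto
  qed
  thus ?thesis by (auto simp: holomorphic_on_def field_differentiable_at_within)
qed

lemma has_integral_sums_nonneg:
  fixes f :: "nat \<Rightarrow> 'n::euclidean_space \<Rightarrow> real"
  assumes "\<And>k. (f k has_integral I k) S" "\<And>k x. x \<in> S \<Longrightarrow> 0 \<le> f k x" "I sums J"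
    "\<And>x. x \<in> S \<Longrightarrow> (\<lambda>k. f k x) sums F x"
  shows "(F has_integral J) S"
proof (rule has_integral_monotone_convergence_increasing)
  show "((\<lambda>x. \<Sum>k<n. f k x) has_integral (\<Sum>k<n. I k)) S" for n
    by (intro has_integral_sum assms) auto
qed (use assms in \<open>auto simp: sums_def\<close>)

section \<open>Partial fractions and real Mellin integrals\<close>

text \<open>
  The function 1/(e^x - 1) without its polar and constant term at 0, hence of size O(x) there.
\<close>
definition planck :: "real \<Rightarrow> real" where
  "planck x = 1 / (exp x - 1) - 1 / x + 1 / 2"

lemma Digamma_reflection:
  fixes z :: complex
  assumes z: "z \<notin> \<int>"
  shows "Digamma z - Digamma (1 - z) = - of_real pi * cos (of_real pi * z) / sin (of_real pi * z)"
proof -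
  have z': "z \<notin> \<int>\<^sub>\<le>\<^sub>0" "1 - z \<notin> \<int>\<^sub>\<le>\<^sub>0"
    using z nonpos_Ints_Int[of z] nonpos_Ints_Int[of "1 - z"] Ints_diff[of 1 "1 - z"] by auto
  have sn: "sin (of_real pi * z) \<noteq> 0"
  proof
    assume "sin (of_real pi * z) = 0"
    then obtain n where "of_real pi * z = of_real (of_int n * pi)" by (auto simp: sin_eq_0)
    hence "z = of_int n" by simp
    thus False using z by simp
  qed
  have "((\<lambda>z. Gamma z * Gamma (1 - z)) has_field_derivative
          (Gamma z * Gamma (1 - z) * (Digamma z - Digamma (1 - z)))) (at z)"
    by (rule derivative_eq_intros refl z' | simp add: algebra_simps)+
  moreover have "((\<lambda>z. of_real pi / sin (of_real pi * z)) has_field_derivative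
         (of_real pi / sin (of_real pi * z) * (- of_real pi * cos (of_real pi * z) / sin (of_real pi * z)))) (at z)"
    using sn by (auto intro!: derivative_eq_intros)
  ultimately have "Gamma z * Gamma (1 - z) * (Digamma z - Digamma (1 - z))
     = of_real pi / sin (of_real pi * z) * (- of_real pi * cos (of_real pi * z) / sin (of_real pi * z))"
    unfolding Gamma_reflection_complex by (rule DERIV_unique)
  thus ?thesis unfolding Gamma_reflection_complex using sn by (subst (asm) mult_cancel_left) auto
qed

text \<open>
  Partial fraction expansion. It is the one of the cotangent, in the variable z = i x / (2 \<pi>); the
  cotangent enters through the reflection formula of the digamma function, whose series supplies
  the fractions.
\<close>
lemma planck_sums:
  assumes x: "x > 0"
  shows "(\<lambda>n. 2 * x / (x\<^sup>2 + (2 * pi * real (Suc n))\<^sup>2)) sums planck x"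
proof -
  define y where "y = x / (2 * pi)"
  have y: "y > 0" using x by (simp add: y_def)
  define z where "z = \<i> * of_real y"
  have zI: "z \<notin> \<int>" using y by (auto simp: z_def Ints_def complex_eq_iff)
  have z0: "z \<noteq> 0" "1 - z \<noteq> 0" using zI by auto
  have "(\<lambda>k. (inverse (of_nat (Suc k)) - inverse (z + of_nat k)) - (inverse (of_nat (Suc k)) - inverse (1 - z + of_nat k)))
          sums ((\<Sum>k. inverse (of_nat (Suc k)) - inverse (z + of_nat k)) - (\<Sum>k. inverse (of_nat (Suc k)) - inverse (1 - z + of_nat k)))"
    by (intro sums_diff summable_sums summable_Digamma z0)
  hence "(\<lambda>k. inverse (1 - z + of_nat k) - inverse (z + of_nat k)) sums (Digamma z - Digamma (1 - z))"
    by (simp add: Digamma_def)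
  moreover have "(\<lambda>k. inverse (z + of_nat (Suc k)) - inverse (z + of_nat k)) sums (0 - inverse (z + of_nat 0))"
    by (intro telescope_sums filterlim_compose[OF tendsto_inverse_0]
              tendsto_add_filterlim_at_infinity[OF tendsto_const] tendsto_of_nat)
  ultimately have "(\<lambda>k. (inverse (1 - z + of_nat k) - inverse (z + of_nat k)) -
           (inverse (z + of_nat (Suc k)) - inverse (z + of_nat k))) sums
           ((Digamma z - Digamma (1 - z)) - (0 - inverse (z + of_nat 0)))"
    by (rule sums_diff)
  hence "(\<lambda>k. inverse (1 - z + of_nat k) - inverse (z + of_nat (Suc k))) sums
          (- of_real pi * cos (of_real pi * z) / sin (of_real pi * z) + inverse z)"
    by (simp add: Digamma_reflection[OF zI] del: of_nat_Suc)
  also have "(\<lambda>k. inverse (1 - z + of_nat k) - inverse (z + of_nat (Suc k)))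
     = (\<lambda>k. 2 * pi * \<i> * of_real (2 * x / (x\<^sup>2 + (2 * pi * real (Suc k))\<^sup>2)))"
  proof
    fix k :: nat
    define m where "m = real (Suc k)"
    have m: "m > 0" by (simp add: m_def)
    have nz: "of_real m - z \<noteq> 0" "of_real m + z \<noteq> 0"
      using m by (auto simp: z_def complex_eq_iff)
    have pr: "(of_real m - z) * (of_real m + z) = of_real (m\<^sup>2 + y\<^sup>2)"
      by (simp add: z_def algebra_simps power2_eq_square)
    have "inverse (1 - z + of_nat k) - inverse (z + of_nat (Suc k)) = inverse (of_real m - z) - inverse (of_real m + z)"
      by (simp add: m_def algebra_simps)
    also have "\<dots> = 2 * z / ((of_real m - z) * (of_real m + z))"
      using nz by (simp add: field_simps)
    also have "\<dots> = 2 * \<i> * of_real (y / (m\<^sup>2 + y\<^sup>2))"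
      unfolding pr by (simp add: z_def)
    also have "y / (m\<^sup>2 + y\<^sup>2) = 2 * pi * x / (x\<^sup>2 + (2 * pi * m)\<^sup>2)"
    proof -
      have "x = 2 * pi * y" by (simp add: y_def)
      hence "x\<^sup>2 + (2 * pi * m)\<^sup>2 = (2 * pi)\<^sup>2 * (m\<^sup>2 + y\<^sup>2)" by (simp add: algebra_simps power2_eq_square)
      moreover have "2 * pi * x = (2 * pi)\<^sup>2 * y" by (simp add: y_def power2_eq_square)
      ultimately show ?thesis by simp
    qed
    finally show "inverse (1 - z + of_nat k) - inverse (z + of_nat (Suc k)) = 2 * pi * \<i> * of_real (2 * x / (x\<^sup>2 + (2 * pi * real (Suc k))\<^sup>2))"
      by (simp add: m_def)
  qed
  also have "- of_real pi * cos (of_real pi * z) / sin (of_real pi * z) + inverse z = 2 * pi * \<i> * of_real (planck x)"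
  proof -
    define e where "e = exp (x / 2)"
    have e: "e > 1" using x by (simp add: e_def)
    have ex: "exp x = e * e" by (simp add: e_def flip: exp_add)
    have pz: "of_real pi * z = \<i> * of_real (x / 2)" by (simp add: z_def y_def)
    have e1: "exp (\<i> * (\<i> * of_real (x / 2))) = of_real (inverse e)"
      by (simp add: e_def exp_minus exp_of_real flip: mult.assoc of_real_divide of_real_minus of_real_inverse)
    have e2: "exp (- (\<i> * (\<i> * of_real (x / 2)))) = of_real e"
      using e1 e by (simp add: exp_minus)
    have c: "cos (of_real pi * z) = of_real ((inverse e + e) / 2)"
      unfolding pz cos_exp_eq e1 e2 by simp
    have s: "sin (of_real pi * z) = of_real ((inverse e - e) / 2) / \<i>"
      unfolding sin_exp_eq pz e1 e2 by simp
    have ne: "e * e \<noteq> 1" "inverse e - e \<noteq> 0" using e less_1_mult[OF e e] inverse_less_1_iff[of e] by linarith+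
    have "- of_real pi * cos (of_real pi * z) / sin (of_real pi * z)
            = - \<i> * of_real (pi * ((inverse e + e) / 2) / ((inverse e - e) / 2))"
    proof -
      have *: "- p * a / (b / \<i>) = - \<i> * (p * a / b)" if "b \<noteq> 0" for p a b :: complex
        using that by (simp add: field_simps)
      show ?thesis unfolding c s by (subst *) (use ne in \<open>auto simp del: of_real_diff simp flip: of_real_mult of_real_divide\<close>)
    qed
    also have "pi * ((inverse e + e) / 2) / ((inverse e - e) / 2) = - (2 * pi * (1 / (e * e - 1) + 1/2))"
      using ne e by (simp add: divide_simps) (simp add: algebra_simps)
    finally have 1: "- of_real pi * cos (of_real pi * z) / sin (of_real pi * z) =
      - \<i> * of_real (- (2 * pi * (1 / (e * e - 1) + 1/2)))" .
    have 2: "inverse z = - \<i> * of_real (2 * pi / x)"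
      using x by (simp add: z_def y_def field_simps)
    have 3: "planck x = 1 / (e * e - 1) + 1/2 - 1 / x" by (simp add: planck_def ex)
    show ?thesis unfolding 1 2 3 by (simp add: algebra_simps)
  qed
  finally have "(\<lambda>k. (1 / (2 * pi * \<i>)) * (2 * pi * \<i> * of_real (2 * x / (x\<^sup>2 + (2 * pi * real (Suc k))\<^sup>2)))) sums
      ((1 / (2 * pi * \<i>)) * (2 * pi * \<i> * of_real (planck x)))"
    by (rule sums_mult)
  hence "(\<lambda>k. complex_of_real (2 * x / (x\<^sup>2 + (2 * pi * real (Suc k))\<^sup>2))) sums of_real (planck x)"
    by (simp del: of_nat_Suc of_real_divide of_real_add of_real_mult of_real_power)
  thus ?thesis by (simp only: sums_of_real_iff)
qed

lemma planck_bounds: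
  assumes x: "x > 0"
  shows "0 \<le> planck x" "planck x \<le> x / 12"
proof -
  note s = planck_sums[OF x]
  have "0 \<le> (\<Sum>n. 2 * x / (x\<^sup>2 + (2 * pi * real (Suc n))\<^sup>2))"
    using x by (intro suminf_nonneg sums_summable[OF s]) auto
  thus "0 \<le> planck x" using s by (simp add: sums_iff)
  have pi2: "(\<lambda>n. 1 / real (Suc n) ^ 2) sums (pi\<^sup>2 / 6)" using inverse_squares_sums by (simp add: add_ac)
  have "(\<lambda>n. x / (2 * pi\<^sup>2) * (1 / real (Suc n) ^ 2)) sums (x / (2 * pi\<^sup>2) * (pi\<^sup>2 / 6))"
    by (rule sums_mult[OF pi2])
  hence t: "(\<lambda>n. x / (2 * pi\<^sup>2) * (1 / real (Suc n) ^ 2)) sums (x / 12)" by simp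
  show "planck x \<le> x / 12"
  proof (rule sums_le[OF _ s t])
    fix n
    have "2 * x / (x\<^sup>2 + (2 * pi * real (Suc n))\<^sup>2) \<le> 2 * x / ((2 * pi * real (Suc n))\<^sup>2)"
      using x by (intro divide_left_mono mult_pos_pos add_nonneg_pos) auto
    also have "\<dots> = x / (2 * pi\<^sup>2) * (1 / real (Suc n) ^ 2)"
      by (simp add: power_mult_distrib field_simps del: of_nat_Suc)
    finally show "2 * x / (x\<^sup>2 + (2 * pi * real (Suc n))\<^sup>2) \<le> x / (2 * pi\<^sup>2) * (1 / real (Suc n) ^ 2)" .
  qed
qed

lemma has_integral_scale:
  fixes f :: "real \<Rightarrow> real"
  assumes f: "(f has_integral I) {0<..}" "\<And>x. x > 0 \<Longrightarrow> f x \<ge> 0" and c: "c > 0"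
  shows "((\<lambda>x. f (c * x)) has_integral I / c) {0<..}"
proof -
  have im: "(\<lambda>x. c * x) ` {0<..} = {0<..}"
  proof safe
    fix x :: real assume "x > 0"
    thus "x \<in> (*) c ` {0<..}" using c by (intro image_eqI[of _ _ "x / c"]) auto
  qed (use c in auto)
  have "f absolutely_integrable_on {0<..} \<and> integral {0<..} f = I"
    using f by (auto intro!: nonnegative_absolutely_integrable_1)
  hence "(\<lambda>x. \<bar>c\<bar> * f (c * x)) absolutely_integrable_on {0<..} \<and> integral {0<..} (\<lambda>x. \<bar>c\<bar> * f (c * x)) = I"
    by (subst has_absolute_integral_change_of_variables_1'[where g = "\<lambda>x. c * x" and g' = "\<lambda>_. c" and f = f]) (use c im in \<open>auto intro!: derivative_eq_intros inj_onI\<close>)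
  hence "((\<lambda>x. c * f (c * x)) has_integral I) {0<..}"
    using c by (auto simp: has_integral_iff absolutely_integrable_on_def)
  from has_integral_mult_right[OF this, of "1 / c"] c show ?thesis by simp
qed

lemma Gamma_integral_scaled:
  assumes s: "s > (0::real)" and c: "c > 0"
  shows "((\<lambda>x. x powr (s - 1) * exp (- c * x)) has_integral (Gamma s * c powr (-s))) {0<..}"
proof -
  have "((\<lambda>t. if t \<in> {0<..} then t powr (s - 1) / exp t else 0) has_integral Gamma s) {0..}"
    by (rule has_integral_spike[of "{0}", rotated 2, OF Gamma_integral_real[OF s]]) auto
  hence "((\<lambda>t. t powr (s - 1) / exp t) has_integral Gamma s) {0<..}"
    by (subst (asm) has_integral_restrict) auto
  from has_integral_mult_right[OF has_integral_scale[OF this _ c], of "c powr (1 - s)"]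
  have "((\<lambda>x. c powr (1 - s) * ((c * x) powr (s - 1) / exp (c * x))) has_integral (c powr (1 - s) * (Gamma s / c))) {0<..}"
    by auto
  also have "c powr (1 - s) * (Gamma s / c) = Gamma s * c powr (-s)"
    using c powr_diff[of c "-s" "-1"] by (simp add: powr_minus field_simps)
  finally show ?thesis
    by (rule has_integral_eq[rotated])
       (use c in \<open>auto simp: powr_mult exp_minus field_simps powr_diff\<close>)
qed

lemma Beta_integral_halfline:
  assumes s: "-1 < s" "s < (1::real)"
  shows "((\<lambda>u. 2 * u powr s / (1 + u\<^sup>2)) has_integral (pi / cos (pi * s / 2))) {0<..}"
proof -
  define a b where "a = (1 + s) / 2" and "b = (1 - s) / 2"
  have ab: "a > 0" "b > 0" "b = 1 - a" using s by (simp_all add: a_def b_def diff_divide_distrib add_divide_distrib)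
  define f where "f = (\<lambda>t::real. t powr (a - 1) * (1 - t) powr (b - 1))"
  define g where "g = (\<lambda>u::real. u\<^sup>2 / (1 + u\<^sup>2))"
  define g' where "g' = (\<lambda>u::real. 2 * u / (1 + u\<^sup>2)\<^sup>2)"
  have p: "1 + u\<^sup>2 > 0" for u :: real by (simp add: add_pos_nonneg)
  have "Beta a b = pi / cos (pi * s / 2)"
  proof -
    have "complex_of_real (Gamma a * Gamma (1 - a)) = of_real (pi / sin (pi * a))"
    proof -
      have "complex_of_real (Gamma a * Gamma (1 - a)) = Gamma (of_real a) * Gamma (of_real (1 - a))"
        by (simp only: Gamma_complex_of_real of_real_mult)
      also have "\<dots> = of_real pi / sin (of_real (pi * a))"
        using Gamma_reflection_complex[of "of_real a"] by simp
      also have "\<dots> = of_real (pi / sin (pi * a))" by (simp only: sin_of_real of_real_divide)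
      finally show ?thesis .
    qed
    hence "Gamma a * Gamma (1 - a) = pi / sin (pi * a)" by (simp only: of_real_eq_iff)
    moreover have "sin (pi * a) = cos (pi * s / 2)"
      using sin_add[of "pi / 2" "pi * s / 2"] by (simp add: a_def field_simps)
    ultimately show ?thesis using ab by (simp add: Beta_def)
  qed
  with has_integral_Beta_real[OF ab(1,2)] have "(f has_integral (pi / cos (pi * s / 2))) {0..1}"
    by (simp add: f_def)
  hence f: "(f has_integral (pi / cos (pi * s / 2))) {0<..<1}" by (simp add: has_integral_Icc_iff_Ioo)
  have im: "g ` {0<..} = {0<..<1}"
  proof (intro equalityI subsetI)
    fix t :: real assume "t \<in> {0<..<1}"
    hence t: "t > 0" "t < 1" by auto
    hence "g (sqrt (t / (1 - t))) = t" by (simp add: g_def field_simps)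
    moreover have "sqrt (t / (1 - t)) > 0" using t by simp
    ultimately show "t \<in> g ` {0<..}" by (metis greaterThan_iff image_eqI)
  qed (auto simp: g_def p)
  have inj: "inj_on g {0<..}"
  proof (rule inj_onI)
    fix u v :: real assume uv: "u \<in> {0<..}" "v \<in> {0<..}" "g u = g v"
    hence "u\<^sup>2 * (1 + v\<^sup>2) = v\<^sup>2 * (1 + u\<^sup>2)" using p[of u] p[of v] by (simp add: g_def field_simps)
    hence "u\<^sup>2 = v\<^sup>2" by (simp add: algebra_simps)
    thus "u = v" using uv by (simp add: power2_eq_iff_nonneg)
  qed
  have "f absolutely_integrable_on (g ` {0<..}) \<and> integral (g ` {0<..}) f = pi / cos (pi * s / 2)"
    unfolding im using f by (auto intro!: nonnegative_absolutely_integrable_1 simp: f_def)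
  hence "(\<lambda>x. \<bar>g' x\<bar> * f (g x)) absolutely_integrable_on {0<..} \<and> integral {0<..} (\<lambda>x. \<bar>g' x\<bar> * f (g x)) = pi / cos (pi * s / 2)"
  proof (subst has_absolute_integral_change_of_variables_1'[where g = g and g' = g' and f = f])
    show "(g has_field_derivative g' x) (at x within {0<..})" for x
      unfolding g_def g'_def using p[of x]
      by (auto intro!: derivative_eq_intros simp: field_simps power2_eq_square)
  qed (use inj in auto)
  hence "((\<lambda>x. \<bar>g' x\<bar> * f (g x)) has_integral (pi / cos (pi * s / 2))) {0<..}"
    by (auto simp: has_integral_iff absolutely_integrable_on_def)
  thus ?thesis
  proof (rule has_integral_eq[rotated])
    fix u :: real assume "u \<in> {0<..}"
    hence u: "u > 0" by auto
    have 1: "1 - g u = 1 / (1 + u\<^sup>2)" using p[of u] by (simp add: g_def field_simps)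
    have "f (g u) = (u\<^sup>2) powr (a - 1) * (1 + u\<^sup>2) powr (- (a - 1) - (b - 1))"
    proof -
      have "(x / v) powr A * (1 / v) powr B = x powr A * v powr (- A - B)" if "x \<ge> 0" "v > 0" for x v A B :: real
        using that by (simp add: powr_divide powr_diff powr_minus field_simps)
      from this[of "u\<^sup>2" "1 + u\<^sup>2"] p[of u] show ?thesis unfolding f_def 1 unfolding g_def by simp
    qed
    also have "- (a - 1) - (b - 1) = 1" using ab by simp
    also have "(u\<^sup>2) powr (a - 1) = u powr (s - 1)"
    proof -
      have "2 * (a - 1) = s - 1" by (simp add: a_def field_simps)
      thus ?thesis using u powr_powr[of u 2 "a - 1"] by (simp add: powr_numeral)
    qed
    finally have "f (g u) = u powr (s - 1) * (1 + u\<^sup>2)" using p[of u] by simp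
    moreover have "u * u powr (s - 1) = u powr s" using u powr_add[of u 1 "s - 1"] by simp
    ultimately show "\<bar>g' u\<bar> * f (g u) = 2 * u powr s / (1 + u\<^sup>2)"
      using u p[of u] by (simp add: g'_def power2_eq_square abs_mult divide_simps)
  qed
qed

lemma Beta_integral_scaled:
  assumes s: "-1 < s" "s < (1::real)" and c: "c > 0"
  shows "((\<lambda>x. 2 * x powr s / (x\<^sup>2 + c\<^sup>2)) has_integral (c powr (s - 1) * (pi / cos (pi * s / 2)))) {0<..}"
proof -
  have ic: "1 / c > 0" using c by simp
  have "((\<lambda>x. c powr (s - 2) * (2 * (1 / c * x) powr s / (1 + (1 / c * x)\<^sup>2))) has_integral
      (c powr (s - 2) * (pi / cos (pi * s / 2) / (1 / c)))) {0<..}"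
    by (intro has_integral_mult_right has_integral_scale[OF Beta_integral_halfline[OF s] _ ic]) auto
  also have "c powr (s - 2) * (pi / cos (pi * s / 2) / (1 / c)) = c powr (s - 1) * (pi / cos (pi * s / 2))"
    using c powr_add[of c "s - 2" 1] by simp
  finally show ?thesis
  proof (rule has_integral_eq[rotated])
    fix x :: real assume "x \<in> {0<..}"
    hence x: "x > 0" by auto
    have p: "x\<^sup>2 + c\<^sup>2 > 0" using x by (simp add: add_pos_nonneg)
    have "(1 / c * x) powr s = x powr s * c powr (-s)"
      using c x by (simp add: powr_divide powr_minus field_simps)
    moreover have "c powr (s - 2) * c powr (-s) = 1 / c\<^sup>2"
      proof -
      have "c powr (s - 2) * c powr (-s) = c powr (-2)" by (simp only: powr_add[symmetric]) simp
      thus ?thesis using c by (simp add: powr_minus powr_numeral divide_inverse)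
    qed
    moreover have "1 + (1 / c * x)\<^sup>2 = (x\<^sup>2 + c\<^sup>2) / c\<^sup>2" using c by (simp add: field_simps)
    ultimately show "c powr (s - 2) * (2 * (1 / c * x) powr s / (1 + (1 / c * x)\<^sup>2)) = 2 * x powr s / (x\<^sup>2 + c\<^sup>2)"
      using c p by (simp add: field_simps)
  qed
qed

section \<open>The functional equation\<close>

lemma powr_integral_0_1:
  assumes "a > (-1::real)"
  shows "((\<lambda>x. x powr a) has_integral 1 / (a + 1)) {0<..1}"
proof -
  have "((\<lambda>x. x powr a) has_integral 1 / (a + 1)) {0..1}"
    using has_integral_powr_from_0[OF assms, of 1] by simp
  thus ?thesis
    by (rule has_integral_spike_set_eq[THEN iffD1, rotated 2]) (auto intro: negligible_subset[of "{0}"])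
qed

text \<open>
  The Mellin transform of 1/(e^x - 1), by expansion into the geometric series of e^(-x).
\<close>
lemma bose_integral:
  assumes s: "s > (1::real)"
  shows "((\<lambda>x. 1 / (exp x - 1) * x powr (s - 1)) has_integral (Gamma s * (\<Sum>k. real (Suc k) powr (-s)))) {0<..}"
proof (rule has_integral_sums_nonneg)
  show "((\<lambda>x. x powr (s - 1) * exp (- real (Suc k) * x)) has_integral (Gamma s * real (Suc k) powr (-s))) {0<..}" for k
    using s by (intro Gamma_integral_scaled) auto
  show "(\<lambda>k. Gamma s * real (Suc k) powr - s) sums (Gamma s * (\<Sum>k. real (Suc k) powr - s))"
    using s by (intro sums_mult summable_sums summable_Suc_powr)
  fix x :: real assume "x \<in> {0<..}"
  hence x: "x > 0" by auto
  have "(\<lambda>k. exp (-x) ^ k) sums (1 / (1 - exp (-x)))" by (rule geometric_sums) (use x in auto)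
  hence "(\<lambda>k. x powr (s - 1) * exp (-x) * exp (-x) ^ k) sums (x powr (s - 1) * exp (-x) * (1 / (1 - exp (-x))))"
    by (rule sums_mult)
  also have "x powr (s - 1) * exp (-x) * (1 / (1 - exp (-x))) = 1 / (exp x - 1) * x powr (s - 1)"
    using x by (simp add: exp_minus field_simps)
  also have "(\<lambda>k. x powr (s - 1) * exp (-x) * exp (-x) ^ k) = (\<lambda>k. x powr (s - 1) * exp (- real (Suc k) * x))"
  proof
    fix k :: nat
    have "exp (- real (Suc k) * x) = exp (-x + real k * (-x))" by (simp add: algebra_simps)
    also have "\<dots> = exp (-x) * exp (-x) ^ k" by (simp only: exp_add exp_of_nat_mult)
    finally show "x powr (s - 1) * exp (-x) * exp (-x) ^ k = x powr (s - 1) * exp (- real (Suc k) * x)"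
      by (simp only: mult.assoc)
  qed
  finally show "(\<lambda>k. x powr (s - 1) * exp (- real (Suc k) * x)) sums (1 / (exp x - 1) * x powr (s - 1))" .
qed auto

text \<open>
  The Mellin transform of the same function minus its terms at 0, to the left of 0, by
  partial fractions. Comparison with the previous lemma is the functional equation.
\<close>
lemma planck_integral:
  assumes s: "-1 < s" "s < (0::real)"
  shows "((\<lambda>x. planck x * x powr (s - 1)) has_integral
     ((2 * pi) powr (s - 1) * (pi / cos (pi * s / 2)) * (\<Sum>k. real (Suc k) powr (s - 1)))) {0<..}"
proof (rule has_integral_sums_nonneg)
  show "((\<lambda>x. 2 * x powr s / (x\<^sup>2 + (2 * pi * real (Suc k))\<^sup>2)) has_integral
      ((2 * pi * real (Suc k)) powr (s - 1) * (pi / cos (pi * s / 2)))) {0<..}" for k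
    using s by (intro Beta_integral_scaled) auto
  have "summable (\<lambda>k. real (Suc k) powr (s - 1))" using summable_Suc_powr[of "1 - s"] s by simp
  hence "(\<lambda>k. (2 * pi) powr (s - 1) * (pi / cos (pi * s / 2)) * real (Suc k) powr (s - 1)) sums
     ((2 * pi) powr (s - 1) * (pi / cos (pi * s / 2)) * (\<Sum>k. real (Suc k) powr (s - 1)))"
    by (intro sums_mult summable_sums)
  thus "(\<lambda>k. (2 * pi * real (Suc k)) powr (s - 1) * (pi / cos (pi * s / 2))) sums
     ((2 * pi) powr (s - 1) * (pi / cos (pi * s / 2)) * (\<Sum>k. real (Suc k) powr (s - 1)))"
    by (simp add: powr_mult mult_ac del: of_nat_Suc)
  fix x :: real assume "x \<in> {0<..}"
  hence x: "x > 0" by auto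
  have "x * x powr (s - 1) = x powr s" using x powr_add[of x 1 "s - 1"] by simp
  hence "2 * x / D * x powr (s - 1) = 2 * x powr s / D" for D by (metis mult.assoc times_divide_eq_left)
  with sums_mult2[OF planck_sums[OF x], of "x powr (s - 1)"]
  show "(\<lambda>k. 2 * x powr s / (x\<^sup>2 + (2 * pi * real (Suc k))\<^sup>2)) sums (planck x * x powr (s - 1))"
    by (simp only:)
qed auto

text \<open>
  The Mellin integrals over (0,1] and over [1,\<infinity>), with exponent s in place of s - 1. The second
  one is entire.
\<close>
definition planck_low :: "complex \<Rightarrow> complex" where
  "planck_low s = integral {0<..1} (\<lambda>x. of_real (planck x) * of_real x powr s)"

definition bose_high :: "complex \<Rightarrow> complex" where
  "bose_high s = integral {1..} (\<lambda>x. of_real (1 / (exp x - 1)) * of_real x powr s)"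

lemma planck_low_integrable:
  assumes "\<sigma> > (-2::real)"
  shows "(\<lambda>x. planck x * x powr \<sigma>) absolutely_integrable_on {0<..1}"
proof (rule measurable_bounded_by_integrable_imp_absolutely_integrable)
  show "(\<lambda>x. planck x * x powr \<sigma>) \<in> borel_measurable (lebesgue_on {0<..1})"
    unfolding planck_def by (intro continuous_imp_measurable_on_sets_lebesgue continuous_intros) auto
  show "(\<lambda>x. (1/12) * x powr (\<sigma> + 1)) integrable_on {0<..1}"
    using assms by (intro integrable_on_mult_right has_integral_integrable[OF powr_integral_0_1]) auto
  fix x :: real assume "x \<in> {0<..1}"
  hence x: "x > 0" by auto
  have "\<bar>planck x\<bar> * x powr \<sigma> \<le> (x / 12) * x powr \<sigma>"
    using planck_bounds[OF x] by (intro mult_right_mono) auto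
  also have "\<dots> = (1/12) * x powr (\<sigma> + 1)" using x by (simp add: powr_add)
  finally show "norm (planck x * x powr \<sigma>) \<le> (1/12) * x powr (\<sigma> + 1)" by (simp add: abs_mult)
qed auto

lemma bose_high_integrable:
  fixes \<sigma> :: real
  shows "(\<lambda>x. 1 / (exp x - 1) * x powr \<sigma>) absolutely_integrable_on {1..}"
proof (rule measurable_bounded_by_integrable_imp_absolutely_integrable)
  define s where "s = max 2 (\<sigma> + 1)"
  have "continuous_on {1..} (\<lambda>x::real. 1 / (exp x - 1) * x powr \<sigma>)"
    by (intro continuous_on_mult continuous_on_divide continuous_on_powr continuous_intros) auto
  thus "(\<lambda>x. 1 / (exp x - 1) * x powr \<sigma>) \<in> borel_measurable (lebesgue_on {1..})"
    by (rule continuous_imp_measurable_on_sets_lebesgue) auto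
  have "(\<lambda>x. 1 / (exp x - 1) * x powr (s - 1)) absolutely_integrable_on {0<..}"
    by (intro nonnegative_absolutely_integrable_1 has_integral_integrable[OF bose_integral]) (auto simp: s_def)
  hence "(\<lambda>x. 1 / (exp x - 1) * x powr (s - 1)) absolutely_integrable_on {1..}"
    by (rule set_integrable_subset) auto
  thus "(\<lambda>x. 1 / (exp x - 1) * x powr (s - 1)) integrable_on {1..}"
    by (simp add: absolutely_integrable_on_def)
  fix x :: real assume "x \<in> {1..}"
  thus "norm (1 / (exp x - 1) * x powr \<sigma>) \<le> 1 / (exp x - 1) * x powr (s - 1)"
    by (auto simp: s_def abs_mult intro!: divide_right_mono powr_mono)
qed auto

lemma mellin_of_real:
  assumes "((\<lambda>x. u x * x powr \<sigma>) has_integral I) S" "S \<subseteq> {0<..}"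
  shows "integral S (\<lambda>x. complex_of_real (u x) * of_real x powr of_real \<sigma>) = of_real I"
proof -
  have "((\<lambda>x. complex_of_real (u x * x powr \<sigma>)) has_integral of_real I) S"
    using has_integral_linear[OF assms(1) bounded_linear_of_real] by (simp add: o_def)
  hence "((\<lambda>x. complex_of_real (u x) * of_real x powr of_real \<sigma>) has_integral of_real I) S"
    by (rule has_integral_eq[rotated]) (use assms(2) in \<open>auto simp: powr_of_real\<close>)
  thus ?thesis by (rule integral_unique)
qed

text \<open>
  The continuation of \<Gamma>(s) zeta(s) to Re s > -1: the two rational summands are the integrals over
  (0,1] of x^(s-2) and of -x^(s-1)/2.
\<close>
definition gamma_zeta :: "complex \<Rightarrow> complex" where
  "gamma_zeta s = planck_low (s - 1) + bose_high (s - 1) + 1 / (s - 1) - 1 / (2 * s)"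

lemma holomorphic_gamma_zeta: "gamma_zeta holomorphic_on ({s. Re s > -1} - {0, 1})"
proof -
  have "planck_low holomorphic_on {s. Re s \<in> {-2<..}}"
    unfolding planck_low_def[abs_def]
    by (rule mellin_holomorphic; (rule planck_low_integrable)?) auto
  moreover have "bose_high holomorphic_on {s. Re s \<in> UNIV}"
    unfolding bose_high_def[abs_def]
    by (rule mellin_holomorphic; (rule bose_high_integrable)?) auto
  ultimately have "(\<lambda>s. planck_low (s - 1)) holomorphic_on ({s. Re s > -1} - {0, 1})"
                  "(\<lambda>s. bose_high (s - 1)) holomorphic_on ({s. Re s > -1} - {0, 1})"
    by (auto intro!: holomorphic_on_compose_gen[unfolded o_def, of "\<lambda>s. s - 1"] holomorphic_intros)
  thus ?thesis unfolding gamma_zeta_def[abs_def] by (intro holomorphic_intros) auto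
qed

lemma negligible_overlap: "negligible ({0<..1} \<inter> {1::real..})"
  by (rule negligible_subset[of "{1}"]) auto

lemma gamma_zeta_real_gt_1:
  assumes s: "s > (1::real)"
  shows "gamma_zeta (of_real s) = of_real (Gamma s * (\<Sum>k. real (Suc k) powr (-s)))"
proof -
  let ?k = "integral {0<..1} (\<lambda>x. planck x * x powr (s - 1))"
  let ?h = "integral {1..} (\<lambda>x. 1 / (exp x - 1) * x powr (s - 1))"
  have k: "((\<lambda>x. planck x * x powr (s - 1)) has_integral ?k) {0<..1}"
    using planck_low_integrable[of "s - 1"] s by (auto simp: absolutely_integrable_on_def)
  have h: "((\<lambda>x. 1 / (exp x - 1) * x powr (s - 1)) has_integral ?h) {1..}"
    using bose_high_integrable[of "s - 1"] by (auto simp: absolutely_integrable_on_def)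
  have "((\<lambda>x. planck x * x powr (s - 1) + x powr (s - 2) - 1/2 * x powr (s - 1)) has_integral (?k + 1 / (s - 2 + 1) - 1/2 * (1 / (s - 1 + 1)))) {0<..1}"
    using s by (intro has_integral_add has_integral_diff k powr_integral_0_1 has_integral_mult_right) auto
  hence "((\<lambda>x. 1 / (exp x - 1) * x powr (s - 1)) has_integral (?k + 1 / (s - 2 + 1) - 1/2 * (1 / (s - 1 + 1)))) {0<..1}"
  proof (rule has_integral_eq[rotated])
    fix x :: real assume "x \<in> {0<..1}"
    hence x: "x > 0" by auto
    have "x powr (s - 1) = x * x powr (s - 2)" using x powr_add[of x 1 "s - 2"] by simp
    thus "planck x * x powr (s - 1) + x powr (s - 2) - 1/2 * x powr (s - 1) = 1 / (exp x - 1) * x powr (s - 1)"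
      using x by (simp add: planck_def field_simps)
  qed
  from has_integral_Un[OF this h negligible_overlap]
  have "((\<lambda>x. 1 / (exp x - 1) * x powr (s - 1)) has_integral (?k + 1 / (s - 1) - 1 / (2 * s) + ?h)) ({0<..1} \<union> {1..})"
    by (simp add: algebra_simps)
  also have "{0<..1} \<union> {1..} = {0::real<..}" by auto
  finally have eq: "?k + 1 / (s - 1) - 1 / (2 * s) + ?h = Gamma s * (\<Sum>k. real (Suc k) powr (-s))"
    using bose_integral[OF s] has_integral_unique by blast
  have "gamma_zeta (of_real s) = of_real (?k + 1 / (s - 1) - 1 / (2 * s) + ?h)"
    using mellin_of_real[OF k] mellin_of_real[OF h]
    by (simp add: gamma_zeta_def planck_low_def bose_high_def subset_iff)
  thus ?thesis unfolding eq .
qed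

lemma gamma_zeta_real_neg:
  assumes s: "-1 < s" "s < (0::real)"
  shows "gamma_zeta (of_real s) = of_real ((2 * pi) powr (s - 1) * (pi / cos (pi * s / 2)) * (\<Sum>k. real (Suc k) powr (s - 1)))"
proof -
  let ?k = "integral {0<..1} (\<lambda>x. planck x * x powr (s - 1))"
  let ?h = "integral {1..} (\<lambda>x. 1 / (exp x - 1) * x powr (s - 1))"
  have k: "((\<lambda>x. planck x * x powr (s - 1)) has_integral ?k) {0<..1}"
    using planck_low_integrable[of "s - 1"] s by (auto simp: absolutely_integrable_on_def)
  have h: "((\<lambda>x. 1 / (exp x - 1) * x powr (s - 1)) has_integral ?h) {1..}"
    using bose_high_integrable[of "s - 1"] by (auto simp: absolutely_integrable_on_def)
  have p: "((\<lambda>x. x powr e) has_integral (- 1 / (e + 1))) {1..}" if "e < -1" for e :: real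
    using has_integral_powr_to_inf[OF that, of 1] by simp
  have "((\<lambda>x. 1 / (exp x - 1) * x powr (s - 1) - x powr (s - 2) + 1/2 * x powr (s - 1)) has_integral (?h - (- 1 / (s - 2 + 1)) + 1/2 * (- 1 / (s - 1 + 1)))) {1..}"
    using s by (intro has_integral_add has_integral_diff h p has_integral_mult_right) auto
  hence "((\<lambda>x. planck x * x powr (s - 1)) has_integral (?h - (- 1 / (s - 2 + 1)) + 1/2 * (- 1 / (s - 1 + 1)))) {1..}"
  proof (rule has_integral_eq[rotated])
    fix x :: real assume "x \<in> {1..}"
    hence x: "x > 0" by auto
    have "x powr (s - 1) = x * x powr (s - 2)" using x powr_add[of x 1 "s - 2"] by simp
    thus "1 / (exp x - 1) * x powr (s - 1) - x powr (s - 2) + 1/2 * x powr (s - 1) = planck x * x powr (s - 1)"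
      using x by (simp add: planck_def field_simps)
  qed
  from has_integral_Un[OF k this negligible_overlap]
  have "((\<lambda>x. planck x * x powr (s - 1)) has_integral (?k + 1 / (s - 1) - 1 / (2 * s) + ?h)) ({0<..1} \<union> {1..})"
    by (simp add: algebra_simps)
  also have "{0<..1} \<union> {1..} = {0::real<..}" by auto
  finally have eq: "?k + 1 / (s - 1) - 1 / (2 * s) + ?h = (2 * pi) powr (s - 1) * (pi / cos (pi * s / 2)) * (\<Sum>k. real (Suc k) powr (s - 1))"
    using planck_integral[OF s] has_integral_unique by blast
  have "gamma_zeta (of_real s) = of_real (?k + 1 / (s - 1) - 1 / (2 * s) + ?h)"
    using mellin_of_real[OF k] mellin_of_real[OF h]
    by (simp add: gamma_zeta_def planck_low_def bose_high_def subset_iff)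
  thus ?thesis unfolding eq .
qed

lemma suminf_powr_of_real:
  assumes "a > (1::real)"
  shows "of_real (\<Sum>k. real (Suc k) powr (-a)) = (\<Sum>k. of_nat (Suc k) powr (- of_real a) :: complex)"
proof -
  have "of_nat (Suc k) powr (- of_real a) = complex_of_real (real (Suc k) powr (-a))" for k
    using powr_of_real[of "real (Suc k)" "-a"] by simp
  thus ?thesis using suminf_of_real[OF summable_Suc_powr[OF assms], where ?'a = complex] by (simp only:)
qed

lemma of_real_islimpt:
  assumes "a < c" "c < (b::real)"
  shows "complex_of_real c islimpt (of_real ` {a<..<b})"
  unfolding islimpt_approachable
proof safe
  fix e :: real assume e: "e > 0"
  define x where "x = c + min (e / 2) ((b - c) / 2)"
  have "x \<in> {a<..<b}" "x \<noteq> c" "dist (complex_of_real x) (of_real c) < e"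
    using assms e by (auto simp: x_def dist_norm simp flip: of_real_diff) (auto simp: min_def field_simps split: if_splits)
  thus "\<exists>x'\<in>of_real ` {a<..<b}. x' \<noteq> complex_of_real c \<and> dist x' (complex_of_real c) < e" by auto
qed

lemma gamma_zeta_right:
  assumes "Re s > 0" "s \<noteq> 1"
  shows "gamma_zeta s = Gamma s * zeta_reg s / (s - 1)"
proof -
  let ?S = "{s. Re s > 0} - {1::complex}"
  have "gamma_zeta s - Gamma s * zeta_reg s / (s - 1) = 0"
  proof (rule analytic_continuation[where S = ?S and w = s and f = "\<lambda>s. gamma_zeta s - Gamma s * zeta_reg s / (s - 1)" and U = "of_real ` {1<..<3}" and \<xi> = "of_real 2"])
    show "(\<lambda>s. gamma_zeta s - Gamma s * zeta_reg s / (s - 1)) holomorphic_on ?S"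
      by (intro holomorphic_intros holomorphic_on_subset[OF holomorphic_gamma_zeta]
            holomorphic_on_subset[OF holomorphic_zeta_reg]) (auto elim!: nonpos_Ints_cases)
    show "connected ?S"
      by (rule connected_open_diff_countable)
         (auto simp: open_halfspace_Re_gt convex_connected convex_halfspace_Re_gt)
    show "open ?S" by (intro open_Diff open_halfspace_Re_gt) auto
    fix z :: complex assume "z \<in> of_real ` {1<..<3}"
    then obtain x where x: "z = of_real x" "x > 1" by auto
    hence "z \<noteq> 1" by simp
    have "zeta_reg z = (z - 1) * of_real (\<Sum>k. real (Suc k) powr (-x))"
      using x by (subst zeta_reg_eq) (simp_all only: suminf_powr_of_real, simp_all)
    thus "gamma_zeta z - Gamma z * zeta_reg z / (z - 1) = 0"
      using gamma_zeta_real_gt_1[OF x(2)] \<open>z \<noteq> 1\<close> by (simp add: x(1) Gamma_complex_of_real)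
  qed (use assms of_real_islimpt[of 1 2 3] in auto)
  thus ?thesis by simp
qed

lemma cos_half_pi_nz:
  assumes "-1 < Re s" "Re s < 1"
  shows "cos (of_real pi * s / 2) \<noteq> 0"
proof
  assume "cos (of_real pi * s / 2) = 0"
  then obtain n where n: "of_real pi * s / 2 = of_real (of_int n * pi) + of_real pi / 2"
    by (auto simp: cos_eq_0)
  have "of_real pi * s / 2 = of_real pi * ((2 * of_int n + 1) / 2)"
    unfolding n by (simp add: field_simps)
  hence "s = 2 * of_int n + 1" by simp
  hence "Re s = of_int (2 * n + 1)" by simp
  with assms have "-1 < real_of_int (2 * n + 1)" "real_of_int (2 * n + 1) < 1" by auto
  hence "-1 < 2 * n + 1" "2 * n + 1 < 1" by linarith+
  thus False by presburger
qed

lemma gamma_zeta_strip: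
  assumes "-1 < Re s" "Re s < 1" "s \<noteq> 0"
  shows "gamma_zeta s = of_real (2 * pi) powr (s - 1) * (of_real pi / cos (of_real pi * s / 2)) * (zeta_reg (1 - s) / (- s))"
proof -
  let ?S = "{s. -1 < Re s} \<inter> {s. Re s < 1} - {0::complex}"
  let ?f = "\<lambda>s. of_real (2 * pi) powr (s - 1) * (of_real pi / cos (of_real pi * s / 2)) * (zeta_reg (1 - s) / (- s))"
  have "gamma_zeta s - ?f s = 0"
  proof (rule analytic_continuation[where S = ?S and w = s and f = "\<lambda>s. gamma_zeta s - ?f s" and U = "of_real ` {-1<..<0}" and \<xi> = "of_real (-1/2)"])
    have "(\<lambda>s. zeta_reg (1 - s)) holomorphic_on ?S"
      by (rule holomorphic_on_compose_gen[unfolded o_def, OF _ holomorphic_zeta_reg])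
         (auto intro!: holomorphic_intros)
    thus "(\<lambda>s. gamma_zeta s - ?f s) holomorphic_on ?S"
      by (intro holomorphic_intros holomorphic_on_subset[OF holomorphic_gamma_zeta] cos_half_pi_nz) auto
    show "connected ?S"
      by (rule connected_open_diff_countable)
         (auto intro!: convex_connected convex_Int open_Int simp: open_halfspace_Re_gt convex_halfspace_Re_gt
             open_halfspace_Re_lt convex_halfspace_Re_lt)
    show "open ?S" by (intro open_Diff open_Int open_halfspace_Re_gt open_halfspace_Re_lt) auto
    fix z :: complex assume "z \<in> of_real ` {-1<..<0}"
    then obtain x where x: "z = of_real x" "x < 0" "-1 < x" by auto
    hence "z \<noteq> 0" by simp
    have "zeta_reg (1 - z) = (1 - z - 1) * (\<Sum>k. of_nat (Suc k) powr (- of_real (1 - x)))"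
      using x by (subst zeta_reg_eq) simp_all
    hence zr: "zeta_reg (1 - z) = - z * of_real (\<Sum>k. real (Suc k) powr (x - 1))"
      using x by (subst (asm) suminf_powr_of_real[symmetric]) auto
    have "gamma_zeta z = of_real ((2 * pi) powr (x - 1)) * (of_real pi / of_real (cos (pi * x / 2))) * of_real (\<Sum>k. real (Suc k) powr (x - 1))"
      using gamma_zeta_real_neg[OF x(3,2)] by (simp only: x(1) of_real_mult of_real_divide)
    also have "complex_of_real ((2 * pi) powr (x - 1)) = of_real (2 * pi) powr (z - 1)"
      using powr_of_real[of "2 * pi" "x - 1"] by (simp add: x(1))
    also have "complex_of_real (cos (pi * x / 2)) = cos (of_real pi * z / 2)"
      by (simp add: x(1) flip: cos_of_real)
    finally show "gamma_zeta z - ?f z = 0" using \<open>z \<noteq> 0\<close> by (simp add: zr)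
  qed (use assms of_real_islimpt[of "-1" "-1/2" 0] in auto)
  thus ?thesis by (simp only: right_minus_eq)
qed

text \<open>
  The completed zeta function (s - 1) zeta(s) \<pi>^(-s/2) \<Gamma>(1 + s/2), meaningful on Re s > 0. As
  \<Gamma>(1 + s/2) = (s/2) \<Gamma>(s/2), this is the classical function of Riemann.
\<close>
definition xi_right :: "complex \<Rightarrow> complex" where
  "xi_right s = zeta_reg s * exp (- s / 2 * of_real (ln pi)) * Gamma (1 + s / 2)"

text \<open>
  The functional equation in symmetric form: the duplication formula and the reflection formula of
  \<Gamma> convert the asymmetric form.
\<close>
lemma xi_right_symmetric:
  assumes s: "0 < Re s" "Re s < 1"
  shows "xi_right (1 - s) = xi_right s"
proof -
  define C where "C = cos (of_real pi * s / 2)"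
  have C: "C \<noteq> 0" unfolding C_def using s by (intro cos_half_pi_nz) auto
  have nz: "s \<noteq> 0" "s \<noteq> 1" using s by auto
  have ni: "z \<notin> \<int>\<^sub>\<le>\<^sub>0" if "Re z > 0" for z :: complex using that by (auto elim!: nonpos_Ints_cases)
  define c where "c = Gamma ((1 + s) / 2)"
  have c: "c \<noteq> 0" unfolding c_def by (subst Gamma_eq_zero_iff, rule ni) (use s in simp)
  have A: "Gamma s * zeta_reg s / (s - 1) = exp ((s - 1) * of_real (ln 2 + ln pi)) * (of_real pi / C) * (zeta_reg (1 - s) / (- s))"
  proof -
    have "of_real (2 * pi) powr (s - 1) = exp ((s - 1) * of_real (ln 2 + ln pi))"
    proof -
      have "ln (2 * pi) = ln 2 + ln pi" by (simp add: ln_mult)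
      moreover have "Ln (of_real (2 * pi)) = complex_of_real (ln (2 * pi))"
        by (rule Ln_of_real) simp
      moreover have "complex_of_real (2 * pi) \<noteq> 0" by simp
      ultimately show ?thesis unfolding powr_def by (simp only: if_False)
    qed
    thus ?thesis
      using gamma_zeta_strip[of s] gamma_zeta_right[of s] s nz by (simp add: C_def)
  qed
  have A': "s * Gamma s * zeta_reg s = exp ((s - 1) * of_real (ln 2 + ln pi)) * (of_real pi / C) * (1 - s) * zeta_reg (1 - s)"
  proof -
    from A have "Gamma s * zeta_reg s = exp ((s - 1) * of_real (ln 2 + ln pi)) * (of_real pi / C) * (zeta_reg (1 - s) / (- s)) * (s - 1)"
      using nz by (simp only: divide_eq_eq right_minus_eq) simp
    hence "s * (Gamma s * zeta_reg s) = s * (exp ((s - 1) * of_real (ln 2 + ln pi)) * (of_real pi / C) * (zeta_reg (1 - s) / (- s)) * (s - 1))"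
      by (simp only:)
    also have "\<dots> = exp ((s - 1) * of_real (ln 2 + ln pi)) * (of_real pi / C) * (s * (zeta_reg (1 - s) / (- s)) * (s - 1))"
      by (simp only: mult_ac)
    also have "s * (zeta_reg (1 - s) / (- s)) * (s - 1) = (1 - s) * zeta_reg (1 - s)"
      using nz by (simp add: algebra_simps)
    finally show ?thesis by (simp only: mult.assoc)
  qed
  have dup: "Gamma (s / 2) * c = exp ((1 - s) * of_real (ln 2)) * of_real (sqrt pi) * Gamma s"
    using Gamma_legendre_duplication[of "s / 2"] s ni[of "s / 2"] ni[of "s / 2 + 1 / 2"]
    by (simp add: c_def add_divide_distrib add_ac)
  have refl: "Gamma ((1 - s) / 2) * c = of_real pi / C"
  proof -
    have "1 - (1 + s) / 2 = (1 - s) / 2" by (simp add: field_simps)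
    hence "c * Gamma ((1 - s) / 2) = of_real pi / sin (of_real pi * ((1 + s) / 2))"
      unfolding c_def using Gamma_reflection_complex[of "(1 + s) / 2"] by (simp only:)
    also have "sin (of_real pi * ((1 + s) / 2)) = C"
    proof -
      have "of_real pi / 2 - of_real pi * ((1 + s) / 2) = - (of_real pi * s / 2)"
        by (simp add: add_divide_distrib ring_distribs)
      thus ?thesis unfolding C_def by (subst sin_cos_eq) (simp only: cos_minus)
    qed
    finally show ?thesis by (subst mult.commute)
  qed
  have sq: "complex_of_real (sqrt pi) = exp (of_real (ln pi) / 2)"
  proof -
    have "sqrt pi = pi powr (1/2)" by (simp add: powr_half_sqrt)
    also have "\<dots> = exp (ln pi / 2)" by (simp add: powr_def)
    finally have "complex_of_real (sqrt pi) = of_real (exp (ln pi / 2))" by (simp only:)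
    also have "\<dots> = exp (of_real (ln pi) / 2)" by (simp only: exp_of_real[symmetric]) simp
    finally show ?thesis .
  qed
  have g1: "Gamma (1 + s / 2) = s / 2 * Gamma (s / 2)"
    using Gamma_plus1[of "s / 2"] ni[of "s / 2"] s by (simp add: add.commute)
  have g2: "Gamma (1 + (1 - s) / 2) = (1 - s) / 2 * Gamma ((1 - s) / 2)"
    using Gamma_plus1[of "(1 - s) / 2"] ni[of "(1 - s) / 2"] s by (simp add: add.commute)
  have "xi_right s * c = 1/2 * exp (- s / 2 * of_real (ln pi)) * zeta_reg s * s * (Gamma (s / 2) * c)"
    by (simp add: xi_right_def g1)
  also have "\<dots> = 1/2 * exp (- s / 2 * of_real (ln pi)) * exp ((1 - s) * of_real (ln 2)) * exp (of_real (ln pi) / 2) * (s * Gamma s * zeta_reg s)"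
    unfolding dup sq by simp
  also have "\<dots> = 1/2 * (exp (- s / 2 * of_real (ln pi)) * exp ((1 - s) * of_real (ln 2)) * exp (of_real (ln pi) / 2) * exp ((s - 1) * of_real (ln 2 + ln pi))) * (of_real pi / C) * (1 - s) * zeta_reg (1 - s)"
    unfolding A' by simp
  also have "exp (- s / 2 * of_real (ln pi)) * exp ((1 - s) * of_real (ln 2)) * exp (of_real (ln pi) / 2) * exp ((s - 1) * of_real (ln 2 + ln pi)) = exp (- (1 - s) / 2 * of_real (ln pi))"
    unfolding exp_add[symmetric] by (rule arg_cong[of _ _ exp]) (simp add: field_simps)
  also have "1/2 * exp (- (1 - s) / 2 * of_real (ln pi)) * (of_real pi / C) * (1 - s) * zeta_reg (1 - s) = xi_right (1 - s) * c"
    unfolding refl[symmetric] by (simp add: xi_right_def g2)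
  finally show ?thesis using c by simp
qed

section \<open>The formulas of Poisson and Jensen\<close>

text \<open>
  The Poisson kernel of the disc |z| < R, for the base point q and the boundary point R e^(it),
  without the factor 1/(2 \<pi>).
\<close>
definition poisson :: "real \<Rightarrow> complex \<Rightarrow> real \<Rightarrow> real" where
  "poisson R q t = (R\<^sup>2 - (norm q)\<^sup>2) / (norm (of_real R * cis t - q))\<^sup>2"

text \<open>
  Cauchy's formula at q, applied to log f(z) (R^2 - |q|^2) / (R^2 - conj(q) z): the
  quotient has no pole in the disc and is 1 at q, and on the boundary it turns the Cauchy kernel
  into the Poisson kernel.
\<close>
lemma poisson_integral_zero_free:
  assumes R: "0 < R" "R < R'" and f: "f holomorphic_on ball 0 R'"
    and nz: "\<And>z. norm z \<le> R \<Longrightarrow> f z \<noteq> 0" and q: "norm q < R"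
  shows "((\<lambda>t. poisson R q t * ln (norm (f (of_real R * cis t)))) has_integral (2 * pi * ln (norm (f q)))) {0..2*pi}"
proof -
  define U where "U = {z \<in> ball 0 R'. f z \<noteq> 0}"
  have "open U"
  proof -
    have "open (ball 0 R' \<inter> f -` (- {0}))"
      by (rule continuous_open_preimage[OF holomorphic_on_imp_continuous_on[OF f]]) auto
    thus ?thesis by (simp add: U_def vimage_def Int_def Compl_eq)
  qed
  moreover have "cball 0 R \<subseteq> U" using R nz by (auto simp: U_def)
  ultimately obtain e where e: "e > 0" "(\<Union>x\<in>cball 0 R. cball x e) \<subseteq> U"
    using compact_subset_open_imp_cball_epsilon_subset[of "cball 0 R" U] by (metis compact_cball)
  have sub: "ball 0 (R + e) \<subseteq> U"
  proof
    fix z :: complex assume "z \<in> ball 0 (R + e)"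
    hence z: "norm z < R + e" by simp
    show "z \<in> U"
    proof (cases "norm z \<le> R")
      case True thus ?thesis using e by force
    next
      case False
      define x where "x = of_real (R / norm z) * z"
      have "norm x = R" unfolding x_def norm_mult norm_of_real using False R by (cases "z = 0") auto
      moreover have "norm (x - z) \<le> e"
      proof -
        have nz: "norm z > 0" using False R by linarith
        have "x - z = of_real (R / norm z - 1) * z" by (simp add: x_def algebra_simps)
        hence "norm (x - z) = \<bar>R / norm z - 1\<bar> * norm z" by (simp only: norm_mult norm_of_real)
        also have "\<dots> = \<bar>(R / norm z - 1) * norm z\<bar>" by (simp add: abs_mult)
        also have "(R / norm z - 1) * norm z = R - norm z" using nz by (simp add: field_simps)
        finally show ?thesis using z False by simp
      qed
      ultimately have "x \<in> cball 0 R" "z \<in> cball x e" by (auto simp: dist_norm)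
      thus ?thesis using e by blast
    qed
  qed
  obtain h where h: "h holomorphic_on ball 0 (R + e)" "\<And>x. x \<in> ball 0 (R + e) \<Longrightarrow> exp (h x) = f x"
  proof (rule holomorphic_logarithm_exists[of "ball 0 (R + e)" f 0])
    show "f holomorphic_on ball 0 (R + e)"
      by (rule holomorphic_on_subset[OF f]) (use sub in \<open>auto simp: U_def\<close>)
    show "f x \<noteq> 0" if "x \<in> ball 0 (R + e)" for x using sub that by (auto simp: U_def)
  qed (use R e in auto)
  have Re_h: "Re (h z) = ln (norm (f z))" if "norm z \<le> R" for z
  proof -
    have "exp (h z) = f z" using that e by (intro h) auto
    hence "norm (f z) = exp (Re (h z))" by (metis norm_exp_eq_Re)
    thus ?thesis by simp
  qed
  define \<phi> where "\<phi> = (\<lambda>z. h z * of_real (R\<^sup>2 - (norm q)\<^sup>2) / (of_real (R\<^sup>2) - cnj q * z))"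
  have den: "of_real (R\<^sup>2) - cnj q * z \<noteq> 0" if "norm z \<le> R" for z
  proof
    assume "of_real (R\<^sup>2) - cnj q * z = 0"
    hence "norm (cnj q * z) = norm (of_real (R\<^sup>2) :: complex)" by simp
    hence "norm q * norm z = R * R" by (simp add: norm_mult norm_power power2_eq_square)
    moreover have "norm q * norm z \<le> norm q * R" using that by (intro mult_left_mono) auto
    moreover have "norm q * R < R * R" using q R by (intro mult_strict_right_mono) auto
    ultimately show False by linarith
  qed
  have "\<phi> holomorphic_on cball 0 R"
    unfolding \<phi>_def using den e by (intro holomorphic_intros holomorphic_on_subset[OF h(1)]) auto
  from Cauchy_integral_circlepath_simple[OF this, of q] q
  have "((\<lambda>u. \<phi> u / (u - q)) has_contour_integral (2 * of_real pi * \<i> * \<phi> q)) (part_circlepath 0 R 0 (2 * pi))"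
    by (simp add: circlepath_def)
  moreover have "\<phi> q = h q"
  proof -
    have "of_real (R\<^sup>2) - cnj q * q = complex_of_real (R\<^sup>2 - (norm q)\<^sup>2)"
      unfolding of_real_diff complex_norm_square by (simp only: mult.commute)
    thus ?thesis using den[of q] q by (simp add: \<phi>_def)
  qed
  ultimately have "((\<lambda>t. \<phi> (0 + of_real R * cis t) / ((0 + of_real R * cis t) - q) * of_real R * \<i> * cis t) has_integral (2 * of_real pi * \<i> * h q)) {0..2 * pi}"
    by (subst (asm) has_contour_integral_part_circlepath_iff) auto
  hence "((\<lambda>t. Re (- \<i> * (\<phi> (0 + of_real R * cis t) / ((0 + of_real R * cis t) - q) * of_real R * \<i> * cis t))) has_integral Re (- \<i> * (2 * of_real pi * \<i> * h q))) {0..2 * pi}"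
    by (intro has_integral_Re has_integral_mult_right)
  moreover have "Re (- \<i> * (2 * of_real pi * \<i> * h q)) = 2 * pi * ln (norm (f q))"
    using Re_h[of q] q by simp
  moreover have "Re (- \<i> * (\<phi> (0 + of_real R * cis t) / ((0 + of_real R * cis t) - q) * of_real R * \<i> * cis t)) = poisson R q t * ln (norm (f (of_real R * cis t)))" for t
  proof -
    define z where "z = of_real R * cis t"
    have nz: "norm z = R" using R by (simp add: z_def norm_mult)
    have zq: "z - q \<noteq> 0" using nz q by auto
    have z0: "z \<noteq> 0" using nz R by auto
    have "of_real (R\<^sup>2) = z * cnj z" unfolding nz[symmetric] by (rule complex_norm_square)
    hence d: "of_real (R\<^sup>2) - cnj q * z = z * cnj (z - q)" by (simp add: algebra_simps)
    have nn: "(z - q) * cnj (z - q) = of_real ((norm (z - q))\<^sup>2)" by (rule complex_norm_square[symmetric])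
    have "- \<i> * (\<phi> z / (z - q) * of_real R * \<i> * cis t) = \<phi> z / (z - q) * z"
    proof -
      have "- \<i> * (A * r * \<i> * c) = A * (r * c)" for A r c :: complex
      proof -
        have "\<i> * (A * r * \<i> * c) = (\<i> * \<i>) * (A * (r * c))" by (simp only: mult_ac)
        thus ?thesis by simp
      qed
      thus ?thesis unfolding z_def .
    qed
    also have "\<dots> = h z * of_real (R\<^sup>2 - (norm q)\<^sup>2) / ((z - q) * cnj (z - q))"
      unfolding \<phi>_def d using z0 by simp
    also have "\<dots> = of_real (poisson R q t) * h z"
      unfolding nn poisson_def z_def[symmetric] by simp
    finally show ?thesis using Re_h[of z] nz by (simp add: z_def)
  qed
  ultimately show ?thesis by simp
qed

lemma holomorphic_factor_zero_order:
  assumes f: "f holomorphic_on S" "open S" "connected S" "a \<in> S" "f a = 0" "w \<in> S" "f w \<noteq> 0"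
  obtains h where "h holomorphic_on S" "\<And>z. z \<in> S \<Longrightarrow> f z = (z - a) ^ nat (zorder f a) * h z"
      "h a \<noteq> 0" "zorder f a > 0"
proof -
  define n where "n = nat (zorder f a)"
  define g where "g = zor_poly f a"
  have "\<exists>w\<in>S. f w \<noteq> 0" using f by blast
  from zorder_exist_zero[OF f(1-4) this] f(5)
  have n: "zorder f a > 0" and "\<exists>r>0. cball a r \<subseteq> S \<and> g holomorphic_on cball a r \<and>
      (\<forall>w\<in>cball a r. f w = g w * (w - a) ^ n \<and> g w \<noteq> 0)"
    by (simp_all add: n_def g_def)
  then obtain r where r: "r > 0" "cball a r \<subseteq> S" "g holomorphic_on cball a r"
      "\<And>w. w \<in> cball a r \<Longrightarrow> f w = g w * (w - a) ^ n \<and> g w \<noteq> 0"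
    by blast
  define h where "h = (\<lambda>z. if z = a then g a else f z / (z - a) ^ n)"
  have hg: "h z = g z" if "z \<in> ball a r" for z
    using that r(4)[of z] by (auto simp: h_def)
  have "h holomorphic_on ball a r"
    by (rule holomorphic_transform[OF holomorphic_on_subset[OF r(3)]]) (use hg in auto)
  moreover have "h holomorphic_on (S - {a})"
    by (rule holomorphic_transform[of "\<lambda>z. f z / (z - a) ^ n"])
       (auto intro!: holomorphic_intros holomorphic_on_subset[OF f(1)] simp: h_def)
  ultimately have "h holomorphic_on (ball a r \<union> (S - {a}))"
    using f(2) by (intro holomorphic_on_Un) (auto intro: open_delete)
  moreover have "ball a r \<union> (S - {a}) = S" using r f(4) by auto
  ultimately have "h holomorphic_on S" by simp
  moreover have "f z = (z - a) ^ n * h z" if "z \<in> S" for z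
    using n f(5) by (auto simp: h_def n_def)
  moreover have "h a \<noteq> 0" using r(1) r(4)[of a] by (simp add: h_def)
  ultimately show ?thesis using that n unfolding n_def by blast
qed

text \<open>
  Induction on the number of zeros. A factor (z - a)^n of f is traded for the n-th power of
  (R^2 - conj(a) z) / R, which has the same modulus on the circle and no zero inside.
\<close>
lemma poisson_jensen:
  assumes R: "0 < R" "R < R'" and f: "f holomorphic_on ball 0 R'"
    and nz: "\<And>z. norm z = R \<Longrightarrow> f z \<noteq> 0" and q: "norm q < R" "f q \<noteq> 0"
    and fin: "finite {z \<in> ball 0 R. f z = 0}"
  shows "((\<lambda>t. poisson R q t * ln (norm (f (of_real R * cis t)))) has_integral
            (2 * pi * (ln (norm (f q)) + (\<Sum>a\<in>{z \<in> ball 0 R. f z = 0}.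
               of_int (zorder f a) * ln (norm ((of_real (R\<^sup>2) - cnj a * q) / (of_real R * (q - a)))))))) {0..2*pi}"
  using f nz q fin
proof (induction "card {z \<in> ball 0 R. f z = 0}" arbitrary: f)
  case 0
  hence Z: "{z \<in> ball 0 R. f z = 0} = {}" by simp
  have "f z \<noteq> 0" if "norm z \<le> R" for z
    using Z "0.prems"(2)[of z] that by (cases "norm z = R") auto
  from poisson_integral_zero_free[OF R "0.prems"(1) this "0.prems"(3)] show ?case unfolding Z by simp
next
  case (Suc k)
  define Z where "Z = {z \<in> ball 0 R. f z = 0}"
  have "Z \<noteq> {}" using Suc.hyps(2) unfolding Z_def[symmetric] by auto
  then obtain a where a: "a \<in> Z" by blast
  hence aR: "norm a < R" and fa: "f a = 0" by (auto simp: Z_def)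
  define n where "n = nat (zorder f a)"
  obtain h where h: "h holomorphic_on ball 0 R'" "\<And>z. z \<in> ball 0 R' \<Longrightarrow> f z = (z - a) ^ n * h z"
      "h a \<noteq> 0" "zorder f a > 0"
    unfolding n_def
    by (rule holomorphic_factor_zero_order[OF Suc.prems(1), of a q]) (use R aR fa Suc.prems in auto)
  have Zh: "{z \<in> ball 0 R. h z = 0} = Z - {a}"
    using h R by (auto simp: Z_def n_def)
  have finZ: "finite Z" using Suc.prems by (simp add: Z_def)
  have hq: "h q \<noteq> 0" "q \<noteq> a" using Suc.prems R h(2)[of q] fa by auto
  have hnz: "h z \<noteq> 0" if "norm z = R" for z
    using Suc.prems(2)[OF that] h(2)[of z] that R by auto
  have "k = card {z \<in> ball 0 R. h z = 0}"
    using Suc.hyps(2) finZ a unfolding Zh by (simp add: Z_def)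
  from Suc.hyps(1)[OF this h(1) hnz Suc.prems(3) hq(1)] finZ
  have IH: "((\<lambda>t. poisson R q t * ln (norm (h (of_real R * cis t)))) has_integral
            (2 * pi * (ln (norm (h q)) + (\<Sum>a\<in>Z - {a}.
               of_int (zorder h a) * ln (norm ((of_real (R\<^sup>2) - cnj a * q) / (of_real R * (q - a)))))))) {0..2*pi}"
    unfolding Zh by simp
  have zo: "zorder h b = zorder f b" if b: "b \<in> Z - {a}" for b
  proof -
    have bR: "b \<in> ball 0 R'" "b \<noteq> a" using b R by (auto simp: Z_def)
    have "\<forall>\<^sub>F w in at b. h w \<noteq> 0 \<and> w \<in> ball 0 R'"
      by (rule non_zero_neighbour_alt[OF h(1), where \<beta> = q]) (use bR hq R Suc.prems in auto)
    moreover have "\<forall>\<^sub>F w in at b. w \<noteq> a"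
      using bR(2) by (simp add: eventually_neq_at_within)
    ultimately have ev: "\<forall>\<^sub>F w in at b. (w - a) ^ n * h w \<noteq> 0" by eventually_elim auto
    have an: "h analytic_on {b}" using h(1) bR(1) by (meson analytic_at open_ball)
    have an': "(\<lambda>w. (w - a) ^ n) analytic_on {b}" by (intro analytic_intros)
    have "\<forall>\<^sub>F w in at b. w \<in> ball 0 R'" using bR by (intro eventually_at_in_open') auto
    hence "zorder f b = zorder (\<lambda>w. (w - a) ^ n * h w) b"
      by (intro zorder_cong) (auto elim!: eventually_mono simp: h(2))
    also have "\<dots> = zorder (\<lambda>w. (w - a) ^ n) b + zorder h b"
      by (rule zorder_times_analytic[OF an' an ev])
    also have "zorder (\<lambda>w. (w - a) ^ n) b = 0" using bR by (intro zorder_eq_0I an') auto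
    finally show ?thesis by simp
  qed
  define B where "B = (\<lambda>z. (of_real (R\<^sup>2) - cnj a * z) / of_real R)"
  have Bnz: "B z \<noteq> 0" if "norm z \<le> R" for z
  proof
    assume "B z = 0"
    hence "norm (cnj a * z) = norm (of_real (R\<^sup>2) :: complex)" using R by (simp add: B_def)
    hence "norm a * norm z = R * R" by (simp add: norm_mult norm_power power2_eq_square)
    moreover have "norm a * norm z \<le> norm a * R" using that by (intro mult_left_mono) auto
    moreover have "norm a * R < R * R" using aR R by (intro mult_strict_right_mono) auto
    ultimately show False by linarith
  qed
  have "((\<lambda>t. poisson R q t * ln (norm (B (of_real R * cis t)))) has_integral (2 * pi * ln (norm (B q)))) {0..2*pi}"
    by (rule poisson_integral_zero_free[OF R _ Bnz Suc.prems(3)])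
       (use R in \<open>auto simp: B_def intro!: holomorphic_intros\<close>)
  from has_integral_add[OF has_integral_mult_right[OF this, of "real n"] IH]
  have "((\<lambda>t. real n * (poisson R q t * ln (norm (B (of_real R * cis t)))) + poisson R q t * ln (norm (h (of_real R * cis t))))
     has_integral (real n * (2 * pi * ln (norm (B q))) + (2 * pi * (ln (norm (h q)) + (\<Sum>a\<in>Z - {a}.
               of_int (zorder h a) * ln (norm ((of_real (R\<^sup>2) - cnj a * q) / (of_real R * (q - a))))))))) {0..2*pi}" .
  also have "(\<lambda>t. real n * (poisson R q t * ln (norm (B (of_real R * cis t)))) + poisson R q t * ln (norm (h (of_real R * cis t))))
     = (\<lambda>t. poisson R q t * ln (norm (f (of_real R * cis t))))"
  proof
    fix t
    define z where "z = of_real R * cis t"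
    have nz: "norm z = R" using R by (simp add: z_def norm_mult)
    have za: "z \<noteq> a" using nz aR by auto
    have "norm (B z) = norm (z - a)"
    proof -
      have "of_real (R\<^sup>2) = z * cnj z" unfolding nz[symmetric] by (rule complex_norm_square)
      hence "of_real (R\<^sup>2) - cnj a * z = z * cnj (z - a)" by (simp add: algebra_simps)
      hence "norm (of_real (R\<^sup>2) - cnj a * z) = R * norm (z - a)" by (simp add: norm_mult nz flip: complex_cnj_diff)
      thus ?thesis using R by (simp add: B_def norm_divide)
    qed
    moreover have "ln (norm (f z)) = real n * ln (norm (z - a)) + ln (norm (h z))"
      using h(2)[of z] nz R za hnz[of z] by (simp add: norm_mult norm_power ln_mult ln_realpow)
    ultimately show "real n * (poisson R q t * ln (norm (B (of_real R * cis t)))) + poisson R q t * ln (norm (h (of_real R * cis t))) = poisson R q t * ln (norm (f (of_real R * cis t)))"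
      unfolding z_def[symmetric] by (simp add: algebra_simps)
  qed
  also have "real n * (2 * pi * ln (norm (B q))) + (2 * pi * (ln (norm (h q)) + (\<Sum>a\<in>Z - {a}.
               of_int (zorder h a) * ln (norm ((of_real (R\<^sup>2) - cnj a * q) / (of_real R * (q - a)))))))
     = 2 * pi * (ln (norm (f q)) + (\<Sum>a\<in>Z.
               of_int (zorder f a) * ln (norm ((of_real (R\<^sup>2) - cnj a * q) / (of_real R * (q - a))))))"
  proof -
    define T where "T = (\<lambda>b. ln (norm ((of_real (R\<^sup>2) - cnj b * q) / (of_real R * (q - b)))))"
    have Tn: "ln (norm ((of_real (R\<^sup>2) - cnj b * q) / (of_real R * (q - b)))) = T b" for b
      by (simp only: T_def)
    have "ln (norm (f q)) = real n * ln (norm (q - a)) + ln (norm (h q))"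
      using h(2)[of q] Suc.prems(3) R hq by (simp add: norm_mult norm_power ln_mult ln_realpow)
    moreover have "ln (norm (B q)) = T a + ln (norm (q - a))"
    proof -
      have "(of_real (R\<^sup>2) - cnj a * q) / (of_real R * (q - a)) = B q / (q - a)" by (simp add: B_def)
      thus ?thesis using Bnz[of q] Suc.prems(3) hq unfolding T_def by (simp only:) (simp add: norm_divide ln_div)
    qed
    moreover have "real_of_int (zorder f a) = real n" using h(4) by (simp add: n_def)
    moreover have "(\<Sum>a\<in>Z - {a}. of_int (zorder h a) * T a) = (\<Sum>a\<in>Z - {a}. of_int (zorder f a) * T a)"
      using zo by (intro sum.cong) auto
    ultimately show ?thesis
      unfolding Tn by (subst sum.remove[OF finZ a]) (simp add: algebra_simps)
  qed
  finally show ?case unfolding Z_def .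
qed

lemma poisson_has_integral:
  assumes "0 < R" "norm q < R"
  shows "(poisson R q has_integral 2 * pi) {0..2*pi}"
  using poisson_integral_zero_free[of R "R + 1" "\<lambda>_. exp 1" q] assms by simp

lemma poisson_subharmonic:
  assumes R: "0 < R" "R < R'" and f: "f holomorphic_on ball 0 R'"
    and nz: "\<And>z. norm z = R \<Longrightarrow> f z \<noteq> 0" and q: "norm q < R" "f q \<noteq> 0"
    and fin: "finite {z \<in> ball 0 R. f z = 0}"
  shows "2 * pi * ln (norm (f q)) \<le> integral {0..2*pi} (\<lambda>t. poisson R q t * ln (norm (f (of_real R * cis t))))"
proof -
  have "0 \<le> of_int (zorder f a) * ln (norm ((of_real (R\<^sup>2) - cnj a * q) / (of_real R * (q - a))))"
    if a: "a \<in> ball 0 R" "f a = 0" for a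
  proof -
    have aR: "norm a < R" "q \<noteq> a" using a q by auto
    have "zorder f a > 0"
      by (rule holomorphic_factor_zero_order[OF f, of a q]) (use R a q in auto)
    moreover have "norm (of_real R * (q - a)) \<le> norm (of_real (R\<^sup>2) - cnj a * q)"
    proof -
      have "(norm (of_real (R\<^sup>2) - cnj a * q))\<^sup>2 - (norm (of_real R * (q - a)))\<^sup>2 = (R\<^sup>2 - (norm a)\<^sup>2) * (R\<^sup>2 - (norm q)\<^sup>2)"
      proof -
        define a1 a2 q1 q2 where d: "a1 = Re a" "a2 = Im a" "q1 = Re q" "q2 = Im q"
        have 1: "(norm (of_real (R\<^sup>2) - cnj a * q))\<^sup>2 = (R\<^sup>2 - (a1 * q1 + a2 * q2))\<^sup>2 + (a1 * q2 - a2 * q1)\<^sup>2"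
          unfolding cmod_power2 by (simp add: d power2_commute del: of_real_power)
        have 2: "(norm (of_real R * (q - a)))\<^sup>2 = R\<^sup>2 * ((q1 - a1)\<^sup>2 + (q2 - a2)\<^sup>2)"
          unfolding norm_mult power_mult_distrib cmod_power2 by (simp add: d)
        have 3: "(norm a)\<^sup>2 = a1\<^sup>2 + a2\<^sup>2" "(norm q)\<^sup>2 = q1\<^sup>2 + q2\<^sup>2"
          unfolding cmod_power2 by (simp_all add: d)
        show ?thesis unfolding 1 2 3 by algebra
      qed
      also have "\<dots> \<ge> 0" using aR q by (intro mult_nonneg_nonneg) (auto simp: power_mono)
      finally have "(norm (of_real R * (q - a)))\<^sup>2 \<le> (norm (of_real (R\<^sup>2) - cnj a * q))\<^sup>2" by (simp only: diff_ge_0_iff_ge)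
      thus ?thesis by (rule power2_le_imp_le) (rule norm_ge_zero)
    qed
    ultimately show ?thesis
    proof (intro mult_nonneg_nonneg ln_ge_zero)
      have "norm (of_real R * (q - a)) > 0" using R aR by simp
      thus "1 \<le> norm ((of_real (R\<^sup>2) - cnj a * q) / (of_real R * (q - a)))"
        using \<open>norm (of_real R * (q - a)) \<le> norm (of_real (R\<^sup>2) - cnj a * q)\<close>
        unfolding norm_divide by (simp only: le_divide_eq_1_pos)
    qed auto
  qed
  hence "0 \<le> (\<Sum>a\<in>{z \<in> ball 0 R. f z = 0}. of_int (zorder f a) * ln (norm ((of_real (R\<^sup>2) - cnj a * q) / (of_real R * (q - a)))))"
    by (intro sum_nonneg) auto
  thus ?thesis using integral_unique[OF poisson_jensen[OF assms]] by simp
qed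

lemma jensen:
  assumes R: "0 < R" "R < R'" and f: "f holomorphic_on ball 0 R'"
    and nz: "\<And>z. norm z = R \<Longrightarrow> f z \<noteq> 0" and q: "f 0 \<noteq> 0"
    and fin: "finite {z \<in> ball 0 R. f z = 0}"
  shows "((\<lambda>t. ln (norm (f (of_real R * cis t)))) has_integral
            (2 * pi * (ln (norm (f 0)) + (\<Sum>a\<in>{z \<in> ball 0 R. f z = 0}. of_int (zorder f a) * ln (R / norm a))))) {0..2*pi}"
proof -
  have p: "poisson R 0 t = 1" for t using R by (simp add: poisson_def norm_mult)
  have n: "norm ((of_real (R\<^sup>2) - cnj a * 0) / (of_real R * (0 - a))) = R / norm a" for a :: complex
    using R by (simp add: norm_divide norm_mult norm_power power2_eq_square)
  show ?thesis using poisson_jensen[OF R f nz _ q fin] R unfolding p n by simp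
qed

section \<open>The completed zeta function and its zeros\<close>

text \<open>
  The completed zeta function as an even entire function of z = s - 1/2. The functional
  equation makes the two formulas agree in the strip |Re z| < 1/2.
\<close>
definition xi :: "complex \<Rightarrow> complex" where
  "xi z = (if Re z > -1/2 then xi_right (1/2 + z) else xi_right (1/2 - z))"

lemma holomorphic_xi_right: "xi_right holomorphic_on {s. Re s > 0}"
  unfolding xi_right_def
  by (intro holomorphic_intros holomorphic_zeta_reg) (auto elim!: nonpos_Ints_cases simp: complex_eq_iff)

lemma xi_right_shift: "Re z > -1/2 \<Longrightarrow> xi z = xi_right (1/2 + z)"
  by (simp add: xi_def)

lemma xi_left_shift: "Re z < 1/2 \<Longrightarrow> xi z = xi_right (1/2 - z)"
  using xi_right_symmetric[of "1/2 + z"] by (simp add: xi_def)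

lemma xi_even: "xi (- z) = xi z"
proof (cases "Re z > - 1/2")
  case True
  hence "xi (-z) = xi_right (1/2 - (-z))" by (intro xi_left_shift) auto
  thus ?thesis using True by (simp add: xi_right_shift)
next
  case False
  hence "xi (-z) = xi_right (1/2 + (-z))" by (intro xi_right_shift) auto
  thus ?thesis using False by (simp add: xi_left_shift)
qed

lemma holomorphic_xi: "xi holomorphic_on A"
proof -
  have "xi holomorphic_on {z. Re z > -1/2}"
  proof (rule holomorphic_transform)
    show "(\<lambda>z. xi_right (1/2 + z)) holomorphic_on {z. Re z > -1/2}"
      by (rule holomorphic_on_compose_gen[unfolded o_def, OF _ holomorphic_xi_right]) (auto intro!: holomorphic_intros)
  qed (simp add: xi_right_shift)
  moreover have "xi holomorphic_on {z. Re z < 1/2}"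
  proof (rule holomorphic_transform)
    show "(\<lambda>z. xi_right (1/2 - z)) holomorphic_on {z. Re z < 1/2}"
      by (rule holomorphic_on_compose_gen[unfolded o_def, OF _ holomorphic_xi_right]) (auto intro!: holomorphic_intros)
  qed (simp add: xi_left_shift)
  ultimately have "xi holomorphic_on ({z. Re z > -1/2} \<union> {z. Re z < 1/2})"
    by (intro holomorphic_on_Un open_halfspace_Re_gt open_halfspace_Re_lt)
  thus ?thesis by (rule holomorphic_on_subset) auto
qed

lemma Gamma_nonzero_right: "Re z > 0 \<Longrightarrow> Gamma z \<noteq> 0"
  by (subst Gamma_eq_zero_iff) (auto elim!: nonpos_Ints_cases)

lemma xi_0_nonzero: "xi 0 \<noteq> 0"
  using zeta_reg_half Gamma_nonzero_right[of "5/4"] by (simp add: xi_def xi_right_def)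

lemma xi_eq_0_iff: "Re z > -1/2 \<Longrightarrow> xi z = 0 \<longleftrightarrow> zeta_reg (1/2 + z) = 0"
proof -
  assume "Re z > -1/2"
  moreover from this have "Gamma (1 + (1/2 + z) / 2) \<noteq> 0" by (intro Gamma_nonzero_right) (simp add: field_simps)
  ultimately show ?thesis by (simp add: xi_def xi_right_def)
qed

lemma xi_eventually_nonzero: "\<forall>\<^sub>F w in at z. xi w \<noteq> 0"
  using non_zero_neighbour_alt[of xi UNIV z 0] holomorphic_xi xi_0_nonzero
  by (auto elim: eventually_mono)

lemma finite_xi_zeros: "finite {z \<in> cball 0 R. xi z = 0}"
proof (cases "xi constant_on UNIV")
  case True
  hence "xi z \<noteq> 0" for z using xi_0_nonzero by (metis constant_on_def UNIV_I)
  thus ?thesis by simp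
next
  case False
  thus ?thesis
    by (intro holomorphic_compact_finite_zeros[of xi UNIV]) (auto intro: holomorphic_xi)
qed

lemma zorder_xi_minus:
  assumes "xi a = 0"
  shows "zorder xi (- a) = zorder xi a"
proof -
  obtain h where h: "h holomorphic_on UNIV" "\<And>z. xi z = (z - a) ^ nat (zorder xi a) * h z" "h a \<noteq> 0" "zorder xi a > 0"
    by (rule holomorphic_factor_zero_order[OF holomorphic_xi open_UNIV connected_UNIV UNIV_I assms UNIV_I xi_0_nonzero]) blast
  define n where "n = nat (zorder xi a)"
  show ?thesis
  proof (rule zorder_eqI[of UNIV _ "\<lambda>w. h (- w) * (-1) ^ n"])
    have "(h \<circ> uminus) holomorphic_on UNIV"
      by (rule holomorphic_on_compose_gen[OF _ h(1)]) (auto intro!: holomorphic_intros)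
    thus "(\<lambda>w. h (- w) * (-1) ^ n) holomorphic_on UNIV"
      unfolding o_def by (intro holomorphic_on_mult holomorphic_on_const)
    fix w
    have "xi w = (- w - a) ^ n * h (- w)" using h(2)[of "- w"] by (simp only: xi_even n_def)
    also have "- w - a = (-1) * (w - - a)" by simp
    also have "\<dots> ^ n = (-1) ^ n * (w - - a) ^ n" by (rule power_mult_distrib)
    finally show "xi w = h (- w) * (-1) ^ n * (w - - a) powi zorder xi a"
      using h(4) unfolding n_def power_int_def by (simp only: if_True less_imp_le mult_ac)
  qed (use h(3) in auto)
qed

lemma xi_eq_zeta:
  assumes "Re s > 0" "s \<noteq> 1"
  shows "riemann_zeta s = xi (s - 1/2) * (exp (s / 2 * of_real (ln pi)) / ((s - 1) * Gamma (1 + s / 2)))"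
proof -
  have "xi (s - 1/2) = zeta_reg s * exp (- s / 2 * of_real (ln pi)) * Gamma (1 + s / 2)"
    using assms by (simp add: xi_right_shift xi_right_def)
  moreover have e: "exp (- s / 2 * of_real (ln pi)) * exp (s / 2 * of_real (ln pi)) = 1"
    unfolding exp_add[symmetric] by simp
  moreover have "Gamma (1 + s / 2) \<noteq> 0" using assms by (intro Gamma_nonzero_right) auto
  moreover have "z * a * c * (b / (d * c)) = z * (a * b) / d" if "c \<noteq> 0" for z a b c d :: complex
    using that by simp
  ultimately have "xi (s - 1/2) * (exp (s / 2 * of_real (ln pi)) / ((s - 1) * Gamma (1 + s / 2))) = zeta_reg s * 1 / (s - 1)"
    unfolding e[symmetric] by (simp only: not_False_eq_True)
  thus ?thesis using riemann_zeta_eq[OF assms] by (simp only: mult_1_right)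
qed

lemma zorder_riemann_zeta:
  assumes "Re s > 0" "s \<noteq> 1"
  shows "zorder riemann_zeta s = zorder xi (s - 1/2)"
proof -
  define g :: "complex \<Rightarrow> complex" where "g = (\<lambda>s. exp (s / 2 * of_real (ln pi)) / ((s - 1) * Gamma (1 + s / 2)))"
  have G: "Gamma (1 + z / 2) \<noteq> 0" if "Re z > 0" for z using that by (intro Gamma_nonzero_right) auto
  have ni: "1 + z / 2 \<notin> \<int>\<^sub>\<le>\<^sub>0" if "Re z > 0" for z
    using that by (auto elim!: nonpos_Ints_cases simp: complex_eq_iff)
  let ?S = "{z. Re z > 0} - {1::complex}"
  have S: "open ?S" by (intro open_Diff open_halfspace_Re_gt) auto
  have "g holomorphic_on ?S" unfolding g_def using G ni by (intro holomorphic_intros) auto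
  hence ga: "g analytic_on {s}" using S assms by (intro analytic_at[THEN iffD2]) (auto intro!: exI[of _ ?S])
  have gs: "g s \<noteq> 0" using assms G[of s] by (simp add: g_def)
  have xa: "(\<lambda>s. xi (s - 1/2)) analytic_on {s}"
    by (intro holomorphic_on_imp_analytic_at[of _ UNIV] holomorphic_on_compose_gen[unfolded o_def, OF _ holomorphic_xi])
       (auto intro!: holomorphic_intros)
  have ev: "\<forall>\<^sub>F w in at s. w \<in> ?S" using S assms by (intro eventually_at_in_open') auto
  have "\<forall>\<^sub>F w in at s. xi (w - 1/2) \<noteq> 0"
    using xi_eventually_nonzero[of "s - 1/2"] unfolding filtermap_at_shift[symmetric] eventually_filtermap .
  with ev have ev2: "\<forall>\<^sub>F w in at s. xi (w - 1/2) * g w \<noteq> 0"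
    by eventually_elim (use G in \<open>auto simp: g_def\<close>)
  have "zorder riemann_zeta s = zorder (\<lambda>w. xi (w - 1/2) * g w) s"
    by (rule zorder_cong) (use ev in \<open>auto elim!: eventually_mono simp: xi_eq_zeta g_def\<close>)
  also have "\<dots> = zorder (\<lambda>w. xi (w - 1/2)) s + zorder g s"
    by (rule zorder_times_analytic[OF xa ga ev2])
  also have "zorder g s = 0" by (rule zorder_eq_0I[OF ga gs])
  also have "zorder (\<lambda>w. xi (w - 1/2)) s = zorder xi (s - 1/2)"
    by (subst (1 2) zorder_shift) (simp add: algebra_simps)
  finally show ?thesis by simp
qed

lemma nontrivial_zeroI:
  assumes "Re s > 0" "zeta_reg s = 0"
  shows "s \<in> nontrivial_zeros"
proof -
  have "s \<noteq> 1" using assms zeta_reg_1 by auto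
  moreover from this have "riemann_zeta s = 0" using assms by (simp add: riemann_zeta_eq)
  moreover have "s \<noteq> - 2 * of_nat (Suc k)" for k
  proof
    assume "s = - 2 * of_nat (Suc k)"
    hence "Re s = - 2 * real (Suc k)" by simp
    thus False using assms by simp
  qed
  ultimately show ?thesis by (auto simp: nontrivial_zeros_def)
qed

lemma nontrivial_zeros_eq:
  assumes "riemann_hypothesis"
  shows "\<rho> \<in> nontrivial_zeros \<longleftrightarrow> Re \<rho> = 1/2 \<and> xi (\<rho> - 1/2) = 0"
proof
  assume r: "\<rho> \<in> nontrivial_zeros"
  hence re: "Re \<rho> = 1/2" using assms by (auto simp: riemann_hypothesis_def)
  from r have "\<rho> \<noteq> 1" "riemann_zeta \<rho> = 0" by (auto simp: nontrivial_zeros_def)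
  hence "zeta_reg \<rho> = 0" using re riemann_zeta_eq[of \<rho>] by auto
  thus "Re \<rho> = 1/2 \<and> xi (\<rho> - 1/2) = 0" using re xi_eq_0_iff[of "\<rho> - 1/2"] by simp
next
  assume r: "Re \<rho> = 1/2 \<and> xi (\<rho> - 1/2) = 0"
  thus "\<rho> \<in> nontrivial_zeros" using xi_eq_0_iff[of "\<rho> - 1/2"] by (intro nontrivial_zeroI) auto
qed

lemma xi_zero_imp_imaginary:
  assumes RH: "riemann_hypothesis" and z: "xi z = 0"
  shows "Re z = 0"
proof -
  have *: "Re w = 0" if "Re w \<ge> 0" "xi w = 0" for w
  proof -
    have "1/2 + w \<in> nontrivial_zeros"
      using that xi_eq_0_iff[of w] by (intro nontrivial_zeroI) auto
    thus ?thesis using RH by (auto simp: riemann_hypothesis_def)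
  qed
  show ?thesis using *[of z] *[of "- z"] z by (cases "Re z \<ge> 0") (auto simp: xi_even)
qed

lemma zero_index_set:
  assumes "riemann_hypothesis"
  shows "{\<rho>\<in>nontrivial_zeros. 0 < Im \<rho> \<and> Im \<rho> < T} = (\<lambda>z. 1/2 + z) ` {z \<in> ball 0 T. xi z = 0 \<and> Im z > 0}"
proof (intro equalityI subsetI)
  fix \<rho> assume "\<rho> \<in> {\<rho>\<in>nontrivial_zeros. 0 < Im \<rho> \<and> Im \<rho> < T}"
  hence r: "Re \<rho> = 1/2" "xi (\<rho> - 1/2) = 0" "0 < Im \<rho>" "Im \<rho> < T"
    by (auto simp: nontrivial_zeros_eq[OF assms])
  have "norm (\<rho> - 1/2) = Im \<rho>" using r by (simp add: cmod_eq_Im)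
  thus "\<rho> \<in> (\<lambda>z. 1/2 + z) ` {z \<in> ball 0 T. xi z = 0 \<and> Im z > 0}"
    using r by (intro image_eqI[of _ _ "\<rho> - 1/2"]) auto
next
  fix \<rho> assume "\<rho> \<in> (\<lambda>z. 1/2 + z) ` {z \<in> ball 0 T. xi z = 0 \<and> Im z > 0}"
  then obtain z where z: "\<rho> = 1/2 + z" "norm z < T" "xi z = 0" "Im z > 0" by auto
  moreover have "Re z = 0" by (rule xi_zero_imp_imaginary[OF assms z(3)])
  moreover have "Im z \<le> norm z" using abs_Im_le_cmod[of z] by simp
  ultimately show "\<rho> \<in> {\<rho>\<in>nontrivial_zeros. 0 < Im \<rho> \<and> Im \<rho> < T}"
    by (auto simp: nontrivial_zeros_eq[OF assms])
qed

lemma finite_zero_index_set: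
  assumes "riemann_hypothesis"
  shows "finite {\<rho>\<in>nontrivial_zeros. 0 < Im \<rho> \<and> Im \<rho> < T}"
  unfolding zero_index_set[OF assms]
  by (intro finite_imageI finite_subset[OF _ finite_xi_zeros[of T]]) auto

lemma zorder_nontrivial_zero_pos:
  assumes RH: "riemann_hypothesis" and r: "\<rho> \<in> nontrivial_zeros"
  shows "zorder riemann_zeta \<rho> > 0"
proof -
  from r have r: "Re \<rho> = 1/2" "xi (\<rho> - 1/2) = 0" by (auto simp: nontrivial_zeros_eq[OF RH])
  hence "zorder riemann_zeta \<rho> = zorder xi (\<rho> - 1/2)" by (intro zorder_riemann_zeta) auto
  also have "\<dots> > 0"
  proof -
    have "\<exists>w\<in>UNIV. xi w \<noteq> 0" using xi_0_nonzero by blast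
    from zorder_exist_zero[OF holomorphic_xi open_UNIV connected_UNIV UNIV_I this, of "\<rho> - 1/2"] r
    show ?thesis by simp
  qed
  finally show ?thesis .
qed

text \<open>
  The zeros come in pairs z, -z with one member in the upper half-plane: a real zero would, being
  imaginary as well, have to be 0, where xi does not vanish.
\<close>
lemma xi_zero_sum:
  assumes RH: "riemann_hypothesis"
  shows "(\<Sum>a\<in>{z \<in> ball 0 T. xi z = 0}. of_int (zorder xi a) * g (norm a)) = 2 * zero_sum g T"
proof -
  define P where "P = {z \<in> ball 0 T. xi z = 0 \<and> Im z > 0}"
  have fin: "finite P" by (rule finite_subset[OF _ finite_xi_zeros[of T]]) (auto simp: P_def)
  have re: "Re z = 0" if "xi z = 0" for z using xi_zero_imp_imaginary[OF RH that] .
  have Z: "{z \<in> ball 0 T. xi z = 0} = P \<union> uminus ` P"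
  proof (intro equalityI subsetI)
    fix z assume z: "z \<in> {z \<in> ball 0 T. xi z = 0}"
    have "Im z \<noteq> 0"
    proof
      assume "Im z = 0"
      hence "z = 0" using z re[of z] by (simp add: complex_eq_iff)
      thus False using z xi_0_nonzero by simp
    qed
    thus "z \<in> P \<union> uminus ` P"
    proof (cases "Im z > 0")
      case False
      with \<open>Im z \<noteq> 0\<close> have "- z \<in> P" using z by (auto simp: P_def xi_even)
      thus ?thesis by (metis UnI2 image_eqI minus_minus)
    qed (use z in \<open>auto simp: P_def\<close>)
  qed (auto simp: P_def xi_even)
  have "(\<Sum>a\<in>{z \<in> ball 0 T. xi z = 0}. of_int (zorder xi a) * g (norm a)) =
        (\<Sum>a\<in>P. of_int (zorder xi a) * g (norm a)) + (\<Sum>a\<in>uminus ` P. of_int (zorder xi a) * g (norm a))"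
    unfolding Z using fin by (intro sum.union_disjoint) (auto simp: P_def)
  also have "(\<Sum>a\<in>uminus ` P. of_int (zorder xi a) * g (norm a)) = (\<Sum>a\<in>P. of_int (zorder xi a) * g (norm a))"
    by (subst sum.reindex) (auto simp: zorder_xi_minus P_def)
  also have "(\<Sum>a\<in>P. of_int (zorder xi a) * g (norm a)) = zero_sum g T"
    unfolding zero_sum_def zero_index_set[OF RH] P_def[symmetric]
  proof (subst sum.reindex)
    show "(\<Sum>a\<in>P. of_int (zorder xi a) * g (norm a)) = sum ((\<lambda>\<rho>. of_int (zorder riemann_zeta \<rho>) * g (Im \<rho>)) \<circ> (+) (1 / 2)) P"
    proof (rule sum.cong[OF refl])
      fix z assume z: "z \<in> P"
      hence "Re z = 0" "Im z > 0" using re by (auto simp: P_def)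
      moreover from this have "norm z = Im z" by (simp add: cmod_eq_Im)
      moreover have "zorder riemann_zeta (1/2 + z) = zorder xi z"
        using zorder_riemann_zeta[of "1/2 + z"] \<open>Re z = 0\<close> by (auto simp: complex_eq_iff)
      ultimately show "of_int (zorder xi z) * g (norm z) = ((\<lambda>\<rho>. of_int (zorder riemann_zeta \<rho>) * g (Im \<rho>)) \<circ> (+) (1 / 2)) z"
        by simp
    qed
  qed (auto simp: inj_on_def)
  finally show ?thesis by simp
qed

section \<open>Stirling's formula\<close>

text \<open>
  The real part of z Log z - z for z = x + iy with x > 0.
\<close>
definition stirling_main :: "real \<Rightarrow> real \<Rightarrow> real" where
  "stirling_main x y = x * ln (x\<^sup>2 + y\<^sup>2) / 2 - y * arctan (y / x) - x"

lemma stirling_main_eq: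
  assumes "Re z > 0"
  shows "stirling_main (Re z) (Im z) = Re (z * Ln z - z)"
proof -
  have "z \<noteq> 0" using assms by auto
  hence "Re (Ln z) = ln ((Re z)\<^sup>2 + (Im z)\<^sup>2) / 2" by (simp add: cmod_def ln_sqrt)
  moreover have "Im (Ln z) = arctan (Im z / Re z)" using assms Im_Ln_eq[of z] \<open>z \<noteq> 0\<close> by auto
  ultimately show ?thesis by (simp add: stirling_main_def)
qed

text \<open>
  By Gauss's product, the difference is the sum over k >= 0 of log |x + k + iy| - log(x + k). The summand
  decreases with k, so that the sum is compared with the integral of the summand over [0,\<infinity>),
  which is -d.
\<close>
lemma ln_norm_Gamma_diff_bounds:
  fixes x y :: real
  assumes x: "x > 0"
  defines "d \<equiv> stirling_main x y - stirling_main x 0"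
  shows "- d \<le> ln (Gamma x) - ln (norm (Gamma (Complex x y)))"
    and "ln (Gamma x) - ln (norm (Gamma (Complex x y))) \<le> ln (x\<^sup>2 + y\<^sup>2) / 2 - ln x - d"
proof -
  define z where "z = Complex x y"
  have z: "Re z = x" "Im z = y" by (simp_all add: z_def)
  define D where "D = (\<lambda>t. ln ((x + t)\<^sup>2 + y\<^sup>2) / 2 - ln (x + t))"
  define U where "U = (\<lambda>t. stirling_main (x + t) y - stirling_main (x + t) 0)"
  have D_eq: "D t = ln (1 + y\<^sup>2 / (x + t)\<^sup>2) / 2" if "t \<ge> 0" for t
  proof -
    have p: "x + t > 0" using x that by simp
    have "1 + y\<^sup>2 / (x + t)\<^sup>2 = ((x + t)\<^sup>2 + y\<^sup>2) / (x + t)\<^sup>2" using p by (simp add: field_simps)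
    moreover have "(x + t)\<^sup>2 + y\<^sup>2 > 0" using p by (simp add: add_pos_nonneg)
    ultimately show ?thesis using p by (simp add: D_def ln_div ln_realpow diff_divide_distrib)
  qed
  have anti: "D t \<le> D s" if "0 \<le> s" "s \<le> t" for s t
  proof -
    have "y\<^sup>2 / (x + t)\<^sup>2 \<le> y\<^sup>2 / (x + s)\<^sup>2" using x that by (intro divide_left_mono power_mono mult_pos_pos) auto
    moreover have "0 \<le> y\<^sup>2 / (x + t)\<^sup>2" by simp
    ultimately have "ln (1 + y\<^sup>2 / (x + t)\<^sup>2) \<le> ln (1 + y\<^sup>2 / (x + s)\<^sup>2)" by (subst ln_le_cancel_iff) linarith+
    thus ?thesis using that by (simp add: D_eq)
  qed
  have U': "(U has_real_derivative D t) (at t)" if "t \<ge> 0" for t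
  proof -
    have p: "x + t > 0" using x that by simp
    have q: "(x + t)\<^sup>2 + y\<^sup>2 > 0" using p by (simp add: add_pos_nonneg)
    have q': "1 + (y / (x + t))\<^sup>2 = ((x + t)\<^sup>2 + y\<^sup>2) / (x + t)\<^sup>2" using p by (simp add: field_simps)
    have l: "((\<lambda>t. ln ((x + t)\<^sup>2 + y\<^sup>2)) has_real_derivative (2 * (x + t) / ((x + t)\<^sup>2 + y\<^sup>2))) (at t)"
    proof (rule DERIV_cong[OF DERIV_chain2[where g = "\<lambda>t. (x + t)\<^sup>2 + y\<^sup>2" and f = ln, OF DERIV_ln[OF q]]])
      show "((\<lambda>t. (x + t)\<^sup>2 + y\<^sup>2) has_real_derivative 2 * (x + t)) (at t)"
        by (auto intro!: derivative_eq_intros)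
    qed (simp add: divide_inverse mult.commute)
    have dq: "((\<lambda>t. y / (x + t)) has_real_derivative (- y / (x + t)\<^sup>2)) (at t)"
    proof (rule DERIV_cong)
      show "((\<lambda>t. y / (x + t)) has_real_derivative ((0 * (x + t) - y * (0 + 1)) / ((x + t) * (x + t)))) (at t)"
        using p by (intro DERIV_divide DERIV_const DERIV_add DERIV_ident) auto
    qed (simp add: power2_eq_square)
    have at: "((\<lambda>t. arctan (y / (x + t))) has_real_derivative (- y / (x + t)\<^sup>2 / (1 + (y / (x + t))\<^sup>2))) (at t)"
      by (rule DERIV_cong[OF DERIV_chain2[where g = "\<lambda>t. y / (x + t)" and f = arctan, OF DERIV_arctan dq]]) (simp add: divide_inverse mult.commute)
    have xt: "((\<lambda>t. x + t) has_real_derivative 1) (at t)"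
      by (auto intro!: derivative_eq_intros)
    have "((\<lambda>t. stirling_main (x + t) y) has_real_derivative
        ((1 * ln ((x + t)\<^sup>2 + y\<^sup>2) + 2 * (x + t) / ((x + t)\<^sup>2 + y\<^sup>2) * (x + t)) / 2
         - (- y / (x + t)\<^sup>2 / (1 + (y / (x + t))\<^sup>2)) * y - 1)) (at t)"
      unfolding stirling_main_def mult.commute[of y "arctan _"]
      by (intro DERIV_diff DERIV_cdivide DERIV_mult DERIV_cmult_right l at xt)
    hence "((\<lambda>t. stirling_main (x + t) y) has_real_derivative
        (ln ((x + t)\<^sup>2 + y\<^sup>2) + (x + t) * (2 * (x + t) / ((x + t)\<^sup>2 + y\<^sup>2))) / 2
         - y * (- y / (x + t)\<^sup>2 / (1 + (y / (x + t))\<^sup>2)) - 1) (at t)"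
      by (simp only: mult.commute mult_1_left)
    also have "- y / (x + t)\<^sup>2 / (1 + (y / (x + t))\<^sup>2) = - y / ((x + t)\<^sup>2 + y\<^sup>2)"
      unfolding q' using p by simp
    also have "(ln ((x + t)\<^sup>2 + y\<^sup>2) + (x + t) * (2 * (x + t) / ((x + t)\<^sup>2 + y\<^sup>2))) / 2
         - y * (- y / ((x + t)\<^sup>2 + y\<^sup>2)) - 1 = ln ((x + t)\<^sup>2 + y\<^sup>2) / 2 + (((x + t)\<^sup>2 + y\<^sup>2) / ((x + t)\<^sup>2 + y\<^sup>2) - 1)"
    proof -
      have "(L + a * (2 * a / D)) / 2 - y * (- y / D) - 1 = L / 2 + ((a\<^sup>2 + y\<^sup>2) / D - 1)" for a L D :: real
        by (simp add: power2_eq_square add_divide_distrib)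
      thus ?thesis .
    qed
    finally have 1: "((\<lambda>t. stirling_main (x + t) y) has_real_derivative ln ((x + t)\<^sup>2 + y\<^sup>2) / 2) (at t)"
      using p by simp
    have 2: "((\<lambda>t. stirling_main (x + t) 0) has_real_derivative ln (x + t)) (at t)"
    proof (rule DERIV_cong)
      show "((\<lambda>t. stirling_main (x + t) 0) has_real_derivative
         (ln ((x + t)\<^sup>2) + (x + t) * (2 * (x + t) / (x + t)\<^sup>2)) / 2 - 1) (at t)"
        unfolding stirling_main_def using p by (auto intro!: derivative_eq_intros)
      show "(ln ((x + t)\<^sup>2) + (x + t) * (2 * (x + t) / (x + t)\<^sup>2)) / 2 - 1 = ln (x + t)"
      proof -
        have "(x + t) * (2 * (x + t) / (x + t)\<^sup>2) = 2"
        proof -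
          have "a * (2 * a / a\<^sup>2) = 2" if "a \<noteq> 0" for a :: real using that by (simp add: power2_eq_square)
          thus ?thesis using p by (metis less_irrefl)
        qed
        moreover have "ln ((x + t)\<^sup>2) = 2 * ln (x + t)" using p by (simp add: ln_realpow)
        ultimately show ?thesis by (simp add: add_divide_distrib)
      qed
    qed
    show ?thesis unfolding U_def D_def by (rule DERIV_diff[OF 1 2])
  qed
  have step: "D (real k + 1) \<le> U (real k + 1) - U (real k)" "U (real k + 1) - U (real k) \<le> D (real k)" for k :: nat
  proof -
    obtain c where c: "real k < c" "c < real k + 1" "U (real k + 1) - U (real k) = (real k + 1 - real k) * D c"
      using MVT2[of "real k" "real k + 1" U D] U' by auto
    thus "D (real k + 1) \<le> U (real k + 1) - U (real k)" "U (real k + 1) - U (real k) \<le> D (real k)"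
      using anti[of "real k" c] anti[of c "real k + 1"] by auto
  qed
  have lower: "U (real (Suc n)) - U 0 \<le> (\<Sum>k\<le>n. D (real k))" for n
  proof (induction n)
    case 0 thus ?case using step(2)[of 0] by simp
  next
    case (Suc n) thus ?case using step(2)[of "Suc n"] by (simp add: add_ac)
  qed
  have upper: "(\<Sum>k\<le>n. D (real k)) \<le> D 0 + U (real n) - U 0" for n
  proof (induction n)
    case (Suc n) thus ?case using step(1)[of "n"] by (simp add: add_ac)
  qed auto
  have U_lim: "(\<lambda>n. U (real n)) \<longlonglongrightarrow> 0"
  proof (rule Lim_null_comparison)
    show "\<forall>\<^sub>F n in sequentially. norm (U (real n)) \<le> 2 * (y\<^sup>2 / (x + real n))"
    proof (intro always_eventually allI)
      fix n :: nat
      have p: "x + real n > 0" using x by simp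
      have "U (real n) = (x + real n) * D (real n) - y * arctan (y / (x + real n))"
        using p by (simp add: U_def D_def stirling_main_def ln_realpow right_diff_distrib)
      moreover have "\<bar>(x + real n) * D (real n)\<bar> \<le> y\<^sup>2 / (x + real n)"
      proof -
        have "D (real n) \<ge> 0" by (simp add: D_eq)
        moreover have "D (real n) \<le> y\<^sup>2 / (x + real n)\<^sup>2"
        proof -
          have "D (real n) = ln (1 + y\<^sup>2 / (x + real n)\<^sup>2) / 2" by (simp add: D_eq)
          moreover have "y\<^sup>2 / (x + real n)\<^sup>2 \<ge> 0" by simp
          ultimately show ?thesis using ln_add_one_self_le_self[of "y\<^sup>2 / (x + real n)\<^sup>2"] by linarith
        qed
        ultimately have "\<bar>(x + real n) * D (real n)\<bar> \<le> (x + real n) * (y\<^sup>2 / (x + real n)\<^sup>2)"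
          using p by (simp add: abs_mult del: times_divide_eq_right)
        thus ?thesis using p by (simp add: power2_eq_square)
      qed
      moreover have "\<bar>y * arctan (y / (x + real n))\<bar> \<le> y\<^sup>2 / (x + real n)"
      proof -
        have "\<bar>arctan (y / (x + real n))\<bar> \<le> \<bar>y / (x + real n)\<bar>" by (rule abs_arctan_le)
        hence "\<bar>y\<bar> * \<bar>arctan (y / (x + real n))\<bar> \<le> \<bar>y\<bar> * \<bar>y / (x + real n)\<bar>" by (rule mult_left_mono) simp
        also have "\<dots> = y\<^sup>2 / (x + real n)" using p by (simp add: power2_eq_square)
        finally show ?thesis by (simp add: abs_mult)
      qed
      ultimately show "norm (U (real n)) \<le> 2 * (y\<^sup>2 / (x + real n))" by simp
    qed
    show "(\<lambda>n. 2 * (y\<^sup>2 / (x + real n))) \<longlonglongrightarrow> 0"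
      by (intro tendsto_mult_right_zero tendsto_divide_0[OF tendsto_const] filterlim_at_top_imp_at_infinity
            filterlim_tendsto_add_at_top[OF tendsto_const] filterlim_real_sequentially)
  qed
  have zni: "z \<notin> \<int>\<^sub>\<le>\<^sub>0" using x z by (auto elim!: nonpos_Ints_cases)
  have G: "Gamma x > 0" using x by (rule Gamma_real_pos)
  have Gz: "Gamma z \<noteq> 0" using zni by (simp add: Gamma_eq_zero_iff)
  have S: "ln (Gamma_series x n) - ln (norm (Gamma_series z n)) = (\<Sum>k\<le>n. D (real k))" for n
  proof -
    have nz: "norm (z + of_nat k) > 0" for k
      using x z by (auto simp: complex_eq_iff)
    have px: "pochhammer x (n + 1) = (\<Prod>k\<le>n. x + real k)"
      by (simp add: pochhammer_prod atLeast0_lessThan_Suc lessThan_Suc_atMost atLeast0LessThan)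
    have pz: "norm (pochhammer z (n + 1)) = (\<Prod>k\<le>n. norm (z + of_nat k))"
      by (simp add: pochhammer_prod prod_norm lessThan_Suc_atMost atLeast0LessThan)
    have P: "(\<Prod>k\<le>n. norm (z + of_nat k)) > 0" "(\<Prod>k\<le>n. x + real k) > 0"
      using nz x by (auto intro!: prod_pos add_pos_nonneg)
    have e: "norm (exp (z * of_real (ln (real n)))) = exp (x * ln (real n))" by (simp add: z)
    have "ln (Gamma_series x n) = ln (fact n * exp (x * ln (real n))) - (\<Sum>k\<le>n. ln (x + real k))"
      using P x by (simp add: Gamma_series_def px[simplified] ln_div ln_prod add_pos_nonneg)
    moreover have "ln (norm (Gamma_series z n)) = ln (fact n * exp (x * ln (real n))) - (\<Sum>k\<le>n. ln (norm (z + of_nat k)))"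
    proof -
      have "norm (Gamma_series z n) = fact n * exp (x * ln (real n)) / (\<Prod>k\<le>n. norm (z + of_nat k))"
        unfolding Gamma_series_def norm_divide norm_mult e pz by simp
      thus ?thesis using P nz by (simp only:) (subst ln_div, auto simp: ln_prod)
    qed
    moreover have "ln (norm (z + of_nat k)) - ln (x + real k) = D (real k)" for k
      by (simp add: D_def cmod_def z ln_sqrt)
    ultimately show ?thesis by (simp flip: sum_subtractf)
  qed
  have "(\<lambda>n. ln (Gamma_series x n) - ln (norm (Gamma_series z n))) \<longlonglongrightarrow> ln (Gamma x) - ln (norm (Gamma z))"
    using G Gz by (intro tendsto_intros Gamma_series_LIMSEQ) auto
  hence lim: "(\<lambda>n. \<Sum>k\<le>n. D (real k)) \<longlonglongrightarrow> ln (Gamma x) - ln (norm (Gamma z))"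
    unfolding S .
  have d: "d = U 0" by (simp add: d_def U_def)
  have "(\<lambda>n. U (real (Suc n)) - U 0) \<longlonglongrightarrow> 0 - U 0"
    by (intro tendsto_diff tendsto_const LIMSEQ_Suc[OF U_lim])
  from LIMSEQ_le[OF this lim] lower
  show "- d \<le> ln (Gamma x) - ln (norm (Gamma (Complex x y)))" by (auto simp: d z_def)
  have "(\<lambda>n. D 0 + U (real n) - U 0) \<longlonglongrightarrow> D 0 + 0 - U 0" by (intro tendsto_intros U_lim)
  from LIMSEQ_le[OF lim this] upper
  show "ln (Gamma x) - ln (norm (Gamma (Complex x y))) \<le> ln (x\<^sup>2 + y\<^sup>2) / 2 - ln x - d"
    by (auto simp: d z_def D_def)
qed

lemma ln_fact_bounds:
  assumes "n \<ge> 1"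
  shows "real n * ln n - n \<le> ln (fact n)" "ln (fact n) \<le> (real n + 1) * ln (real n + 1) - n"
proof -
  have l: "ln (1 + t) \<ge> t / (1 + t)" if "t > 0" for t :: real
  proof -
    have "ln (1 / (1 + t)) \<le> 1 / (1 + t) - 1" using that by (intro ln_le_minus_one) auto
    moreover have "1 / (1 + t) - 1 = - (t / (1 + t))" using that by (simp add: field_simps)
    ultimately show ?thesis using that by (simp add: ln_div)
  qed
  have "real n * ln n - n \<le> ln (fact n) \<and> ln (fact n) \<le> (real n + 1) * ln (real n + 1) - n"
    using assms
  proof (induction n rule: dec_induct)
    case base
    show ?case using l[of 1] by simp
  next
    case (step n)
    have n: "real n \<ge> 1" using step by simp
    have f: "ln (fact (Suc n) :: real) = ln (real n + 1) + ln (fact n)"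
      using n by (simp add: ln_mult add_ac)
    have a: "ln (real n + 1) - ln (real n) = ln (1 + 1 / real n)"
    proof -
      have "1 + 1 / real n = (real n + 1) / real n" using n by (simp add: field_simps)
      thus ?thesis using n by (simp add: ln_div)
    qed
    have b: "ln (real n + 2) - ln (real n + 1) = ln (1 + 1 / (real n + 1))"
    proof -
      have "1 + 1 / (real n + 1) = (real n + 2) / (real n + 1)" using n by (simp add: field_simps)
      thus ?thesis using n by (simp add: ln_div)
    qed
    have "real n * (ln (real n + 1) - ln (real n)) \<le> real n * (1 / real n)"
      unfolding a using n by (intro mult_left_mono ln_add_one_self_le_self) auto
    hence 1: "real n * ln (real n + 1) - real n * ln (real n) \<le> 1" using n by (simp add: algebra_simps)
    have "(real n + 2) * (1 / (real n + 1) / (1 + 1 / (real n + 1))) \<le> (real n + 2) * (ln (real n + 2) - ln (real n + 1))"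
      unfolding b using n by (intro mult_left_mono l) auto
    moreover have "1 / (real n + 1) / (1 + 1 / (real n + 1)) = 1 / (real n + 2)" using n by (simp add: field_simps)
    ultimately have 2: "1 \<le> (real n + 2) * ln (real n + 2) - (real n + 2) * ln (real n + 1)"
      using n by (simp add: algebra_simps)
    show ?case using step.IH 1 2 unfolding f by (simp add: algebra_simps)
  qed
  thus "real n * ln n - n \<le> ln (fact n)" "ln (fact n) \<le> (real n + 1) * ln (real n + 1) - n" by auto
qed

text \<open>
  The bounds at the integers are carried over to real arguments by the log-convexity of \<Gamma>.
\<close>
lemma ln_Gamma_real_bound:
  fixes x :: real
  assumes x: "x \<ge> 1"
  shows "\<bar>ln (Gamma x) - (x * ln x - x)\<bar> \<le> 2 * ln (x + 1) + 1"
proof -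
  define n where "n = nat \<lfloor>x\<rfloor>"
  have n: "n \<ge> 1" "real n \<le> x" "x \<le> real n + 1" using x unfolding n_def by (simp_all add: le_nat_floor of_nat_floor le_of_int_ceiling) linarith?
  note conv = log_convex_Gamma_real
  have G1: "ln (Gamma (real n + 1)) = ln (fact n)" by (simp add: Gamma_fact add.commute)
  have G2: "ln (Gamma (real n + 2)) = ln (fact n) + ln (real n + 1)"
    using Gamma_fact[of "Suc n", where ?'a = real] by (simp add: ln_mult add_ac)
  have G0: "ln (Gamma (real n)) \<le> ln (fact n)"
  proof -
    have "Gamma (real n) = fact (n - 1)" using Gamma_fact[of "n - 1", where ?'a = real] n by simp
    thus ?thesis by (simp add: fact_mono)
  qed
  have up: "ln (Gamma x) \<le> ln (fact n)"
  proof -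
    define u where "u = x - real n"
    have u: "0 \<le> u" "u \<le> 1" using n by (auto simp: u_def)
    have "(ln \<circ> Gamma) ((1 - u) *\<^sub>R real n + u *\<^sub>R (real n + 1)) \<le> (1 - u) * (ln \<circ> Gamma) (real n) + u * (ln \<circ> Gamma) (real n + 1)"
      using u n by (intro convex_onD[OF conv]) auto
    moreover have "(1 - u) *\<^sub>R real n + u *\<^sub>R (real n + 1) = x" by (simp add: u_def algebra_simps)
    ultimately have "ln (Gamma x) \<le> (1 - u) * ln (Gamma (real n)) + u * ln (fact n)" by (simp add: G1)
    also have "\<dots> \<le> (1 - u) * ln (fact n) + u * ln (fact n)"
      using u G0 by (intro add_right_mono mult_left_mono) auto
    finally show ?thesis by (simp add: algebra_simps)
  qed
  have lo: "ln (Gamma x) \<ge> ln (fact n) - ln (real n + 1)"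
  proof -
    define v where "v = real n + 1 - x"
    have v: "0 \<le> v" "v \<le> 1" using n by (auto simp: v_def)
    define u where "u = v / (1 + v)"
    have u: "0 \<le> u" "u \<le> 1" "1 - u = 1 / (1 + v)" using v by (auto simp: u_def field_simps)
    have "(ln \<circ> Gamma) ((1 - u) *\<^sub>R x + u *\<^sub>R (real n + 2)) \<le> (1 - u) * (ln \<circ> Gamma) x + u * (ln \<circ> Gamma) (real n + 2)"
      using u n x by (intro convex_onD[OF conv]) auto
    moreover have "(1 - u) *\<^sub>R x + u *\<^sub>R (real n + 2) = real n + 1"
    proof -
      have "(1 - u) *\<^sub>R x + u *\<^sub>R (real n + 2) = (x + v * (real n + 2)) / (1 + v)"
        unfolding u(3) by (simp add: u_def add_divide_distrib)
      also have "x + v * (real n + 2) = (real n + 1) * (1 + v)" by (simp add: v_def algebra_simps)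
      finally show ?thesis using v by simp
    qed
    ultimately have "ln (fact n) \<le> 1 / (1 + v) * ln (Gamma x) + v / (1 + v) * (ln (fact n) + ln (real n + 1))"
      using G1 G2 u(3) by (simp add: u_def)
    also have "\<dots> = (ln (Gamma x) + v * (ln (fact n) + ln (real n + 1))) / (1 + v)" by (simp add: add_divide_distrib)
    finally have "ln (fact n) * (1 + v) \<le> ln (Gamma x) + v * (ln (fact n) + ln (real n + 1))"
      using v by (simp add: pos_le_divide_eq)
    hence "ln (fact n) - v * ln (real n + 1) \<le> ln (Gamma x)" by (simp add: algebra_simps)
    moreover have "v * ln (real n + 1) \<le> 1 * ln (real n + 1)" using v n by (intro mult_right_mono) auto
    ultimately show ?thesis by simp
  qed
  have mono: "a * ln a - a \<le> b * ln b - b" if "1 \<le> a" "a \<le> b" for a b :: real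
  proof (rule DERIV_nonneg_imp_nondecreasing[of a b "\<lambda>t. t * ln t - t"])
    fix t assume "a \<le> t" "t \<le> b"
    hence "t \<ge> 1" using that by simp
    hence "((\<lambda>t. t * ln t - t) has_real_derivative ln t) (at t)" by (auto intro!: derivative_eq_intros)
    thus "\<exists>y. ((\<lambda>t. t * ln t - t) has_real_derivative y) (at t) \<and> 0 \<le> y" using \<open>t \<ge> 1\<close> by (intro exI[of _ "ln t"]) auto
  qed (use that in auto)
  have gap: "(real n + 1) * ln (real n + 1) - real n * ln (real n) \<le> ln (real n + 1) + 1"
  proof -
    have "1 + 1 / real n = (real n + 1) / real n" using n by (simp add: field_simps)
    hence "ln (real n + 1) - ln (real n) = ln (1 + 1 / real n)" using n by (simp add: ln_div)
    also have "\<dots> \<le> 1 / real n" by (intro ln_add_one_self_le_self) auto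
    finally have "real n * (ln (real n + 1) - ln (real n)) \<le> real n * (1 / real n)" by (intro mult_left_mono) auto
    thus ?thesis using n by (simp add: algebra_simps)
  qed
  have "ln (real n + 1) \<le> ln (x + 1)" using n by simp
  moreover have "ln (real n + 1) \<ge> 0" by simp
  ultimately show ?thesis
    using up lo gap mono[of "real n" x] mono[of x "real n + 1"] n x ln_fact_bounds[OF n(1)] by linarith
qed

lemma stirling:
  assumes z: "Re z \<ge> 1"
  shows "\<bar>ln (norm (Gamma z)) - Re (z * Ln z - z)\<bar> \<le> 3 * ln (norm z + 1) + 1"
proof -
  define x y where "x = Re z" and "y = Im z"
  have x: "x \<ge> 1" using z by (simp add: x_def)
  have zC: "z = Complex x y" by (simp add: x_def y_def)
  have m: "Re (z * Ln z - z) = stirling_main x y"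
    using stirling_main_eq[of z] z by (simp add: x_def y_def)
  have s0: "stirling_main x 0 = x * ln x - x" using x by (simp add: stirling_main_def ln_realpow)
  have nz: "norm z = sqrt (x\<^sup>2 + y\<^sup>2)" by (simp add: cmod_def x_def y_def)
  have n1: "norm z \<ge> x" unfolding x_def by (rule complex_Re_le_cmod)
  have z0: "norm z > 0" using n1 x by linarith
  have "ln (x\<^sup>2 + y\<^sup>2) / 2 = ln (norm z)" using x by (simp add: nz ln_sqrt add_pos_nonneg)
  moreover have "ln (norm z) \<le> ln (norm z + 1)" "ln (x + 1) \<le> ln (norm z + 1)" "0 \<le> ln x" "0 \<le> ln (norm z + 1)"
    using n1 x z0 by (simp_all add: ln_le_cancel_iff)
  ultimately show ?thesis
    using ln_norm_Gamma_diff_bounds[of x y] ln_Gamma_real_bound[OF x] x unfolding m s0 zC[symmetric] by linarith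
qed

section \<open>The size of the completed zeta function\<close>

text \<open>
  The main term of log |xi(w)|. For Re w >= 0 it is the real part of
  (w/2) Log(w/2) - w/2 - (w/2) log \<pi>; the absolute values make it even.
\<close>
definition xi_main :: "complex \<Rightarrow> real" where
  "xi_main w = (\<bar>Re w\<bar> * (ln (norm w / (2 * pi)) - 1) - \<bar>Im w\<bar> * arccos (\<bar>Re w\<bar> / norm w)) / 2"

lemma xi_main_minus: "xi_main (- w) = xi_main w"
  by (simp add: xi_main_def)

lemma Im_times_Im_Ln:
  assumes "Re w \<ge> 0" "w \<noteq> 0"
  shows "Im w * Im (Ln w) = \<bar>Im w\<bar> * arccos (\<bar>Re w\<bar> / norm w)"
proof -
  have a: "Im (Ln w) = Arg w" using assms by (simp add: Arg_eq_Im_Ln)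
  have "cos \<bar>Arg w\<bar> = \<bar>Re w\<bar> / norm w" using assms by (simp add: cos_Arg)
  moreover have "\<bar>Arg w\<bar> \<le> pi" using Arg_bounded[of w] by auto
  ultimately have b: "arccos (\<bar>Re w\<bar> / norm w) = \<bar>Arg w\<bar>" by (metis arccos_cos abs_ge_zero)
  have "Im w * Arg w = \<bar>Im w\<bar> * \<bar>Arg w\<bar>"
  proof -
    have "Im w * Arg w \<ge> 0"
      using Arg_less_0[of w] Arg_neg_iff[of w] by (cases "Im w < 0") (auto simp: mult_nonpos_nonpos)
    thus ?thesis by (simp add: abs_mult[symmetric])
  qed
  thus ?thesis using a b by simp
qed

lemma ln_ge_1: "R \<ge> 4 \<Longrightarrow> ln R \<ge> (1::real)"
proof -
  assume R: "R \<ge> 4"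
  hence "exp 1 \<le> R" using exp_le by linarith
  thus ?thesis using R by (subst ln_ge_iff) auto
qed

lemma norm_Ln_le_ln:
  assumes "norm z \<ge> 1" "norm z \<le> R"
  shows "norm (Ln z) \<le> ln R + 4"
proof -
  have z: "z \<noteq> 0" using assms by auto
  have "norm (Ln z) \<le> \<bar>Re (Ln z)\<bar> + \<bar>Im (Ln z)\<bar>" by (rule cmod_le)
  also have "\<bar>Re (Ln z)\<bar> \<le> ln R" using assms z by simp
  also have "\<bar>Im (Ln z)\<bar> \<le> pi" using mpi_less_Im_Ln[OF z] Im_Ln_le_pi[OF z] by simp
  finally show ?thesis using pi_less_4 by simp
qed

text \<open>
  The argument 5/4 + w/2 is 1 + s/2 for s = 1/2 + w. As the derivative of z Log z - z is Log z,
  moving the argument from 5/4 + w/2 to w/2 in Stirling's main term costs O(log R).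
\<close>
lemma Gamma_right_estimate:
  assumes w: "Re w \<ge> 0" and R: "norm w = R" "R \<ge> 4"
  shows "\<bar>ln (norm (Gamma (5/4 + w / 2))) - ln pi * Re w / 2 - xi_main w\<bar> \<le> 14 * ln R"
proof -
  define u where "u = 5/4 + w / 2"
  have lnR: "ln R \<ge> 1" using R by (intro ln_ge_1)
  have w0: "w \<noteq> 0" using R by auto
  have Re_u: "Re u \<ge> 1" using w by (simp add: u_def)
  have "norm u \<le> norm (5/4 :: complex) + norm (w / 2)" unfolding u_def by (rule norm_triangle_ineq)
  hence nu: "norm u \<le> 5/4 + R / 2" using R by simp
  have "ln (norm u + 1) \<le> ln (R * R)"
  proof -
    have "norm u + 1 \<le> R * R" using nu R mult_left_mono[of 4 R R] by linarith
    thus ?thesis by (subst ln_le_cancel_iff) (use R in \<open>auto intro: add_nonneg_pos mult_pos_pos\<close>)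
  qed
  also have "\<dots> = 2 * ln R" using R by (simp add: ln_mult)
  finally have 1: "\<bar>ln (norm (Gamma u)) - Re (u * Ln u - u)\<bar> \<le> 7 * ln R"
    using stirling[OF Re_u] lnR by linarith
  have "norm ((u * Ln u - u) - (w / 2 * Ln (w / 2) - w / 2)) \<le> (ln R + 4) * norm (u - w / 2)"
  proof (rule field_differentiable_bound[where f = "\<lambda>z. z * Ln z - z" and f' = Ln and S = "closed_segment (w / 2) u"])
    fix z assume z: "z \<in> closed_segment (w / 2) u"
    then obtain t where t': "0 \<le> t" "t \<le> 1" "z = (1 - t) *\<^sub>R (w / 2) + t *\<^sub>R u"
      by (auto simp: closed_segment_def)
    have "(1 - T) * a + T * (c + a) = a + T * c" for T a c :: complex by (simp add: algebra_simps)
    hence "z = w / 2 + of_real t * (5/4)"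
      using t'(3) by (simp only: u_def scaleR_conv_of_real of_real_diff of_real_1)
    with t' have t: "0 \<le> t" "t \<le> 1" "z = w / 2 + of_real (t * (5/4))" by simp_all
    have re: "Re z \<ge> Re w / 2" and im: "Im z = Im w / 2" using t by auto
    have "(Re w / 2)\<^sup>2 \<le> (Re z)\<^sup>2" using re w by (intro power_mono) auto
    hence "(norm (w / 2))\<^sup>2 \<le> (norm z)\<^sup>2"
      unfolding cmod_power2 by (simp add: im)
    hence n1: "norm z \<ge> R / 2" using R by (simp add: norm_divide power2_le_iff_abs_le)
    have "norm z \<le> norm (w / 2) + norm (of_real (t * (5/4)) :: complex)" unfolding t(3) by (rule norm_triangle_ineq)
    also have "\<dots> \<le> R / 2 + 5/4" using t R by (simp add: norm_mult)
    finally have n2: "norm z \<le> R" using R by simp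
    show "norm (Ln z) \<le> ln R + 4" using n1 n2 R by (intro norm_Ln_le_ln) auto
    have "z \<notin> \<real>\<^sub>\<le>\<^sub>0"
    proof
      assume "z \<in> \<real>\<^sub>\<le>\<^sub>0"
      hence "Re z \<le> 0" "Im z = 0" by (auto simp: complex_nonpos_Reals_iff)
      hence "Re z = 0" "Im z = 0" using re w by auto
      hence "norm z = 0" by (simp add: complex_eq_iff)
      thus False using n1 R by simp
    qed
    moreover from this have "z \<noteq> 0" by auto
    ultimately show "((\<lambda>z. z * Ln z - z) has_field_derivative Ln z) (at z within closed_segment (w / 2) u)"
      by (auto intro!: derivative_eq_intros)
  qed auto
  also have "norm (u - w / 2) = 5/4" by (simp add: u_def)
  also have "(ln R + 4) * (5/4) \<le> 7 * ln R" using lnR by simp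
  finally have 2: "\<bar>Re (u * Ln u - u) - Re (w / 2 * Ln (w / 2) - w / 2)\<bar> \<le> 7 * ln R"
    using abs_Re_le_cmod[of "(u * Ln u - u) - (w / 2 * Ln (w / 2) - w / 2)"] by (simp only: minus_complex.sel)
  have Lw: "Ln (w / 2) = of_real (ln (1/2)) + Ln w"
    using Ln_times_of_real[of "1/2" w] Ln_of_real[of "1/2"] w0 by simp
  have "Re (w / 2 * Ln (w / 2) - w / 2) = (Re w * (ln (1/2) + ln R) - Im w * Im (Ln w) - Re w) / 2"
    unfolding Lw using R w0 by (simp add: field_simps)
  also have "\<dots> = (Re w * (ln R - ln 2) - \<bar>Im w\<bar> * arccos (\<bar>Re w\<bar> / norm w) - Re w) / 2"
    unfolding Im_times_Im_Ln[OF w w0] by (simp add: ln_div)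
  also have "\<dots> = xi_main w + ln pi * Re w / 2"
  proof -
    have e: "ln (R / (2 * pi)) = ln R - ln 2 - ln pi" using R by (simp add: ln_div ln_mult)
    show ?thesis unfolding xi_main_def R(1) e using w by (simp add: field_simps)
  qed
  finally have 3: "Re (w / 2 * Ln (w / 2) - w / 2) = xi_main w + ln pi * Re w / 2" .
  show ?thesis using 1 2 unfolding 3 u_def[symmetric] by linarith
qed

lemma xi_nonzero_away:
  assumes "\<bar>Re w\<bar> \<ge> 3/2"
  shows "xi w \<noteq> 0"
proof -
  have *: "xi w \<noteq> 0" if "Re w \<ge> 3/2" for w
  proof -
    have "0 < Re (1/2 + w - 1)" using that by simp
    also have "\<dots> \<le> norm (1/2 + w - 1)" by (rule complex_Re_le_cmod)
    finally have "norm (1/2 + w - 1) > 0" .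
    hence "zeta_reg (1/2 + w) \<noteq> 0" using norm_zeta_reg_ge[of "1/2 + w"] that by auto
    thus ?thesis using xi_eq_0_iff[of w] that by simp
  qed
  show ?thesis using *[of w] *[of "- w"] assms by (cases "Re w \<ge> 0") (auto simp: xi_even)
qed

lemma xi_bounds_aux:
  obtains C where "C \<ge> 1"
    "\<And>w R. Re w \<ge> 0 \<Longrightarrow> norm w = R \<Longrightarrow> R \<ge> 4 \<Longrightarrow> xi w \<noteq> 0 \<Longrightarrow> ln (norm (xi w)) \<le> xi_main w + C * ln R"
    "\<And>w R. Re w \<ge> 3/2 \<Longrightarrow> norm w = R \<Longrightarrow> R \<ge> 4 \<Longrightarrow> ln (norm (xi w)) \<ge> xi_main w - C * ln R"
proof -
  obtain C1 where C1: "C1 \<ge> 1" "\<And>s. Re s \<ge> 1/2 \<Longrightarrow> norm (zeta_reg s) \<le> C1 * (norm s + 1) ^ 2"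
    using norm_zeta_reg_le by blast
  have eq: "ln (norm (xi w)) = ln (norm (zeta_reg (1/2 + w))) + ln (norm (Gamma (5/4 + w / 2))) - ln pi * Re w / 2 - ln pi / 4"
    if w: "Re w \<ge> 0" and nz: "zeta_reg (1/2 + w) \<noteq> 0" for w
  proof -
    have G: "Gamma (5/4 + w / 2) \<noteq> 0" using w by (intro Gamma_nonzero_right) auto
    have e: "1 + (1/2 + w) / 2 = 5/4 + w / 2" by (simp add: field_simps)
    have "norm (xi w) = norm (zeta_reg (1/2 + w)) * exp (- (1/2 + Re w) / 2 * ln pi) * norm (Gamma (5/4 + w / 2))"
      using w by (simp add: xi_right_shift xi_right_def norm_mult e)
    thus ?thesis using G nz by (simp add: ln_mult) (simp add: field_simps)
  qed
  have lpi: "0 \<le> ln pi" "ln pi / 4 \<le> 1"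
  proof -
    show "0 \<le> ln pi" using pi_gt3 by simp
    have "ln pi \<le> pi - 1" by (rule ln_le_minus_one) simp
    thus "ln pi / 4 \<le> 1" using pi_less_4 by linarith
  qed
  define C where "C = ln C1 + 20"
  have lC: "ln C1 \<ge> 0" using C1 by simp
  show ?thesis
  proof (rule that[of C])
    show "C \<ge> 1" using lC by (simp add: C_def)
    fix w R assume w: "Re w \<ge> 0" "norm w = R" "R \<ge> 4" "xi w \<noteq> 0"
    have nz: "zeta_reg (1/2 + w) \<noteq> 0" using xi_eq_0_iff[of w] w by auto
    have "norm (1/2 + w) \<le> norm (1/2 :: complex) + norm w" by (rule norm_triangle_ineq)
    moreover have "R * 4 \<le> R * R" using w by (intro mult_left_mono) auto
    moreover have "norm (1/2 :: complex) = 1/2" by (simp add: norm_divide)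
    ultimately have "norm (1/2 + w) + 1 \<le> R * R" using w(2,3) by linarith
    hence "(norm (1/2 + w) + 1) ^ 2 \<le> (R * R) ^ 2" by (intro power_mono) auto
    hence "C1 * (norm (1/2 + w) + 1) ^ 2 \<le> C1 * (R * R) ^ 2" using C1 by (intro mult_left_mono) auto
    hence "norm (zeta_reg (1/2 + w)) \<le> C1 * (R * R) ^ 2" using C1(2)[of "1/2 + w"] w by simp
    hence "ln (norm (zeta_reg (1/2 + w))) \<le> ln (C1 * (R * R) ^ 2)"
      using nz C1 w by (subst ln_le_cancel_iff) auto
    also have "\<dots> = ln C1 + 4 * ln R" using C1 w by (simp add: ln_mult ln_realpow)
    also have "\<dots> \<le> (ln C1 + 4) * ln R" using lC ln_ge_1[OF w(3)] mult_left_mono[of 1 "ln R" "ln C1"] by (simp add: algebra_simps)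
    finally show "ln (norm (xi w)) \<le> xi_main w + C * ln R"
      using Gamma_right_estimate[OF w(1,2,3)] eq[OF w(1) nz] lpi ln_ge_1[OF w(3)] unfolding C_def distrib_right by linarith
  next
    fix w R assume w: "Re w \<ge> 3/2" "norm w = R" "R \<ge> 4"
    have "norm (w - 1/2) \<ge> norm w - norm (1/2 :: complex)" by (rule norm_triangle_ineq2)
    hence n: "norm (w - 1/2) \<ge> 1" using w by (simp add: norm_divide)
    have "norm (zeta_reg (1/2 + w)) \<ge> norm (1/2 + w - 1) / 4" using w by (intro norm_zeta_reg_ge) auto
    also have "1/2 + w - 1 = w - 1/2" by simp
    finally have z: "norm (zeta_reg (1/2 + w)) \<ge> 1/4" using n by linarith
    hence nz: "zeta_reg (1/2 + w) \<noteq> 0" by auto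
    have "ln (1/4) \<le> ln (norm (zeta_reg (1/2 + w)))" using z nz by (subst ln_le_cancel_iff) auto
    moreover have "ln (1/4) = - ln (4::real)" by (simp add: ln_div)
    moreover have "ln 4 \<le> ln R" using w by simp
    moreover have "C * ln R \<ge> 20 * ln R" using lC ln_ge_1[OF w(3)] unfolding C_def distrib_right by simp
    moreover have "0 \<le> Re w" using w by simp
    ultimately show "ln (norm (xi w)) \<ge> xi_main w - C * ln R"
      using Gamma_right_estimate[of w, OF _ w(2,3)] eq[of w, OF _ nz] lpi ln_ge_1[OF w(3)] by linarith
  qed
qed

text \<open>
  At distance 3/2 from the imaginary axis the argument s = 1/2 + w, or 1/2 - w, has real part at least
  2, where the Dirichlet series is bounded away from 0. The upper bound holds everywhere.
\<close>
lemma xi_bounds: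
  obtains C where "C \<ge> 1"
    "\<And>w R. norm w = R \<Longrightarrow> R \<ge> 4 \<Longrightarrow> xi w \<noteq> 0 \<Longrightarrow> ln (norm (xi w)) \<le> xi_main w + C * ln R"
    "\<And>w R. \<bar>Re w\<bar> \<ge> 3/2 \<Longrightarrow> norm w = R \<Longrightarrow> R \<ge> 4 \<Longrightarrow> ln (norm (xi w)) \<ge> xi_main w - C * ln R"
proof -
  obtain C where C: "C \<ge> 1"
    "\<And>w R. Re w \<ge> 0 \<Longrightarrow> norm w = R \<Longrightarrow> R \<ge> 4 \<Longrightarrow> xi w \<noteq> 0 \<Longrightarrow> ln (norm (xi w)) \<le> xi_main w + C * ln R"
    "\<And>w R. Re w \<ge> 3/2 \<Longrightarrow> norm w = R \<Longrightarrow> R \<ge> 4 \<Longrightarrow> ln (norm (xi w)) \<ge> xi_main w - C * ln R"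
    using xi_bounds_aux by blast
  show ?thesis
  proof (rule that[OF C(1)])
    show "ln (norm (xi w)) \<le> xi_main w + C * ln R" if "norm w = R" "R \<ge> 4" "xi w \<noteq> 0" for w R
      using C(2)[of w R] C(2)[of "- w" R] that by (cases "Re w \<ge> 0") (auto simp: xi_even xi_main_minus)
    show "ln (norm (xi w)) \<ge> xi_main w - C * ln R" if "\<bar>Re w\<bar> \<ge> 3/2" "norm w = R" "R \<ge> 4" for w R
      using C(3)[of w R] C(3)[of "- w" R] that by (cases "Re w \<ge> 0") (auto simp: xi_even xi_main_minus)
  qed
qed

section \<open>Integrals and Poisson kernels on a circle\<close>

text \<open>
  The integrand has the same integral over each of the four quadrants, and on [0,\<pi>/2] it is
  a cos t - t sin t.
\<close>
lemma abs_trig_integral: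
  "((\<lambda>t. \<bar>cos t\<bar> * a - \<bar>sin t\<bar> * arccos \<bar>cos t\<bar>) has_integral (4 * (a - 1))) {0..2*pi}"
proof -
  define G where "G = (\<lambda>t. cos t * a - sin t * t)"
  define P where "P = (\<lambda>t. a * sin t - sin t + t * cos t)"
  define W where "W = (\<lambda>t. \<bar>cos t\<bar> * a - \<bar>sin t\<bar> * arccos \<bar>cos t\<bar>)"
  have P': "(P has_real_derivative G t) (at t within A)" for t A
    unfolding P_def G_def by (auto intro!: derivative_eq_intros simp: algebra_simps)
  have P0: "P (pi / 2) - P 0 = a - 1" by (simp add: P_def)
  have WG: "W t = G t" if "0 \<le> t" "t \<le> pi / 2" for t
  proof -
    have "cos t \<ge> 0" "sin t \<ge> 0" using that by (auto intro!: cos_ge_zero sin_ge_zero)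
    moreover have "arccos (cos t) = t" using that by (intro arccos_cos) auto
    ultimately show ?thesis by (simp add: W_def G_def)
  qed
  have W1: "W t = W (pi - t)" for t by (simp add: W_def)
  have W2: "W t = W (t - pi)" for t by (simp add: W_def cos_diff sin_diff)
  have W3: "W t = W (2 * pi - t)" for t by (simp add: W_def cos_diff sin_diff)
  have q0: "(W has_integral (a - 1)) {0..pi/2}"
  proof -
    have "(G has_integral (P (pi / 2) - P 0)) {0..pi/2}"
      by (rule fundamental_theorem_of_calculus) (use P' in \<open>auto simp: has_real_derivative_iff_has_vector_derivative[symmetric]\<close>)
    thus ?thesis unfolding P0 by (rule has_integral_eq[rotated]) (use WG in auto)
  qed
  have q1: "(W has_integral (a - 1)) {pi/2..pi}"
  proof -
    have "((\<lambda>t. G (pi - t)) has_integral (- P (pi - pi) - - P (pi - pi/2))) {pi/2..pi}"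
    proof (rule fundamental_theorem_of_calculus)
      fix t
      have "((\<lambda>t. - P (pi - t)) has_real_derivative - (G (pi - t) * (0 - 1))) (at t within {pi/2..pi})"
        by (intro DERIV_minus DERIV_chain2[OF P'] DERIV_diff DERIV_const DERIV_ident)
      thus "((\<lambda>t. - P (pi - t)) has_vector_derivative G (pi - t)) (at t within {pi/2..pi})"
        by (simp add: has_real_derivative_iff_has_vector_derivative)
    qed auto
    also have "- P (pi - pi) - - P (pi - pi/2) = a - 1" using P0 by simp
    finally show ?thesis
    proof (rule has_integral_eq[rotated])
      fix t assume "t \<in> {pi/2..pi}"
      thus "G (pi - t) = W t" using WG[of "pi - t"] W1[of t] by simp
    qed
  qed
  have q2: "(W has_integral (a - 1)) {pi..3*pi/2}"
  proof -
    have "((\<lambda>t. G (t - pi)) has_integral (P (3*pi/2 - pi) - P (pi - pi))) {pi..3*pi/2}"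
    proof (rule fundamental_theorem_of_calculus)
      fix t
      have "((\<lambda>t. P (t - pi)) has_real_derivative (G (t - pi) * (1 - 0))) (at t within {pi..3*pi/2})"
        by (intro DERIV_chain2[OF P'] DERIV_diff DERIV_const DERIV_ident)
      thus "((\<lambda>t. P (t - pi)) has_vector_derivative G (t - pi)) (at t within {pi..3*pi/2})"
        by (simp add: has_real_derivative_iff_has_vector_derivative)
    qed auto
    also have "P (3*pi/2 - pi) - P (pi - pi) = a - 1" using P0 by (simp add: field_simps)
    finally show ?thesis
    proof (rule has_integral_eq[rotated])
      fix t assume "t \<in> {pi..3*pi/2}"
      thus "G (t - pi) = W t" using WG[of "t - pi"] W2[of t] by simp
    qed
  qed
  have q3: "(W has_integral (a - 1)) {3*pi/2..2*pi}"
  proof -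
    have "((\<lambda>t. G (2*pi - t)) has_integral (- P (2*pi - 2*pi) - - P (2*pi - 3*pi/2))) {3*pi/2..2*pi}"
    proof (rule fundamental_theorem_of_calculus)
      fix t
      have "((\<lambda>t. - P (2*pi - t)) has_real_derivative - (G (2*pi - t) * (0 - 1))) (at t within {3*pi/2..2*pi})"
        by (intro DERIV_minus DERIV_chain2[OF P'] DERIV_diff DERIV_const DERIV_ident)
      thus "((\<lambda>t. - P (2*pi - t)) has_vector_derivative G (2*pi - t)) (at t within {3*pi/2..2*pi})"
        by (simp add: has_real_derivative_iff_has_vector_derivative)
    qed auto
    also have "- P (2*pi - 2*pi) - - P (2*pi - 3*pi/2) = a - 1" using P0 by (simp add: field_simps)
    finally show ?thesis
    proof (rule has_integral_eq[rotated])
      fix t assume "t \<in> {3*pi/2..2*pi}"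
      thus "G (2*pi - t) = W t" using WG[of "2*pi - t"] W3[of t] by simp
    qed
  qed
  have "(W has_integral ((a - 1) + (a - 1))) {0..pi}"
    by (rule has_integral_combine[OF _ _ q0 q1]) auto
  moreover have "(W has_integral ((a - 1) + (a - 1))) {pi..2*pi}"
    by (rule has_integral_combine[OF _ _ q2 q3]) auto
  ultimately have "(W has_integral ((a - 1) + (a - 1)) + ((a - 1) + (a - 1))) {0..2*pi}"
    by (rule has_integral_combine[rotated 2]) auto
  thus ?thesis by (simp add: W_def algebra_simps)
qed

lemma xi_main_circle:
  assumes "R > 0"
  shows "xi_main (of_real R * cis t) = R / 2 * (\<bar>cos t\<bar> * (ln (R / (2 * pi)) - 1) - \<bar>sin t\<bar> * arccos \<bar>cos t\<bar>)"
proof -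
  have 1: "\<bar>Re (of_real R * cis t)\<bar> = R * \<bar>cos t\<bar>" "\<bar>Im (of_real R * cis t)\<bar> = R * \<bar>sin t\<bar>" "norm (of_real R * cis t) = R"
    using assms by (simp_all add: norm_mult abs_mult)
  have 2: "R * \<bar>cos t\<bar> / R = \<bar>cos t\<bar>" using assms by simp
  have "(R * c * l - R * s * a) / 2 = R / 2 * (c * l - s * a)" for c l s a :: real by (simp add: field_simps)
  thus ?thesis unfolding xi_main_def 1 2 .
qed

text \<open>
  The base point lies at distance sqrt R from the imaginary axis, and at a distance of this
  order from the circle, so that its Poisson kernel is at least of order sqrt R on the short arc near iR.
\<close>
lemma poisson_lower_near_top:
  assumes R: "R \<ge> 16" and c: "\<bar>R * cos t\<bar> < 3/2" and s: "sin t \<ge> 0"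
  defines "q \<equiv> Complex (sqrt R) (R - sqrt R)"
  shows "sqrt R / 16 \<le> poisson R q t"
proof -
  define r where "r = sqrt R"
  have r: "r \<ge> 4" using R by (simp add: r_def real_le_rsqrt)
  have rr: "R = r * r" using R by (simp add: r_def)
  have nq: "(norm q)\<^sup>2 = r\<^sup>2 + (R - r)\<^sup>2" by (simp add: q_def cmod_power2 r_def)
  have num: "R\<^sup>2 - (norm q)\<^sup>2 \<ge> R * r"
  proof -
    have "R\<^sup>2 - (norm q)\<^sup>2 - R * r = r * r * (r - 2)" unfolding nq rr by algebra
    also have "\<dots> \<ge> 0" using r by simp
    finally show ?thesis by simp
  qed
  have den: "(norm (of_real R * cis t - q))\<^sup>2 = (R * cos t - r)\<^sup>2 + (R * sin t - R + r)\<^sup>2"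
  proof -
    have "R * sin t - (R - r) = R * sin t - R + r" by simp
    moreover have "(norm (of_real R * cis t - q))\<^sup>2 = (R * cos t - r)\<^sup>2 + (R * sin t - (R - r))\<^sup>2"
      by (simp add: q_def cmod_power2 r_def)
    ultimately show ?thesis by (simp only:)
  qed
  have a: "(R * cos t - r)\<^sup>2 \<le> (2 * r)\<^sup>2" using c r by (intro power2_le_iff_abs_le[THEN iffD2]) auto
  have b: "\<bar>R * sin t - R + r\<bar> \<le> r"
  proof -
    have "sin t \<le> 1" by simp
    hence "R * sin t \<le> R * 1" using R by (intro mult_left_mono) auto
    moreover have "R - R * sin t \<le> 2 * r"
    proof -
      have "sin t * sin t \<le> sin t * 1" using s by (intro mult_left_mono) auto
      hence "1 - sin t \<le> (cos t)\<^sup>2" unfolding cos_squared_eq by (simp add: power2_eq_square)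
      hence "R * (R * (1 - sin t)) \<le> R * (R * (cos t)\<^sup>2)" using R by (intro mult_left_mono) auto
      also have "\<dots> = \<bar>R * cos t\<bar>\<^sup>2" by (simp add: power2_eq_square)
      also have "\<dots> \<le> (3/2)\<^sup>2" using c by (intro power_mono) auto
      also have "\<dots> \<le> R * (2 * r)"
      proof -
        have "16 * 8 \<le> R * (2 * r)" using R r by (intro mult_mono) auto
        thus ?thesis by (simp add: power2_eq_square)
      qed
      finally have "R * (1 - sin t) \<le> 2 * r" using R by simp
      thus ?thesis by (simp add: algebra_simps)
    qed
    ultimately show ?thesis by (simp add: abs_le_iff)
  qed
  have "(R * sin t - R + r)\<^sup>2 \<le> r\<^sup>2" using b r by (intro power2_le_iff_abs_le[THEN iffD2]) auto
  with a have "(norm (of_real R * cis t - q))\<^sup>2 \<le> (2 * r)\<^sup>2 + r\<^sup>2" unfolding den by linarith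
  also have "\<dots> \<le> 16 * R" unfolding rr by (simp add: power2_eq_square)
  finally have den_le: "(norm (of_real R * cis t - q))\<^sup>2 \<le> 16 * R" .
  have den_pos: "(norm (of_real R * cis t - q))\<^sup>2 > 0"
  proof -
    have "R * cos t - r < 0" using c r by linarith
    hence "(R * cos t - r)\<^sup>2 > 0" by simp
    thus ?thesis unfolding den by (simp add: add_pos_nonneg)
  qed
  have "sqrt R / 16 = R * r / (16 * R)" using R by (simp add: r_def)
  also have "\<dots> \<le> R * r / (norm (of_real R * cis t - q))\<^sup>2"
    using den_le den_pos R r by (intro divide_left_mono mult_pos_pos) auto
  also have "\<dots> \<le> poisson R q t" unfolding poisson_def using num by (intro divide_right_mono) auto
  finally show ?thesis .
qed

lemma poisson_minus: "poisson R (- q) t = poisson R q (t + pi)"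
proof -
  have "of_real R * cis t - (- q) = - (of_real R * cis (t + pi) - q)"
    by (simp add: cis_mult[symmetric])
  thus ?thesis unfolding poisson_def by (metis norm_minus_cancel)
qed

lemma poisson_nonneg: "norm q < R \<Longrightarrow> 0 \<le> poisson R q t"
  unfolding poisson_def by (intro divide_nonneg_nonneg) (auto simp: power_mono)

lemma continuous_on_poisson:
  assumes "norm q < R"
  shows "continuous_on A (poisson R q)"
proof -
  have "of_real R * cis t \<noteq> q" for t
  proof
    assume "of_real R * cis t = q"
    hence "norm q = \<bar>R\<bar>" by (metis mult.right_neutral norm_cis norm_mult norm_of_real)
    thus False using assms by linarith
  qed
  thus ?thesis unfolding poisson_def by (intro continuous_intros) auto
qed

section \<open>The mean of the logarithm over a circle\<close>

lemma xi_main_le: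
  assumes "norm w \<le> R" "R \<ge> 4" "w \<noteq> 0"
  shows "xi_main w \<le> R * ln R"
proof -
  have n: "norm w > 0" using assms by simp
  have q: "0 \<le> \<bar>Re w\<bar> / norm w" "\<bar>Re w\<bar> / norm w \<le> 1" using n abs_Re_le_cmod[of w] by (auto simp: divide_le_eq_1)
  have q3: "-1 \<le> \<bar>Re w\<bar> / norm w" using q by linarith
  have 1: "\<bar>Im w\<bar> * arccos (\<bar>Re w\<bar> / norm w) \<ge> 0" by (intro mult_nonneg_nonneg arccos_lbound q q3) auto
  have "ln (norm w / (2 * pi)) - 1 \<le> ln R"
  proof -
    have "norm w / (2 * pi) \<le> R / 1" using assms pi_gt3 n by (intro frac_le) auto
    moreover have "norm w / (2 * pi) > 0" "R > 0" using n assms by auto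
    ultimately have "ln (norm w / (2 * pi)) \<le> ln R" by (subst ln_le_cancel_iff) auto
    thus ?thesis by simp
  qed
  hence "\<bar>Re w\<bar> * (ln (norm w / (2 * pi)) - 1) \<le> \<bar>Re w\<bar> * ln R" by (intro mult_left_mono) auto
  also have "\<dots> \<le> R * ln R" using abs_Re_le_cmod[of w] assms ln_ge_1[OF assms(2)] by (intro mult_right_mono) auto
  finally have "\<bar>Re w\<bar> * (ln (norm w / (2 * pi)) - 1) \<le> R * ln R" .
  moreover have "R * ln R \<ge> 0" using assms ln_ge_1[OF assms(2)] by simp
  ultimately have "\<bar>Re w\<bar> * (ln (norm w / (2 * pi)) - 1) - \<bar>Im w\<bar> * arccos (\<bar>Re w\<bar> / norm w) \<le> R * ln R * 2"
    using 1 by linarith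
  thus ?thesis unfolding xi_main_def by simp
qed

lemma xi_main_ge:
  assumes "norm w \<le> R" "norm w \<ge> 2 * pi"
  shows "xi_main w \<ge> - (3 * R)"
proof -
  have n: "norm w > 0" using assms(2) pi_gt_zero by linarith
  have q: "0 \<le> \<bar>Re w\<bar> / norm w" "\<bar>Re w\<bar> / norm w \<le> 1" using n abs_Re_le_cmod[of w] by (auto simp: divide_le_eq_1)
  have q3: "-1 \<le> \<bar>Re w\<bar> / norm w" using q by linarith
  have "arccos (\<bar>Re w\<bar> / norm w) \<le> pi" by (intro arccos_ubound q q3)
  define B where "B = \<bar>Im w\<bar> * arccos (\<bar>Re w\<bar> / norm w)"
  define A where "A = \<bar>Re w\<bar> * (ln (norm w / (2 * pi)) - 1)"
  have "B \<le> R * 4" unfolding B_def using \<open>arccos (\<bar>Re w\<bar> / norm w) \<le> pi\<close>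
    using abs_Im_le_cmod[of w] assms pi_less_4 arccos_lbound[OF q3 q(2)] by (intro mult_mono) auto
  moreover have "ln (norm w / (2 * pi)) \<ge> 0" using assms n by (intro ln_ge_zero) (auto simp: le_divide_eq)
  hence "A \<ge> \<bar>Re w\<bar> * (-1)" unfolding A_def by (intro mult_left_mono) auto
  moreover have "\<bar>Re w\<bar> \<le> R" using abs_Re_le_cmod[of w] assms by linarith
  moreover have "R \<ge> 0" using n assms by linarith
  ultimately have "A - B \<ge> - (6 * R)" by linarith
  thus ?thesis unfolding xi_main_def A_def[symmetric] B_def[symmetric] by simp
qed

text \<open>
  The defect D = main term + O(log R) - log |xi| is nonnegative on the circle. It is O(log R) off two
  arcs near the imaginary axis. On these arcs it is dominated by 16/sqrt R times its product with the
  Poisson kernels of q = sqrt R + i (R - sqrt R) and -q; the integrals of these products are O(R log R), because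
  log |xi| is subharmonic and not too small at q.
\<close>
lemma xi_circle_mean:
  obtains K where "K \<ge> 0"
    "\<And>R. R \<ge> 16 \<Longrightarrow> (\<And>z. norm z = R \<Longrightarrow> xi z \<noteq> 0) \<Longrightarrow>
       \<bar>integral {0..2*pi} (\<lambda>t. ln (norm (xi (of_real R * cis t)))) - 2 * R * (ln (R / (2 * pi)) - 2)\<bar> \<le> K * (sqrt R * ln R)"
proof -
  obtain C where C: "C \<ge> 1"
    "\<And>w R. norm w = R \<Longrightarrow> R \<ge> 4 \<Longrightarrow> xi w \<noteq> 0 \<Longrightarrow> ln (norm (xi w)) \<le> xi_main w + C * ln R"
    "\<And>w R. \<bar>Re w\<bar> \<ge> 3/2 \<Longrightarrow> norm w = R \<Longrightarrow> R \<ge> 4 \<Longrightarrow> ln (norm (xi w)) \<ge> xi_main w - C * ln R"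
    using xi_bounds by blast
  define K where "K = 4 * pi * C + 64 * pi * (2 * C + 4) + 2 * pi * C"
  have "\<bar>integral {0..2*pi} (\<lambda>t. ln (norm (xi (of_real R * cis t)))) - 2 * R * (ln (R / (2 * pi)) - 2)\<bar> \<le> K * (sqrt R * ln R)"
    if R: "R \<ge> 16" and nz: "\<And>z. norm z = R \<Longrightarrow> xi z \<noteq> 0" for R
  proof -
    define r where "r = sqrt R"
    have r: "r \<ge> 4" using R by (simp add: r_def real_le_rsqrt)
    have rr: "R = r * r" using R by (simp add: r_def)
    have lnR: "ln R \<ge> 1" using R by (intro ln_ge_1) auto
    define v where "v = (\<lambda>t. ln (norm (xi (of_real R * cis t))))"
    define V where "V = (\<lambda>t. xi_main (of_real R * cis t))"
    define D where "D = (\<lambda>t. V t + C * ln R - v t)"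
    define q where "q = Complex r (R - r)"
    have nR: "norm (of_real R * cis t) = R" for t using R by (simp add: norm_mult)
    have V_eq: "V = (\<lambda>t. R / 2 * (\<bar>cos t\<bar> * (ln (R / (2 * pi)) - 1) - \<bar>sin t\<bar> * arccos \<bar>cos t\<bar>))"
      using R by (auto simp: V_def xi_main_circle)
    have V_int: "(V has_integral (2 * R * (ln (R / (2 * pi)) - 2))) {0..2*pi}"
    proof -
      have "(V has_integral (R / 2 * (4 * ((ln (R / (2 * pi)) - 1) - 1)))) {0..2*pi}"
        unfolding V_eq by (intro has_integral_mult_right abs_trig_integral)
      thus ?thesis by (simp add: algebra_simps)
    qed
    have V_cont: "continuous_on A V" for A
      unfolding V_eq by (intro continuous_intros) auto
    have v_cont: "continuous_on A v" for A
    proof -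
      have "continuous_on UNIV xi" using holomorphic_xi by (rule holomorphic_on_imp_continuous_on)
      hence "continuous_on A (\<lambda>t. xi (of_real R * cis t))"
        by (rule continuous_on_compose2) (auto intro!: continuous_intros)
      thus ?thesis unfolding v_def using nz nR by (intro continuous_intros) auto
    qed
    have D_cont: "continuous_on A D" for A unfolding D_def by (intro continuous_intros V_cont v_cont)
    have D_nonneg: "D t \<ge> 0" for t
      using C(2)[OF nR, of t] nz[OF nR] R by (simp add: D_def V_def v_def)
    have "(norm q)\<^sup>2 = R\<^sup>2 - 2 * r * r * (r - 1)"
      unfolding q_def cmod_power2 rr by (simp add: algebra_simps power2_eq_square)
    moreover have "2 * r * r * (r - 1) > 0" using r by (intro mult_pos_pos) auto
    ultimately have "(norm q)\<^sup>2 < R\<^sup>2" by linarith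
    hence q: "norm q < R" using R by (simp add: power2_less_imp_less)
    have q': "norm (- q) < R" using q by simp
    have xq: "ln (norm (xi q)) \<ge> - (3 * R) - C * ln R" and xq0: "xi q \<noteq> 0"
    proof -
      have n: "norm q \<ge> 12"
      proof -
        have "R - r \<le> norm q" using complex_Re_le_cmod[of q] abs_Im_le_cmod[of q] by (simp add: q_def)
        moreover have "r * (r - 1) \<ge> 4 * 3" using r by (intro mult_mono) auto
        ultimately show ?thesis unfolding rr by (simp add: algebra_simps)
      qed
      have "\<bar>Re q\<bar> \<ge> 3/2" using r by (simp add: q_def)
      from C(3)[OF this refl] n have "ln (norm (xi q)) \<ge> xi_main q - C * ln (norm q)" by simp
      moreover have "xi_main q \<ge> - (3 * R)" using q n pi_less_4 pi_approx by (intro xi_main_ge) auto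
      moreover have "ln (norm q) \<le> ln R"
      proof (subst ln_le_cancel_iff)
        show "norm q > 0" using n by linarith
      qed (use q R in auto)
      hence "C * ln (norm q) \<le> C * ln R" using C(1) by (intro mult_left_mono) auto
      ultimately show "ln (norm (xi q)) \<ge> - (3 * R) - C * ln R" by linarith
      show "xi q \<noteq> 0" by (rule xi_nonzero_away) fact
    qed
    have fin: "finite {z \<in> ball 0 R. xi z = 0}"
      by (rule finite_subset[OF _ finite_xi_zeros[of R]]) auto
    have PD: "integral {0..2*pi} (\<lambda>t. poisson R p t * D t) \<le> 2 * pi * ((2 * C + 4) * (R * ln R))"
      if p: "norm p < R" and xp: "ln (norm (xi p)) \<ge> - (3 * R) - C * ln R" and xp0: "xi p \<noteq> 0" for p
    proof -
      let ?P = "poisson R p"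
      define M where "M = R * ln R + C * ln R"
      have cP: "continuous_on A ?P" for A using p by (rule continuous_on_poisson)
      have Pn: "?P t \<ge> 0" for t using p by (rule poisson_nonneg)
      have sub: "2 * pi * ln (norm (xi p)) \<le> integral {0..2*pi} (\<lambda>t. ?P t * v t)"
        unfolding v_def using R
        by (intro poisson_subharmonic[where R' = "R + 1"] holomorphic_xi nz p xp0 fin) auto
      have "integral {0..2*pi} (\<lambda>t. ?P t * D t) \<le> integral {0..2*pi} (\<lambda>t. ?P t * M - ?P t * v t)"
      proof (rule integral_le)
        fix t
        have "of_real R * cis t \<noteq> 0" using R by simp
        hence "V t \<le> R * ln R" unfolding V_def using nR[of t] R by (intro xi_main_le) auto
        hence "D t \<le> M - v t" by (simp add: D_def M_def)
        hence "?P t * D t \<le> ?P t * (M - v t)" using Pn by (rule mult_left_mono)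
        thus "?P t * D t \<le> ?P t * M - ?P t * v t" by (simp add: right_diff_distrib)
      qed (intro integrable_continuous_interval continuous_intros cP D_cont v_cont)+
      also have "\<dots> = integral {0..2*pi} (\<lambda>t. ?P t * M) - integral {0..2*pi} (\<lambda>t. ?P t * v t)"
        by (intro integral_diff integrable_continuous_interval continuous_intros cP v_cont)
      also have "integral {0..2*pi} (\<lambda>t. ?P t * M) = 2 * pi * M"
        using has_integral_mult_left[OF poisson_has_integral[of R p], of M] p R by (intro integral_unique) auto
      also have "2 * pi * M - integral {0..2*pi} (\<lambda>t. ?P t * v t) \<le> 2 * pi * (M - ln (norm (xi p)))"
        using sub by (simp add: right_diff_distrib)
      also have "M - ln (norm (xi p)) \<le> (2 * C + 4) * (R * ln R)"
      proof -
        have "C * ln R \<le> C * (R * ln R)" using C(1) R lnR mult_right_mono[of 1 R "ln R"] by (intro mult_left_mono) auto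
        moreover have "R * 1 \<le> R * ln R" using R lnR by (intro mult_left_mono) auto
        moreover have "(2 * C + 4) * (R * ln R) = 2 * (C * (R * ln R)) + 4 * (R * ln R)" by (simp add: algebra_simps)
        ultimately show ?thesis using xp unfolding M_def by linarith
      qed
      finally show ?thesis by simp
    qed
    have D_le: "D t \<le> 2 * C * ln R + 16 / r * (poisson R q t * D t + poisson R (- q) t * D t)" for t
    proof (cases "\<bar>R * cos t\<bar> < 3/2")
      case False
      hence "D t \<le> 2 * C * ln R"
        using C(3)[OF _ nR, of t] R by (simp add: D_def V_def v_def)
      moreover have "16 / r * (poisson R q t * D t + poisson R (- q) t * D t) \<ge> 0"
        using r D_nonneg poisson_nonneg[OF q] poisson_nonneg[OF q'] by (intro mult_nonneg_nonneg add_nonneg_nonneg) auto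
      ultimately show ?thesis by linarith
    next
      case True
      have "r / 16 \<le> poisson R q t + poisson R (- q) t"
      proof (cases "sin t \<ge> 0")
        case s: True
        have "r / 16 \<le> poisson R q t"
          using poisson_lower_near_top[OF R True s] by (simp add: q_def r_def)
        thus ?thesis using poisson_nonneg[OF q', of t] by linarith
      next
        case False
        have "r / 16 \<le> poisson R q (t + pi)"
          using poisson_lower_near_top[OF R, of "t + pi"] True False by (simp add: q_def r_def)
        thus ?thesis using poisson_nonneg[OF q, of t] unfolding poisson_minus by linarith
      qed
      hence "16 / r * (r / 16) * D t \<le> 16 / r * (poisson R q t + poisson R (- q) t) * D t"
        using r D_nonneg by (intro mult_right_mono mult_left_mono) auto
      hence "D t \<le> 16 / r * (poisson R q t * D t + poisson R (- q) t * D t)"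
        using r by (simp add: distrib_left distrib_right)
      moreover have "2 * C * ln R \<ge> 0" using C(1) lnR by simp
      ultimately show ?thesis by linarith
    qed
    have D_int: "integral {0..2*pi} D \<le> 4 * pi * C * ln R + 64 * pi * (2 * C + 4) * (r * ln R)"
    proof -
      let ?I = "\<lambda>p. integral {0..2*pi} (\<lambda>t. poisson R p t * D t)"
      have cP: "continuous_on A (poisson R q)" "continuous_on A (poisson R (- q))" for A
        using q q' by (intro continuous_on_poisson; simp)+
      have i: "(\<lambda>t. poisson R q t * D t) integrable_on {0..2*pi}" "(\<lambda>t. poisson R (- q) t * D t) integrable_on {0..2*pi}"
        by (intro integrable_continuous_interval continuous_intros cP D_cont)+
      have h: "((\<lambda>t. 2 * C * ln R + 16 / r * (poisson R q t * D t + poisson R (- q) t * D t)) has_integral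
               (2 * C * ln R * (2 * pi) + 16 / r * (?I q + ?I (- q)))) {0..2*pi}"
        using has_integral_const_real[of "2 * C * ln R" 0 "2 * pi"]
        by (intro has_integral_add has_integral_mult_right integrable_integral i) (simp add: mult.commute)
      have "integral {0..2*pi} D \<le> integral {0..2*pi} (\<lambda>t. 2 * C * ln R + 16 / r * (poisson R q t * D t + poisson R (- q) t * D t))"
        by (intro integral_le D_le integrable_continuous_interval D_cont has_integral_integrable[OF h])
      also have "\<dots> = 2 * C * ln R * (2 * pi) + 16 / r * (?I q + ?I (- q))" by (rule integral_unique[OF h])
      also have "\<dots> \<le> 2 * C * ln R * (2 * pi) + 16 / r * (2 * pi * ((2 * C + 4) * (R * ln R)) + 2 * pi * ((2 * C + 4) * (R * ln R)))"
        using r xq xq0 by (intro add_left_mono mult_left_mono add_mono PD q q') (auto simp: xi_even)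
      also have "\<dots> = 4 * pi * C * ln R + 64 * pi * (2 * C + 4) * (r * ln R)"
        unfolding rr using r by (simp add: field_simps)
      finally show ?thesis .
    qed
    have "integral {0..2*pi} D = 2 * R * (ln (R / (2 * pi)) - 2) + C * ln R * (2 * pi) - integral {0..2*pi} v"
    proof (rule integral_unique)
      show "(D has_integral (2 * R * (ln (R / (2 * pi)) - 2) + C * ln R * (2 * pi) - integral {0..2*pi} v)) {0..2*pi}"
        unfolding D_def using has_integral_const_real[of "C * ln R" 0 "2 * pi"]
        by (intro has_integral_add has_integral_diff V_int integrable_integral integrable_continuous_interval v_cont) (simp add: mult.commute)
    qed
    moreover have "integral {0..2*pi} D \<ge> 0" by (intro integral_nonneg integrable_continuous_interval D_cont D_nonneg)
    moreover have "ln R \<le> r * ln R" using r lnR mult_right_mono[of 1 r "ln R"] by simp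
    hence "4 * pi * C * ln R \<le> 4 * pi * C * (r * ln R)" "2 * pi * C * ln R \<le> 2 * pi * C * (r * ln R)"
      using C(1) by (intro mult_left_mono; simp)+
    moreover have "64 * pi * (2 * C + 4) * (r * ln R) \<ge> 0" "4 * pi * C * (r * ln R) \<ge> 0" using C(1) r lnR by auto
    moreover have "K * (sqrt R * ln R) = 4 * pi * C * (r * ln R) + 64 * pi * (2 * C + 4) * (r * ln R) + 2 * pi * C * (r * ln R)"
      unfolding K_def r_def by (simp add: distrib_right)
    moreover have "C * ln R * (2 * pi) = 2 * pi * C * ln R" by simp
    ultimately show ?thesis using D_int unfolding v_def[symmetric] abs_le_iff by linarith
  qed
  moreover have "K \<ge> 0" unfolding K_def using C(1) by simp
  ultimately show ?thesis using that by blast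
qed

text \<open>
  Jensen's formula, applied to the preceding mean.
\<close>
lemma log_zero_sum_asymptotics:
  assumes RH: "riemann_hypothesis"
  obtains K where "K \<ge> 0"
    "\<And>R. R \<ge> 16 \<Longrightarrow> R \<notin> ordinates \<Longrightarrow>
       \<bar>zero_sum (\<lambda>t. ln (R / t)) R - R / (2 * pi) * (ln (R / (2 * pi)) - 2)\<bar> \<le> K * (sqrt R * ln R)"
proof -
  obtain K where K: "K \<ge> 0"
    "\<And>R. R \<ge> 16 \<Longrightarrow> (\<And>z. norm z = R \<Longrightarrow> xi z \<noteq> 0) \<Longrightarrow>
       \<bar>integral {0..2*pi} (\<lambda>t. ln (norm (xi (of_real R * cis t)))) - 2 * R * (ln (R / (2 * pi)) - 2)\<bar> \<le> K * (sqrt R * ln R)"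
    using xi_circle_mean by blast
  define L where "L = ln (norm (xi 0))"
  show ?thesis
  proof (rule that[of "K + \<bar>L\<bar>"])
    show "K + \<bar>L\<bar> \<ge> 0" using K by simp
    fix R assume R: "R \<ge> 16" "R \<notin> ordinates"
    have nz: "xi z \<noteq> 0" if "norm z = R" for z
    proof
      assume x: "xi z = 0"
      have re: "Re z = 0" by (rule xi_zero_imp_imaginary[OF RH x])
      have "R \<in> ordinates" if "Im w > 0" "xi w = 0" "norm w = R" "Re w = 0" for w
      proof -
        have "1/2 + w \<in> nontrivial_zeros" using that by (simp add: nontrivial_zeros_eq[OF RH])
        moreover have "Im (1/2 + w) = R" using that by (simp add: cmod_eq_Im)
        ultimately show ?thesis using that unfolding ordinates_def mem_Collect_eq
          by (intro exI[of _ "1/2 + w"]) simp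
      qed
      from this[of z] this[of "- z"] R x re that show False
        by (cases "Im z > 0"; cases "Im z = 0") (auto simp: xi_even cmod_eq_Im)
    qed
    have fin: "finite {z \<in> ball 0 R. xi z = 0}"
      by (rule finite_subset[OF _ finite_xi_zeros[of R]]) auto
    define I where "I = integral {0..2*pi} (\<lambda>t. ln (norm (xi (of_real R * cis t))))"
    define N where "N = zero_sum (\<lambda>t. ln (R / t)) R"
    have "I = 2 * pi * (L + 2 * N)"
      unfolding I_def L_def N_def xi_zero_sum[OF RH, symmetric]
      by (intro integral_unique jensen[where R' = "R + 1"] holomorphic_xi nz xi_0_nonzero fin) (use R in auto)
    moreover have "\<bar>I - 2 * R * (ln (R / (2 * pi)) - 2)\<bar> \<le> K * (sqrt R * ln R)"
      unfolding I_def by (rule K(2)[OF R(1) nz])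
    moreover have "N - R / (2 * pi) * (ln (R / (2 * pi)) - 2) = (2 * pi * (L + 2 * N) - 2 * R * (ln (R / (2 * pi)) - 2)) / (4 * pi) - L / 2"
      by (simp add: field_simps)
    ultimately have M: "\<bar>I - 2 * R * (ln (R / (2 * pi)) - 2)\<bar> \<le> K * (sqrt R * ln R)"
      "N - R / (2 * pi) * (ln (R / (2 * pi)) - 2) = (I - 2 * R * (ln (R / (2 * pi)) - 2)) / (4 * pi) - L / 2"
      by (simp_all only:)
    have "\<bar>N - R / (2 * pi) * (ln (R / (2 * pi)) - 2)\<bar> \<le> \<bar>(I - 2 * R * (ln (R / (2 * pi)) - 2)) / (4 * pi)\<bar> + \<bar>L / 2\<bar>"
      unfolding M(2) by (rule abs_triangle_ineq4)
    also have "\<bar>(I - 2 * R * (ln (R / (2 * pi)) - 2)) / (4 * pi)\<bar> \<le> K * (sqrt R * ln R) / (4 * pi)"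
      using M(1) by (simp add: abs_divide divide_right_mono)
    finally have "\<bar>N - R / (2 * pi) * (ln (R / (2 * pi)) - 2)\<bar> \<le> K * (sqrt R * ln R) / (4 * pi) + \<bar>L\<bar> / 2"
      by simp
    also have "K * (sqrt R * ln R) / (4 * pi) \<le> K * (sqrt R * ln R) / 1"
      using K R pi_gt3 ln_ge_1[of R] by (intro divide_left_mono mult_nonneg_nonneg) auto
    also have "\<bar>L\<bar> / 2 \<le> \<bar>L\<bar> * (sqrt R * ln R)"
    proof -
      have "1 * 1 \<le> sqrt R * ln R" using R ln_ge_1[of R] by (intro mult_mono) auto
      hence "\<bar>L\<bar> * 1 \<le> \<bar>L\<bar> * (sqrt R * ln R)" by (intro mult_left_mono) auto
      thus ?thesis by linarith
    qed
    finally show "\<bar>zero_sum (\<lambda>t. ln (R / t)) R - R / (2 * pi) * (ln (R / (2 * pi)) - 2)\<bar> \<le> (K + \<bar>L\<bar>) * (sqrt R * ln R)"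
      unfolding N_def by (simp add: distrib_right)
  qed
qed

section \<open>The counting function of the zeros\<close>

lemma zero_sum_eq_superset:
  assumes RH: "riemann_hypothesis" and "T \<le> U"
  shows "zero_sum \<phi> T = (\<Sum>\<rho>\<in>{\<rho>\<in>nontrivial_zeros. 0 < Im \<rho> \<and> Im \<rho> < U}.
           of_int (zorder riemann_zeta \<rho>) * (if Im \<rho> < T then \<phi> (Im \<rho>) else 0))"
  unfolding zero_sum_def
  by (rule sum.mono_neutral_cong_left[OF finite_zero_index_set[OF RH]]) (use assms in auto)

lemma zero_sum_const: "zero_sum (\<lambda>t. c) T = c * zero_count T"
  by (simp add: zero_sum_def zero_count_def sum_distrib_left mult.commute)

lemma zero_count_nonneg:
  assumes RH: "riemann_hypothesis"
  shows "zero_count T \<ge> 0"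
  unfolding zero_count_def zero_sum_def
  by (intro sum_nonneg) (use zorder_nontrivial_zero_pos[OF RH] in \<open>auto intro: less_imp_le\<close>)

lemma zero_count_mono:
  assumes RH: "riemann_hypothesis" and "T \<le> U"
  shows "zero_count T \<le> zero_count U"
  unfolding zero_count_def zero_sum_def
  by (rule sum_mono2[OF finite_zero_index_set[OF RH]])
     (use assms zorder_nontrivial_zero_pos[OF RH] in \<open>auto intro: less_imp_le\<close>)

text \<open>
  The integral of N(t)/t over [0,R], as a sum over zeros.
\<close>
definition log_zero_sum :: "real \<Rightarrow> real" where
  "log_zero_sum R = zero_sum (\<lambda>t. ln (R / t)) R"

text \<open>
  The difference is the integral of N(t)/t over [R,U], and N is monotone.
\<close>
lemma log_zero_sum_diff:
  assumes RH: "riemann_hypothesis" and R: "0 < R" "R < U"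
  shows "zero_count R * ln (U / R) \<le> log_zero_sum U - log_zero_sum R"
    and "log_zero_sum U - log_zero_sum R \<le> zero_count U * ln (U / R)"
proof -
  let ?A = "{\<rho>\<in>nontrivial_zeros. 0 < Im \<rho> \<and> Im \<rho> < U}"
  let ?m = "\<lambda>\<rho>. real_of_int (zorder riemann_zeta \<rho>)"
  have m: "?m \<rho> \<ge> 0" if "\<rho> \<in> ?A" for \<rho>
    using zorder_nontrivial_zero_pos[OF RH, of \<rho>] that by simp
  have eq: "log_zero_sum U - log_zero_sum R = (\<Sum>\<rho>\<in>?A. ?m \<rho> * (ln (U / Im \<rho>) - (if Im \<rho> < R then ln (R / Im \<rho>) else 0)))"
    unfolding log_zero_sum_def using zero_sum_eq_superset[OF RH, of R U] R
    by (simp add: zero_sum_def sum_subtractf right_diff_distrib)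
  have ln1: "ln (U / g) - ln (R / g) = ln (U / R)" if "g > 0" for g using that R by (simp add: ln_div)
  have "zero_count R * ln (U / R) = (\<Sum>\<rho>\<in>?A. ?m \<rho> * (if Im \<rho> < R then ln (U / R) else 0))"
    using zero_sum_eq_superset[OF RH, of R U "\<lambda>_. ln (U / R)"] R by (simp add: zero_sum_const mult.commute)
  also have "\<dots> \<le> log_zero_sum U - log_zero_sum R"
    unfolding eq
  proof (intro sum_mono mult_left_mono m)
    fix \<rho> assume r: "\<rho> \<in> ?A"
    hence "ln (U / Im \<rho>) \<ge> 0" by (intro ln_ge_zero) (auto simp: le_divide_eq)
    thus "(if Im \<rho> < R then ln (U / R) else 0) \<le> ln (U / Im \<rho>) - (if Im \<rho> < R then ln (R / Im \<rho>) else 0)"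
      using ln1[of "Im \<rho>"] r by auto
  qed
  finally show "zero_count R * ln (U / R) \<le> log_zero_sum U - log_zero_sum R" .
  have "log_zero_sum U - log_zero_sum R \<le> (\<Sum>\<rho>\<in>?A. ?m \<rho> * ln (U / R))"
    unfolding eq
  proof (intro sum_mono mult_left_mono m)
    fix \<rho> assume r: "\<rho> \<in> ?A"
    show "ln (U / Im \<rho>) - (if Im \<rho> < R then ln (R / Im \<rho>) else 0) \<le> ln (U / R)"
    proof (cases "Im \<rho> < R")
      case True thus ?thesis using ln1[of "Im \<rho>"] r by auto
    next
      case False
      have "ln (U / Im \<rho>) \<le> ln (U / R)"
        using False r R by (subst ln_le_cancel_iff) (auto intro!: divide_left_mono divide_pos_pos mult_pos_pos)
      thus ?thesis using False by simp
    qed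
  qed
  also have "\<dots> = zero_count U * ln (U / R)"
    by (simp add: zero_count_def zero_sum_def sum_distrib_right)
  finally show "log_zero_sum U - log_zero_sum R \<le> zero_count U * ln (U / R)" .
qed

lemma log_zero_sum_mono:
  assumes RH: "riemann_hypothesis" and R: "0 < R" "R \<le> U"
  shows "log_zero_sum R \<le> log_zero_sum U"
proof (cases "R = U")
  case False
  have "0 \<le> zero_count R * ln (U / R)"
    using R by (intro mult_nonneg_nonneg zero_count_nonneg[OF RH] ln_ge_zero) (auto simp: le_divide_eq)
  also have "\<dots> \<le> log_zero_sum U - log_zero_sum R" using False R by (intro log_zero_sum_diff RH) auto
  finally show ?thesis by simp
qed auto

lemma exists_non_ordinate:
  assumes RH: "riemann_hypothesis" and "a < b"
  obtains c where "a < c" "c < b" "c \<notin> ordinates"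
proof -
  have "ordinates \<inter> {a<..<b} \<subseteq> Im ` {\<rho>\<in>nontrivial_zeros. 0 < Im \<rho> \<and> Im \<rho> < b}"
    by (auto simp: ordinates_def)
  hence "finite (ordinates \<inter> {a<..<b})"
    by (rule finite_subset) (intro finite_imageI finite_zero_index_set RH)
  hence "\<not> {a<..<b} \<subseteq> ordinates"
    using infinite_Ioo[OF \<open>a < b\<close>] by (metis Int_absorb1)
  then obtain c where "c \<in> {a<..<b}" "c \<notin> ordinates" by blast
  thus ?thesis using that[of c] by simp
qed

lemma ln_le_powr_tenth: "(t::real) > 0 \<Longrightarrow> ln t \<le> 10 * t powr (1/10)"
proof -
  assume t: "t > 0"
  have "ln t = 10 * ln (t powr (1/10))" using t by (simp add: ln_powr)
  also have "ln (t powr (1/10)) \<le> t powr (1/10) - 1" using t by (intro ln_le_minus_one) auto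
  finally show ?thesis by simp
qed

text \<open>
  The main term of log_zero_sum, and its derivative.
\<close>
definition zero_log_main :: "real \<Rightarrow> real" where
  "zero_log_main R = R / (2 * pi) * (ln (R / (2 * pi)) - 2)"

definition zero_log_main' :: "real \<Rightarrow> real" where
  "zero_log_main' R = (ln (R / (2 * pi)) - 1) / (2 * pi)"

lemma zero_log_main_deriv:
  assumes "t > 0"
  shows "(zero_log_main has_real_derivative zero_log_main' t) (at t)"
proof -
  have "(zero_log_main has_real_derivative (1 / (2 * pi) * (ln (t / (2 * pi)) - 2) + t / (2 * pi) * (1 / t))) (at t)"
  proof -
    have "((\<lambda>R. R / P * (ln (R / P) - 2)) has_real_derivative (1 / P * (ln (t / P) - 2) + t / P * (1 / t))) (at t)"
      if "P > 0" for P using assms that by (auto intro!: derivative_eq_intros simp: field_simps)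
    from this[of "2 * pi"] show ?thesis unfolding zero_log_main_def by simp
  qed
  also have "1 / (2 * pi) * (ln (t / (2 * pi)) - 2) + t / (2 * pi) * (1 / t) = zero_log_main' t"
  proof -
    have "1 / P * (l - 2) + t / P * (1 / t) = (l - 1) / P" for P l
      using assms by (simp add: diff_divide_distrib)
    thus ?thesis unfolding zero_log_main'_def .
  qed
  finally show ?thesis .
qed

lemma zero_log_main'_mono: "0 < s \<Longrightarrow> s \<le> t \<Longrightarrow> zero_log_main' s \<le> zero_log_main' t"
  unfolding zero_log_main'_def by (intro divide_right_mono diff_right_mono) (auto intro!: divide_right_mono simp: ln_le_cancel_iff divide_pos_pos)

lemma smooth_count_main: "smooth_count t = 7/8 + t * zero_log_main' t"
  unfolding smooth_count_def zero_log_main'_def by (simp add: diff_divide_distrib right_diff_distrib)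

lemma zero_log_main_mvt:
  assumes "0 < s" "s < t"
  shows "(t - s) * zero_log_main' s \<le> zero_log_main t - zero_log_main s"
    and "zero_log_main t - zero_log_main s \<le> (t - s) * zero_log_main' t"
proof -
  obtain c where c: "s < c" "c < t" "zero_log_main t - zero_log_main s = (t - s) * zero_log_main' c"
    using MVT2[of s t zero_log_main zero_log_main'] zero_log_main_deriv assms by auto
  show "(t - s) * zero_log_main' s \<le> zero_log_main t - zero_log_main s"
    "zero_log_main t - zero_log_main s \<le> (t - s) * zero_log_main' t"
    unfolding c(3) using c assms by (auto intro!: mult_left_mono zero_log_main'_mono)
qed

lemma smooth_count_deriv:
  assumes "t > 0"
  shows "(smooth_count has_real_derivative ln (t / (2 * pi)) / (2 * pi)) (at t)"
proof -
  have "(smooth_count has_real_derivative (1 / (2 * pi) * ln (t / (2 * pi)) + t / (2 * pi) * (1 / t) - 1 / (2 * pi))) (at t)"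
  proof -
    have "((\<lambda>R. 7 / 8 + R / P * ln (R / P) - R / P) has_real_derivative (1 / P * ln (t / P) + t / P * (1 / t) - 1 / P)) (at t)"
      if "P > 0" for P using assms that by (auto intro!: derivative_eq_intros simp: field_simps)
    from this[of "2 * pi"] show ?thesis unfolding smooth_count_def by simp
  qed
  also have "1 / (2 * pi) * ln (t / (2 * pi)) + t / (2 * pi) * (1 / t) - 1 / (2 * pi) = ln (t / (2 * pi)) / (2 * pi)"
    using assms by simp
  finally show ?thesis .
qed

lemma smooth_count_diff_le:
  assumes "1 \<le> s" "s < t"
  shows "smooth_count t - smooth_count s \<le> (t - s) * ln t"
proof -
  obtain c where c: "s < c" "c < t" "smooth_count t - smooth_count s = (t - s) * (ln (c / (2 * pi)) / (2 * pi))"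
    using MVT2[of s t smooth_count "\<lambda>t. ln (t / (2 * pi)) / (2 * pi)"] smooth_count_deriv assms by auto
  have cp: "c > 0" using c assms by linarith
  have p: "2 * pi \<ge> 1" using pi_gt3 by simp
  have "ln (c / (2 * pi)) \<le> ln t"
  proof (subst ln_le_cancel_iff)
    show "c / (2 * pi) \<le> t" using frac_le[of t c 1 "2 * pi"] c assms p cp by simp
  qed (use cp c in auto)
  hence "ln (c / (2 * pi)) / (2 * pi) \<le> ln t / (2 * pi)" by (intro divide_right_mono) auto
  also have "\<dots> \<le> ln t / 1" using p assms by (intro divide_left_mono) auto
  finally show ?thesis unfolding c(3) using assms by (intro mult_left_mono) auto
qed

text \<open>
  Radii that are ordinates are reached by monotonicity, from other radii at distance at most 1.
\<close>
lemma log_zero_sum_estimate: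
  assumes RH: "riemann_hypothesis"
  obtains K where "K \<ge> 0" "\<And>R. R \<ge> 17 \<Longrightarrow> \<bar>log_zero_sum R - zero_log_main R\<bar> \<le> K * R powr (3/5)"
proof -
  obtain K where K: "K \<ge> 0" "\<And>R. R \<ge> 16 \<Longrightarrow> R \<notin> ordinates \<Longrightarrow>
       \<bar>log_zero_sum R - zero_log_main R\<bar> \<le> K * (sqrt R * ln R)"
    using log_zero_sum_asymptotics[OF RH] unfolding log_zero_sum_def zero_log_main_def by metis
  have K': "\<bar>log_zero_sum R - zero_log_main R\<bar> \<le> 10 * K * R powr (3/5)" if "R \<ge> 16" "R \<notin> ordinates" for R
  proof -
    have "sqrt R * ln R \<le> R powr (1/2) * (10 * R powr (1/10))"
      using that ln_le_powr_tenth[of R] by (intro mult_mono) (auto simp: powr_half_sqrt)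
    also have "\<dots> = 10 * (R powr (1/2) * R powr (1/10))" by simp
    also have "R powr (1/2) * R powr (1/10) = R powr (3/5)" by (simp flip: powr_add)
    finally have "K * (sqrt R * ln R) \<le> K * (10 * R powr (3/5))" using K(1) by (intro mult_left_mono) auto
    thus ?thesis using K(2)[OF that] by simp
  qed
  have M: "zero_log_main t - zero_log_main s \<le> ln t" if "1 \<le> s" "s < t" "t \<le> s + 1" for s t
  proof -
    have "zero_log_main t - zero_log_main s \<le> (t - s) * zero_log_main' t" using that by (intro zero_log_main_mvt) auto
    also have "\<dots> \<le> (t - s) * ln t"
    proof (intro mult_left_mono)
      have p: "2 * pi \<ge> 1" using pi_gt3 by simp
      have "t / (2 * pi) \<le> t" using frac_le[of t t 1 "2 * pi"] that p by simp
      hence "ln (t / (2 * pi)) \<le> ln t" using that by (subst ln_le_cancel_iff) auto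
      hence "(ln (t / (2 * pi)) - 1) / (2 * pi) \<le> ln t / (2 * pi)" by (intro divide_right_mono) auto
      also have "\<dots> \<le> ln t / 1" using p that by (intro divide_left_mono) auto
      finally show "zero_log_main' t \<le> ln t" by (simp add: zero_log_main'_def)
    qed (use that in auto)
    also have "\<dots> \<le> 1 * ln t" using that by (intro mult_right_mono) auto
    finally show ?thesis by simp
  qed
  show ?thesis
  proof (rule that[of "20 * K + 20"])
    show "20 * K + 20 \<ge> 0" using K by simp
    fix R :: real assume R: "R \<ge> 17"
    obtain U where U: "R < U" "U < R + 1" "U \<notin> ordinates" using exists_non_ordinate[OF RH, of R "R + 1"] by auto
    obtain S where S: "R - 1 < S" "S < R" "S \<notin> ordinates" using exists_non_ordinate[OF RH, of "R - 1" R] by auto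
    have p2: "(2 * R) powr a \<le> 2 * R powr a" if "0 \<le> a" "a \<le> 1" for a
    proof -
      have "(2::real) powr a \<le> 2 powr 1" using that by (intro powr_mono) auto
      hence "2 powr a * R powr a \<le> 2 * R powr a" by (intro mult_right_mono) auto
      thus ?thesis using R by (simp add: powr_mult)
    qed
    have Up: "U powr (3/5) \<le> 2 * R powr (3/5)"
      using powr_mono2[of "3/5" U "2 * R"] U R p2[of "3/5"] by simp
    have lnU: "ln U \<le> 20 * R powr (3/5)"
    proof -
      have "ln U \<le> 10 * U powr (1/10)" using U R by (intro ln_le_powr_tenth) auto
      also have "U powr (1/10) \<le> U powr (3/5)" using U R by (intro powr_mono) auto
      finally show ?thesis using Up by simp
    qed
    have "log_zero_sum R \<le> log_zero_sum U" using U R by (intro log_zero_sum_mono RH) auto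
    also have "\<dots> \<le> zero_log_main U + 10 * K * U powr (3/5)" using K'[of U] U R by simp
    also have "zero_log_main U \<le> zero_log_main R + ln U" using M[of R U] U R by simp
    also have "10 * K * U powr (3/5) \<le> 10 * K * (2 * R powr (3/5))" using Up K by (intro mult_left_mono) auto
    finally have 1: "log_zero_sum R \<le> zero_log_main R + (20 * K + 20) * R powr (3/5)"
      using lnU by (simp add: distrib_right)
    have "zero_log_main R - ln U \<le> zero_log_main S"
    proof -
      have "ln R \<le> ln U" using U R by simp
      thus ?thesis using M[of S R] S R by linarith
    qed
    also have "zero_log_main S \<le> log_zero_sum S + 10 * K * S powr (3/5)" using K'[of S] S R by simp
    also have "10 * K * S powr (3/5) \<le> 10 * K * R powr (3/5)" using S R K by (intro mult_left_mono powr_mono2) auto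
    also have "log_zero_sum S \<le> log_zero_sum R" using S R by (intro log_zero_sum_mono RH) auto
    finally have "zero_log_main R \<le> log_zero_sum R + ln U + 10 * K * R powr (3/5)" by simp
    moreover have "10 * K * R powr (3/5) \<ge> 0" using K by simp
    ultimately have 2: "zero_log_main R \<le> log_zero_sum R + (20 * K + 20) * R powr (3/5)"
      using lnU by (simp add: distrib_right)
    show "\<bar>log_zero_sum R - zero_log_main R\<bar> \<le> (20 * K + 20) * R powr (3/5)"
      using 1 2 by (simp add: abs_le_iff)
  qed
qed

text \<open>
  Differencing over a step h = R^(4/5) divides the error R^(3/5) by h/R, which gives R^(4/5), and the
  variation of the smooth count over the step is O(h log R). The bound R^(1/10) for the logarithm
  leads to the exponent 9/10.
\<close>
lemma zero_count_estimate_large: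
  assumes RH: "riemann_hypothesis"
  obtains C where "C \<ge> 0" "\<And>R. R \<ge> 40 \<Longrightarrow> \<bar>zero_count R - smooth_count R\<bar> \<le> C * R powr (9/10)"
proof -
  obtain K where K: "K \<ge> 0" "\<And>R. R \<ge> 17 \<Longrightarrow> \<bar>log_zero_sum R - zero_log_main R\<bar> \<le> K * R powr (3/5)"
    using log_zero_sum_estimate[OF RH] by blast
  show ?thesis
  proof (rule that[of "8 * K + 21"])
    show "8 * K + 21 \<ge> 0" using K by simp
    fix R :: real assume R: "R \<ge> 40"
    define h where "h = R powr (4/5)"
    have h0: "h > 0" using R by (simp add: h_def)
    have hR: "h \<le> R / 2"
    proof -
      have "(2::real) = 32 powr (1/5)" using powr_powr[of 2 5 "1/5"] by (simp add: powr_numeral)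
      also have "\<dots> \<le> R powr (1/5)" using R by (intro powr_mono2) auto
      finally have "h * 2 \<le> h * R powr (1/5)" using h0 by (intro mult_left_mono) auto
      also have "\<dots> = R" using R by (simp add: h_def flip: powr_add)
      finally show ?thesis by simp
    qed
    have Rh: "R powr (3/5) * R = h * R powr (4/5)"
    proof -
      have "R powr (3/5) * R powr 1 = R powr (8/5)" unfolding powr_add[symmetric] by simp
      moreover have "h * R powr (4/5) = R powr (8/5)" unfolding h_def powr_add[symmetric] by simp
      ultimately show ?thesis using R by simp
    qed
    have p8: "R powr (4/5) \<le> R powr (9/10)" using R by (intro powr_mono) auto
    have p9: "h * (10 * R powr (1/10)) = 10 * R powr (9/10)"
      unfolding h_def by (simp flip: powr_add)
    have N0: "zero_count R \<ge> 0" by (rule zero_count_nonneg[OF RH])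
    have p1: "1 \<le> R powr (9/10)" using R by (intro ge_one_powr_ge_zero) auto
    have p2: "(2 * R) powr a \<le> 2 * R powr a" if "0 \<le> a" "a \<le> 1" for a
    proof -
      have "(2::real) powr a \<le> 2 powr 1" using that by (intro powr_mono) auto
      hence "2 powr a * R powr a \<le> 2 * R powr a" by (intro mult_right_mono) auto
      thus ?thesis using R by (simp add: powr_mult)
    qed
    \<comment> \<open>Upper bound, from the increment of the logarithmic sum over [R,R+h].\<close>
    have up: "zero_count R \<le> smooth_count R + (8 * K + 21) * R powr (9/10)"
    proof -
      define U where "U = R + h"
      have U: "R < U" "U \<le> 2 * R" "U > 0" using h0 hR R by (auto simp: U_def)
      have "zero_count R * (h / U) \<le> zero_count R * ln (U / R)"
      proof (intro mult_left_mono N0)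
        have "ln (R / U) \<le> R / U - 1" using U R by (intro ln_le_minus_one) auto
        thus "h / U \<le> ln (U / R)" using U R by (simp add: ln_div U_def field_simps)
      qed
      also have "\<dots> \<le> log_zero_sum U - log_zero_sum R" using U R by (intro log_zero_sum_diff RH) auto
      also have "\<dots> \<le> (zero_log_main U - zero_log_main R) + K * U powr (3/5) + K * R powr (3/5)"
        using K(2)[of U] K(2)[of R] U R by linarith
      also have "zero_log_main U - zero_log_main R \<le> h * zero_log_main' U"
        using zero_log_main_mvt(2)[of R U] U R by (simp add: U_def)
      also have "K * U powr (3/5) \<le> K * (2 * R powr (3/5))"
        using powr_mono2[of "3/5" U "2 * R"] U R p2[of "3/5"] K by (intro mult_left_mono) auto
      finally have "zero_count R * (h / U) \<le> h * zero_log_main' U + 3 * K * R powr (3/5)" by simp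
      hence "zero_count R * (h / U) * U \<le> (h * zero_log_main' U + 3 * K * R powr (3/5)) * U"
        using U by (intro mult_right_mono) auto
      hence "zero_count R * h \<le> h * (U * zero_log_main' U) + 3 * K * R powr (3/5) * U"
        using U by (simp add: algebra_simps)
      also have "3 * K * R powr (3/5) * U \<le> 3 * K * R powr (3/5) * (2 * R)" using U K by (intro mult_left_mono) auto
      also have "3 * K * R powr (3/5) * (2 * R) = 6 * K * (R powr (3/5) * R)" by simp
      also have "\<dots> = h * (6 * K * R powr (4/5))" unfolding Rh by simp
      finally have "h * zero_count R \<le> h * (U * zero_log_main' U + 6 * K * R powr (4/5))" by (simp add: algebra_simps)
      hence "zero_count R \<le> U * zero_log_main' U + 6 * K * R powr (4/5)" using h0 by simp
      also have "U * zero_log_main' U = smooth_count U - 7/8" using smooth_count_main[of U] by simp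
      also have "smooth_count U \<le> smooth_count R + h * ln U"
        using smooth_count_diff_le[of R U] U R by (simp add: U_def)
      also have "h * ln U \<le> h * (2 * (10 * R powr (1/10)))"
      proof (intro mult_left_mono)
        have "ln U \<le> 10 * U powr (1/10)" using U by (intro ln_le_powr_tenth) auto
        also have "U powr (1/10) \<le> 2 * R powr (1/10)" using powr_mono2[of "1/10" U "2 * R"] U R p2[of "1/10"] by simp
        finally show "ln U \<le> 2 * (10 * R powr (1/10))" by simp
      qed (use h0 in auto)
      also have "h * (2 * (10 * R powr (1/10))) = 20 * R powr (9/10)" using p9 by simp
      also have "6 * K * R powr (4/5) \<le> 6 * K * R powr (9/10)" using p8 K by (intro mult_left_mono) auto
      finally have "zero_count R \<le> smooth_count R + 20 * R powr (9/10) + 6 * K * R powr (9/10)" by simp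
      moreover have "K * R powr (9/10) \<ge> 0" using K by simp
      ultimately show ?thesis using p1 by (simp add: distrib_right)
    qed
    \<comment> \<open>Lower bound, from the increment over [R-h,R].\<close>
    have lo: "smooth_count R \<le> zero_count R + (8 * K + 21) * R powr (9/10)"
    proof -
      define S where "S = R - h"
      have S: "S < R" "S \<ge> 20" "S > 0" using h0 hR R by (auto simp: S_def)
      have "h * zero_log_main' S \<le> zero_log_main R - zero_log_main S"
        using zero_log_main_mvt(1)[of S R] S R by (simp add: S_def)
      also have "\<dots> \<le> (log_zero_sum R - log_zero_sum S) + K * R powr (3/5) + K * S powr (3/5)"
        using K(2)[of S] K(2)[of R] S R by linarith
      also have "K * S powr (3/5) \<le> K * R powr (3/5)" using S K by (intro mult_left_mono powr_mono2) auto
      also have "log_zero_sum R - log_zero_sum S \<le> zero_count R * ln (R / S)"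
        using S R by (intro log_zero_sum_diff RH) auto
      also have "zero_count R * ln (R / S) \<le> zero_count R * (h / S)"
      proof (intro mult_left_mono N0)
        have "ln (R / S) \<le> R / S - 1" using S R by (intro ln_le_minus_one) auto
        also have "R / S - 1 = h / S" using S by (simp add: S_def field_simps)
        finally show "ln (R / S) \<le> h / S" .
      qed
      finally have "h * zero_log_main' S \<le> zero_count R * (h / S) + 2 * K * R powr (3/5)" by simp
      hence "h * zero_log_main' S * S \<le> (zero_count R * (h / S) + 2 * K * R powr (3/5)) * S"
        using S by (intro mult_right_mono) auto
      hence "h * (S * zero_log_main' S) \<le> zero_count R * h + 2 * K * R powr (3/5) * S"
        using S by (simp add: algebra_simps)
      also have "2 * K * R powr (3/5) * S \<le> 2 * K * R powr (3/5) * R" using S K by (intro mult_left_mono) auto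
      also have "2 * K * R powr (3/5) * R = 2 * K * (R powr (3/5) * R)" by simp
      also have "\<dots> = h * (2 * K * R powr (4/5))" unfolding Rh by simp
      finally have "h * (S * zero_log_main' S) \<le> h * (zero_count R + 2 * K * R powr (4/5))" by (simp add: algebra_simps)
      hence "S * zero_log_main' S \<le> zero_count R + 2 * K * R powr (4/5)" using h0 by simp
      moreover have "S * zero_log_main' S = smooth_count S - 7/8" using smooth_count_main[of S] by simp
      moreover have "smooth_count R \<le> smooth_count S + h * ln R"
        using smooth_count_diff_le[of S R] S R by (simp add: S_def)
      moreover have "h * ln R \<le> h * (10 * R powr (1/10))" using h0 R by (intro mult_left_mono ln_le_powr_tenth) auto
      moreover have "2 * K * R powr (4/5) \<le> 2 * K * R powr (9/10)" using p8 K by (intro mult_left_mono) auto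
      moreover have "K * R powr (9/10) \<ge> 0" using K by simp
      ultimately show ?thesis using p1 p9 by (simp add: distrib_right)
    qed
    show "\<bar>zero_count R - smooth_count R\<bar> \<le> (8 * K + 21) * R powr (9/10)"
      using up lo by (simp add: abs_le_iff)
  qed
qed

lemma zero_count_estimate:
  assumes RH: "riemann_hypothesis"
  obtains C where "C \<ge> 0" "\<And>t. t \<ge> 1 \<Longrightarrow> \<bar>zero_count t - smooth_count t\<bar> \<le> C * t powr (9/10)"
proof -
  obtain C where C: "C \<ge> 0" "\<And>R. R \<ge> 40 \<Longrightarrow> \<bar>zero_count R - smooth_count R\<bar> \<le> C * R powr (9/10)"
    using zero_count_estimate_large[OF RH] by blast
  have "continuous_on {1..40} smooth_count"
    unfolding smooth_count_def by (intro continuous_intros) auto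
  hence "bounded (smooth_count ` {1..40})" by (intro compact_imp_bounded compact_continuous_image) auto
  then obtain B where "\<forall>x\<in>smooth_count ` {1..40}. norm x \<le> B" unfolding bounded_iff by blast
  hence B: "\<bar>smooth_count t\<bar> \<le> B" if "t \<in> {1..40}" for t using that by auto
  have B0: "B \<ge> 0" using B[of 1] by simp
  show ?thesis
  proof (rule that[of "C + B + zero_count 40"])
    show "C + B + zero_count 40 \<ge> 0" using C B0 zero_count_nonneg[OF RH, of 40] by simp
    fix t :: real assume t: "t \<ge> 1"
    have p: "t powr (9/10) \<ge> 1" using t by (intro ge_one_powr_ge_zero) auto
    have n: "(B + zero_count 40) * 1 \<le> (B + zero_count 40) * t powr (9/10)"
      using p B0 zero_count_nonneg[OF RH, of 40] by (intro mult_left_mono) auto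
    have c: "C * t powr (9/10) \<ge> 0" using C by simp
    show "\<bar>zero_count t - smooth_count t\<bar> \<le> (C + B + zero_count 40) * t powr (9/10)"
    proof (cases "t \<ge> 40")
      case True
      thus ?thesis using C(2)[OF True] n B0 zero_count_nonneg[OF RH, of 40] by (simp add: distrib_right)
    next
      case False
      have "zero_count t \<le> zero_count 40" using False by (intro zero_count_mono RH) auto
      thus ?thesis using B[of t] False t n c zero_count_nonneg[OF RH, of t] by (simp add: distrib_right abs_le_iff)
    qed
  qed
qed

section \<open>Integration by parts against the counting function\<close>

text \<open>
  The error term Q = N - L of the zero count.
\<close>
definition count_error :: "real \<Rightarrow> real" where
  "count_error t = zero_count t - smooth_count t"

text \<open>
  Sum over the ordinates below T with multiplicity, for functions with values in a vector space.
\<close>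
definition zero_vsum :: "(real \<Rightarrow> 'a::real_vector) \<Rightarrow> real \<Rightarrow> 'a" where
  "zero_vsum \<phi> T = (\<Sum>\<rho>\<in>{\<rho>\<in>nontrivial_zeros. 0 < Im \<rho> \<and> Im \<rho> < T}.
                      of_int (zorder riemann_zeta \<rho>) *\<^sub>R \<phi> (Im \<rho>))"

lemma zero_vsum_real: "zero_vsum \<phi> T = zero_sum \<phi> T"
  by (simp add: zero_vsum_def zero_sum_def)

text \<open>
  Integration from 1 instead of 0 replaces an ordinate below 1 by 1.
\<close>
lemma zero_vsum_max_stieltjes:
  fixes \<phi> :: "real \<Rightarrow> 'a :: euclidean_space"
  assumes RH: "riemann_hypothesis" and T: "T \<ge> 1"
    and d: "\<And>t. t \<ge> 1 \<Longrightarrow> (\<phi> has_vector_derivative \<phi>' t) (at t)"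
  shows "((\<lambda>t. zero_count t *\<^sub>R \<phi>' t) has_integral
           (zero_count T *\<^sub>R \<phi> T - zero_vsum (\<lambda>t. \<phi> (max 1 t)) T)) {1..T}"
proof -
  let ?A = "{\<rho>\<in>nontrivial_zeros. 0 < Im \<rho> \<and> Im \<rho> < T}"
  let ?m = "\<lambda>\<rho>. real_of_int (zorder riemann_zeta \<rho>)"
  have fin: "finite ?A" by (rule finite_zero_index_set[OF RH])
  have one: "((\<lambda>t. ?m \<rho> *\<^sub>R (if Im \<rho> < t then \<phi>' t else 0)) has_integral ?m \<rho> *\<^sub>R (\<phi> T - \<phi> (max 1 (Im \<rho>)))) {1..T}"
    if r: "\<rho> \<in> ?A" for \<rho>
  proof -
    define c where "c = max 1 (Im \<rho>)"
    have c: "1 \<le> c" "c \<le> T" using r T by (auto simp: c_def)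
    have "(\<phi>' has_integral (\<phi> T - \<phi> c)) {c..T}"
      by (rule fundamental_theorem_of_calculus) (use c d in \<open>auto intro: has_vector_derivative_at_within\<close>)
    hence "((\<lambda>t. if t \<in> {c..T} then \<phi>' t else 0) has_integral (\<phi> T - \<phi> c)) {1..T}"
      by (subst has_integral_restrict) (use c in auto)
    hence "((\<lambda>t. if Im \<rho> < t then \<phi>' t else 0) has_integral (\<phi> T - \<phi> c)) {1..T}"
      by (rule has_integral_spike[of "{Im \<rho>}", rotated 2]) (auto simp: c_def)
    thus ?thesis unfolding c_def by (rule has_integral_cmul)
  qed
  have "((\<lambda>t. \<Sum>\<rho>\<in>?A. ?m \<rho> *\<^sub>R (if Im \<rho> < t then \<phi>' t else 0)) has_integral
          (\<Sum>\<rho>\<in>?A. ?m \<rho> *\<^sub>R (\<phi> T - \<phi> (max 1 (Im \<rho>))))) {1..T}"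
    by (intro has_integral_sum fin one)
  also have "(\<Sum>\<rho>\<in>?A. ?m \<rho> *\<^sub>R (\<phi> T - \<phi> (max 1 (Im \<rho>)))) = zero_count T *\<^sub>R \<phi> T - zero_vsum (\<lambda>t. \<phi> (max 1 t)) T"
    by (simp add: zero_count_def zero_sum_def zero_vsum_def scaleR_right_diff_distrib sum_subtractf scaleR_sum_left)
  finally show ?thesis
  proof (rule has_integral_eq[rotated])
    fix t assume "t \<in> {1..T}"
    hence "zero_count t = (\<Sum>\<rho>\<in>?A. ?m \<rho> * (if Im \<rho> < t then 1 else 0))"
      unfolding zero_count_def by (subst zero_sum_eq_superset[OF RH, of t T]) auto
    thus "(\<Sum>\<rho>\<in>?A. ?m \<rho> *\<^sub>R (if Im \<rho> < t then \<phi>' t else 0)) = zero_count t *\<^sub>R \<phi>' t"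
      by (simp only: scaleR_sum_left) (intro sum.cong, auto)
  qed
qed

lemma zero_vsum_max_eq:
  assumes RH: "riemann_hypothesis" and T: "T \<ge> 1"
  shows "zero_vsum (\<lambda>t. \<phi> (max 1 t)) T = zero_vsum \<phi> T - zero_vsum (\<lambda>t. \<phi> t - \<phi> 1) 1"
proof -
  let ?A = "{\<rho>\<in>nontrivial_zeros. 0 < Im \<rho> \<and> Im \<rho> < T}"
  have "zero_vsum (\<lambda>t. \<phi> t - \<phi> 1) 1 = (\<Sum>\<rho>\<in>?A. of_int (zorder riemann_zeta \<rho>) *\<^sub>R (\<phi> (Im \<rho>) - \<phi> (max 1 (Im \<rho>))))"
    unfolding zero_vsum_def
  proof (rule sum.mono_neutral_cong_left[OF finite_zero_index_set[OF RH]])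
    show "\<forall>i\<in>?A - {\<rho> \<in> nontrivial_zeros. 0 < Im \<rho> \<and> Im \<rho> < 1}.
        of_int (zorder riemann_zeta i) *\<^sub>R (\<phi> (Im i) - \<phi> (max 1 (Im i))) = 0"
    proof
      fix i assume "i \<in> ?A - {\<rho> \<in> nontrivial_zeros. 0 < Im \<rho> \<and> Im \<rho> < 1}"
      hence "max 1 (Im i) = Im i" by auto
      thus "of_int (zorder riemann_zeta i) *\<^sub>R (\<phi> (Im i) - \<phi> (max 1 (Im i))) = 0" by simp
    qed
  qed (use T in auto)
  thus ?thesis by (simp add: zero_vsum_def scaleR_right_diff_distrib sum_subtractf)
qed

text \<open>
  The integration by parts for Q = N - L. The last summand corrects the contribution of
  ordinates below 1, without a proof that there are none.
\<close>
lemma zero_vsum_stieltjes: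
  fixes \<phi> :: "real \<Rightarrow> 'a :: euclidean_space"
  assumes RH: "riemann_hypothesis" and T: "T \<ge> 1"
    and d: "\<And>t. t \<ge> 1 \<Longrightarrow> (\<phi> has_vector_derivative \<phi>' t) (at t)"
    and J: "((\<lambda>t. (ln (t / (2 * pi)) / (2 * pi)) *\<^sub>R \<phi> t) has_integral J) {1..T}"
  shows "((\<lambda>t. count_error t *\<^sub>R \<phi>' t) has_integral
           (count_error T *\<^sub>R \<phi> T + smooth_count 1 *\<^sub>R \<phi> 1 + J - zero_vsum \<phi> T + zero_vsum (\<lambda>t. \<phi> t - \<phi> 1) 1)) {1..T}"
proof -
  have "((\<lambda>t. smooth_count t *\<^sub>R \<phi>' t + (ln (t / (2 * pi)) / (2 * pi)) *\<^sub>R \<phi> t) has_integral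
     (smooth_count T *\<^sub>R \<phi> T - smooth_count 1 *\<^sub>R \<phi> 1)) {1..T}"
  proof (rule fundamental_theorem_of_calculus)
    fix t assume t: "t \<in> {1..T}"
    have "((\<lambda>t. smooth_count t *\<^sub>R \<phi> t) has_vector_derivative
       (smooth_count t *\<^sub>R \<phi>' t + (ln (t / (2 * pi)) / (2 * pi)) *\<^sub>R \<phi> t)) (at t)"
      using t by (intro has_vector_derivative_scaleR smooth_count_deriv d) auto
    thus "((\<lambda>t. smooth_count t *\<^sub>R \<phi> t) has_vector_derivative
       (smooth_count t *\<^sub>R \<phi>' t + (ln (t / (2 * pi)) / (2 * pi)) *\<^sub>R \<phi> t)) (at t within {1..T})"
      by (rule has_vector_derivative_at_within)
  qed (use T in auto)
  from has_integral_diff[OF this J]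
  have "((\<lambda>t. smooth_count t *\<^sub>R \<phi>' t) has_integral
     (smooth_count T *\<^sub>R \<phi> T - smooth_count 1 *\<^sub>R \<phi> 1 - J)) {1..T}" by simp
  from has_integral_diff[OF zero_vsum_max_stieltjes[OF RH T d] this]
  show ?thesis unfolding zero_vsum_max_eq[OF RH T]
    by (simp add: count_error_def scaleR_left_diff_distrib algebra_simps)
qed

lemma count_error_measurable:
  assumes RH: "riemann_hypothesis" and S: "S \<in> sets lebesgue"
  shows "count_error \<in> borel_measurable (lebesgue_on S)"
proof -
  have "zero_count \<in> borel_measurable borel"
    by (intro borel_measurable_mono monoI zero_count_mono RH)
  moreover have "smooth_count \<in> borel_measurable borel" unfolding smooth_count_def by measurable
  ultimately have "count_error \<in> borel_measurable borel" unfolding count_error_def by measurable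
  thus ?thesis by (intro measurable_restrict_space1 measurable_completion) simp
qed

lemma count_error_integrable:
  assumes RH: "riemann_hypothesis" and g: "g \<in> borel_measurable (lebesgue_on {1..})"
    and e: "e < -19/10" and gb: "\<And>t. t \<ge> 1 \<Longrightarrow> norm (g t) \<le> B * t powr e"
  shows "(\<lambda>t. count_error t *\<^sub>R (g t :: 'a :: euclidean_space)) absolutely_integrable_on {1..}"
proof -
  obtain C where C: "C \<ge> 0" "\<And>t. t \<ge> 1 \<Longrightarrow> \<bar>count_error t\<bar> \<le> C * t powr (9/10)"
    using zero_count_estimate[OF RH] unfolding count_error_def by metis
  show ?thesis
  proof (rule measurable_bounded_by_integrable_imp_absolutely_integrable)
    show "(\<lambda>t. count_error t *\<^sub>R g t) \<in> borel_measurable (lebesgue_on {1..})"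
      using count_error_measurable[OF RH, of "{1..}"] g by (intro borel_measurable_scaleR) auto
    show "(\<lambda>t. (C * B) * t powr (9/10 + e)) integrable_on {1..}"
      using has_integral_powr_to_inf[of "9/10 + e" 1] e
      by (intro integrable_on_mult_right has_integral_integrable) auto
    fix t :: real assume t: "t \<in> {1..}"
    have "norm (count_error t *\<^sub>R g t) \<le> (C * t powr (9/10)) * (B * t powr e)"
      unfolding norm_scaleR using C t gb by (intro mult_mono) auto
    also have "\<dots> = C * B * t powr (9/10 + e)" by (simp add: powr_add)
    finally show "norm (count_error t *\<^sub>R g t) \<le> C * B * t powr (9/10 + e)" .
  qed auto
qed

lemma integral_tail_tendsto:
  fixes f :: "real \<Rightarrow> 'a :: euclidean_space"
  assumes "f absolutely_integrable_on {1..}"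
  shows "((\<lambda>T. integral {1..T} f) \<longlongrightarrow> integral {1..} f) at_top"
proof -
  have "((\<lambda>T. set_lebesgue_integral lebesgue {1..T} f) \<longlongrightarrow> set_lebesgue_integral lebesgue {1..} f) at_top"
    by (rule tendsto_set_lebesgue_integral_at_top) (use assms in auto)
  moreover have "set_lebesgue_integral lebesgue {1..T} f = integral {1..T} f" for T
    by (rule set_lebesgue_integral_eq_integral(2)[OF set_integrable_subset[OF assms]]) auto
  moreover have "set_lebesgue_integral lebesgue {1..} f = integral {1..} f"
    by (rule set_lebesgue_integral_eq_integral(2)[OF assms])
  ultimately show ?thesis by simp
qed

section \<open>The bracket is constant\<close>

text \<open>
  The integral of L'(t) log^n(t) / t over [1,T].
\<close>
definition log_pow_main :: "nat \<Rightarrow> real \<Rightarrow> real" where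
  "log_pow_main n T = (ln T ^ (n + 2) / (real n + 2) - ln (2 * pi) * (ln T ^ (n + 1) / (real n + 1))) / (2 * pi)"

lemma log_pow_main_eq:
  assumes T: "T > 0"
  shows "1 / (2 * pi * (real n + 1) * (real n + 2)) * ln T ^ (n + 1) * ln (T ^ (n + 1) / (2 * pi) ^ (n + 2)) = log_pow_main n T"
proof -
  define a b L c where "a = real n + 1" and "b = real n + 2" and "L = ln T" and "c = ln (2 * pi)"
  have ab: "a > 0" "b > 0" by (simp_all add: a_def b_def)
  have "ln (T ^ (n + 1) / (2 * pi) ^ (n + 2)) = ln (T ^ (n + 1)) - ln ((2 * pi) ^ (n + 2))"
    using T by (intro ln_divide_pos) auto
  also have "ln (T ^ (n + 1)) = a * L" using T by (simp only: ln_realpow a_def L_def) simp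
  also have "ln ((2 * pi) ^ (n + 2)) = b * c" by (subst ln_realpow) (auto simp: b_def c_def)
  finally have l: "ln (T ^ (n + 1) / (2 * pi) ^ (n + 2)) = a * L - b * c" .
  have "1 / (P * a * b) * X * (a * L - b * c) = (L * X / b - c * (X / a)) / P" if "P > 0" for P X
    using ab that by (simp add: divide_simps) (simp add: algebra_simps)
  from this[of "2 * pi" "L ^ (n + 1)"] show ?thesis
    unfolding l log_pow_main_def a_def[symmetric] b_def[symmetric] L_def[symmetric] c_def[symmetric] by simp
qed

lemma log_pow_main_integral:
  assumes T: "T \<ge> 1"
  shows "((\<lambda>t. (ln (t / (2 * pi)) / (2 * pi)) *\<^sub>R (ln t ^ n / t)) has_integral log_pow_main n T) {1..T}"
proof -
  have "((\<lambda>t. (ln (t / (2 * pi)) / (2 * pi)) *\<^sub>R (ln t ^ n / t)) has_integral (log_pow_main n T - log_pow_main n 1)) {1..T}"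
  proof (rule fundamental_theorem_of_calculus)
    fix t assume t: "t \<in> {1..T}"
    have p: "((\<lambda>t. ln t ^ m / a) has_real_derivative (ln t ^ k / t)) (at t)" if "m = Suc k" "a = 1 + real k" for m k a
    proof (rule DERIV_cong)
      show "((\<lambda>t. ln t ^ m / a) has_real_derivative (a * (1 / t * ln t ^ k)) / a) (at t)"
        unfolding that using t by (intro DERIV_cdivide DERIV_power_Suc DERIV_ln_divide) auto
      have "a \<noteq> 0" using that by simp
      thus "(a * (1 / t * ln t ^ k)) / a = ln t ^ k / t" by simp
    qed
    have p1: "((\<lambda>t. ln t ^ (n + 2) / (real n + 2)) has_real_derivative (ln t ^ (n + 1) / t)) (at t)"
      by (rule p) auto
    have p2: "((\<lambda>t. ln t ^ (n + 1) / (real n + 1)) has_real_derivative (ln t ^ n / t)) (at t)"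
      by (rule p) auto
    have "((\<lambda>t. (ln t ^ (n + 2) / (real n + 2) - ln (2 * pi) * (ln t ^ (n + 1) / (real n + 1))) / (2 * pi))
       has_real_derivative ((ln t ^ (n + 1) / t - ln (2 * pi) * (ln t ^ n / t)) / (2 * pi))) (at t)"
      by (rule DERIV_cdivide[OF DERIV_diff[OF p1 DERIV_cmult[OF p2]]])
    hence "(log_pow_main n has_real_derivative ((ln t ^ (n + 1) / t - ln (2 * pi) * (ln t ^ n / t)) / (2 * pi))) (at t)"
      unfolding log_pow_main_def[abs_def] .
    also have "(ln t ^ (n + 1) / t - ln (2 * pi) * (ln t ^ n / t)) / (2 * pi) = (ln (t / (2 * pi)) / (2 * pi)) *\<^sub>R (ln t ^ n / t)"
    proof -
      have e: "ln (t / (2 * pi)) = ln t - ln (2 * pi)" using t by (intro ln_divide_pos) auto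
      have z: "ln t ^ (n + 1) = ln t * ln t ^ n" by simp
      have "(L * Z / t - c * (Z / t)) / P = ((L - c) / P) *\<^sub>R (Z / t)" for L Z c P
      proof -
        have "L * Z / t - c * (Z / t) = (L - c) * (Z / t)" by (simp only: left_diff_distrib times_divide_eq_right diff_divide_distrib)
        thus ?thesis by (simp only: real_scaleR_def times_divide_eq_left)
      qed
      thus ?thesis unfolding e z .
    qed
    finally show "(log_pow_main n has_vector_derivative (ln (t / (2 * pi)) / (2 * pi)) *\<^sub>R (ln t ^ n / t)) (at t within {1..T})"
      unfolding has_real_derivative_iff_has_vector_derivative by (rule has_vector_derivative_at_within)
  qed (use T in auto)
  moreover have "log_pow_main n 1 = 0" by (simp add: log_pow_main_def)
  ultimately show ?thesis by simp
qed

text \<open>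
  The derivative of log^n(t) / t for t > 0.
\<close>
definition log_pow_deriv :: "nat \<Rightarrow> real \<Rightarrow> real" where
  "log_pow_deriv n t = (real n * ln t ^ (n - 1) - ln t ^ n) * t powr (- 2)"

lemma log_pow_has_deriv:
  assumes t: "t > 0"
  shows "((\<lambda>t. ln t ^ n / t) has_real_derivative log_pow_deriv n t) (at t)"
proof (rule DERIV_cong)
  show "((\<lambda>t. ln t ^ n / t) has_real_derivative
     ((real n * ln t ^ (n - 1) * (1 / t)) * t - ln t ^ n * 1) / (t * t)) (at t)"
    using t by (intro DERIV_divide DERIV_ident) (auto intro!: derivative_eq_intros)
  have "t powr (- 2) = 1 / (t * t)" using t by (simp add: powr_minus powr_numeral power2_eq_square divide_inverse)
  thus "((real n * ln t ^ (n - 1) * (1 / t)) * t - ln t ^ n * 1) / (t * t) = log_pow_deriv n t"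
    using t by (simp add: log_pow_deriv_def)
qed

text \<open>
  The exponent 1/20 is such that t^(-2) log^k(t) stays below the threshold t^(-19/10) at which
  integrability against Q begins.
\<close>
lemma ln_pow_bound:
  fixes t :: real
  assumes "t \<ge> 1"
  shows "ln t ^ k \<le> fact k * 20 ^ k * t powr (1/20)"
proof -
  have l: "ln t \<ge> 0" using assms by simp
  have "(ln t / 20) ^ k / fact k \<le> (\<Sum>j<Suc k. (ln t / 20) ^ j / fact j)"
    using l by (simp add: sum_nonneg)
  also have "\<dots> \<le> exp (ln t / 20)" using l by (intro sum_exp_le) auto
  also have "\<dots> = t powr (1/20)" using assms by (simp add: powr_def)
  finally show ?thesis by (simp add: power_divide field_simps)
qed

text \<open>
  The logarithmic moments of Q(t) / t^2 over [1,\<infinity>).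
\<close>
definition error_moment :: "nat \<Rightarrow> real" where
  "error_moment k = integral {1..} (\<lambda>t. count_error t *\<^sub>R (t powr (- 2) * ln t ^ k))"

lemma error_moment_integrable:
  assumes RH: "riemann_hypothesis"
  shows "(\<lambda>t. count_error t *\<^sub>R (t powr (- 2) * ln t ^ k)) absolutely_integrable_on {1..}"
proof (rule count_error_integrable[OF RH])
  show "(\<lambda>t::real. t powr (- 2) * ln t ^ k) \<in> borel_measurable (lebesgue_on {1..})"
    by (rule continuous_imp_measurable_on_sets_lebesgue) (auto intro!: continuous_intros)
  fix t :: real assume t: "t \<ge> 1"
  have "norm (t powr (- 2) * ln t ^ k) = t powr (- 2) * ln t ^ k" using t by simp
  also have "\<dots> \<le> t powr (- 2) * (fact k * 20 ^ k * t powr (1/20))"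
    using t by (intro mult_left_mono ln_pow_bound) auto
  also have "\<dots> = fact k * 20 ^ k * (t powr (- 2) * t powr (1/20))" by simp
  also have "t powr (- 2) * t powr (1/20) = t powr (- 39/20)" by (simp flip: powr_add)
  finally show "norm (t powr (- 2) * ln t ^ k) \<le> fact k * 20 ^ k * t powr (- 39/20)" .
qed auto

lemma error_log_pow_deriv_integral:
  assumes RH: "riemann_hypothesis"
  shows "(\<lambda>t. count_error t *\<^sub>R log_pow_deriv n t) absolutely_integrable_on {1..}"
    and "integral {1..} (\<lambda>t. count_error t *\<^sub>R log_pow_deriv n t) = real n * error_moment (n - 1) - error_moment n"
proof -
  have eq: "(\<lambda>t. count_error t *\<^sub>R log_pow_deriv n t) =
     (\<lambda>t. real n *\<^sub>R (count_error t *\<^sub>R (t powr (- 2) * ln t ^ (n - 1))) - count_error t *\<^sub>R (t powr (- 2) * ln t ^ n))"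
    by (simp add: log_pow_deriv_def algebra_simps)
  note i = error_moment_integrable[OF RH]
  show "(\<lambda>t. count_error t *\<^sub>R log_pow_deriv n t) absolutely_integrable_on {1..}"
    unfolding eq by (intro set_integral_diff(1) absolutely_integrable_scaleR_left i)
  have h: "((\<lambda>t. count_error t *\<^sub>R (t powr (- 2) * ln t ^ k)) has_integral error_moment k) {1..}" for k
    using i[of k] unfolding error_moment_def by (auto simp: absolutely_integrable_on_def)
  show "integral {1..} (\<lambda>t. count_error t *\<^sub>R log_pow_deriv n t) = real n * error_moment (n - 1) - error_moment n"
    unfolding eq using has_integral_diff[OF has_integral_cmul[OF h[of "n - 1"], of "real n"] h[of n]]
    by (intro integral_unique) simp
qed

text \<open>
  The constant value of the bracket: the terms at 1 minus the integral of \<phi>' Q over [1,\<infinity>), for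
  \<phi>(t) = log^n(t) / t. The unsimplified values at 1 cover the case n = 0, where ln 1 ^ n is 1.
\<close>
definition stieltjes_const :: "nat \<Rightarrow> real" where
  "stieltjes_const n = zero_sum (\<lambda>t. ln t ^ n / t - ln 1 ^ n / 1) 1 + smooth_count 1 * (ln 1 ^ n / 1)
       - (real n * error_moment (n - 1) - error_moment n)"

lemma bracket_constant:
  assumes RH: "riemann_hypothesis" and T: "T \<ge> 1"
  shows "zero_sum (\<lambda>t. ln t ^ n / t) T
               - 1 / (2 * pi * (real n + 1) * (real n + 2)) * ln T ^ (n + 1)
                   * ln (T ^ (n + 1) / (2 * pi) ^ (n + 2))
               - ln T ^ n / T
                   * (zero_count T - 7 / 8 - T / (2 * pi) * ln (T / (2 * pi)) + T / (2 * pi))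
               + bpt_remainder (\<lambda>t. ln t ^ n / t) T = stieltjes_const n"
proof -
  let ?\<phi> = "\<lambda>t::real. ln t ^ n / t"
  let ?f = "\<lambda>t. count_error t *\<^sub>R log_pow_deriv n t"
  have d: "(?\<phi> has_vector_derivative log_pow_deriv n t) (at t)" if "t \<ge> 1" for t
    using log_pow_has_deriv[of t n] that by (simp add: has_real_derivative_iff_has_vector_derivative)
  note S = zero_vsum_stieltjes[OF RH T d log_pow_main_integral[OF T]]
  have I: "?f absolutely_integrable_on {1..}" by (rule error_log_pow_deriv_integral(1)[OF RH])
  hence IT: "(?f has_integral integral {T..} ?f) {T..}"
    using set_integrable_subset[OF I, of "{T..}"] T by (auto simp: absolutely_integrable_on_def)
  have "negligible ({1..T} \<inter> {T..})" by (rule negligible_subset[of "{T}"]) auto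
  note U = has_integral_Un[OF S IT this]
  have "{1..T} \<union> {T..} = {1..}" using T by auto
  hence "(?f has_integral (count_error T *\<^sub>R ?\<phi> T + smooth_count 1 *\<^sub>R ?\<phi> 1 + log_pow_main n T - zero_vsum ?\<phi> T + zero_vsum (\<lambda>t. ?\<phi> t - ?\<phi> 1) 1
           + integral {T..} ?f)) {1..}"
    using U by (simp only:)
  from integral_unique[OF this]
  have eq: "real n * error_moment (n - 1) - error_moment n =
     count_error T * ?\<phi> T + smooth_count 1 * ?\<phi> 1 + log_pow_main n T - zero_sum ?\<phi> T + zero_sum (\<lambda>t. ?\<phi> t - ?\<phi> 1) 1
           + integral {T..} ?f"
    unfolding error_log_pow_deriv_integral(2)[OF RH] zero_vsum_real by simp
  have b: "bpt_remainder ?\<phi> T = - integral {T..} ?f"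
    unfolding bpt_remainder_def
  proof (intro arg_cong[of _ _ uminus] integral_cong)
    fix t assume "t \<in> {T..}"
    hence "deriv ?\<phi> t = log_pow_deriv n t" using T by (intro DERIV_imp_deriv log_pow_has_deriv) auto
    thus "deriv ?\<phi> t * (zero_count t - smooth_count t) = ?f t" by (simp add: count_error_def)
  qed
  have q: "zero_count T - 7 / 8 - T / (2 * pi) * ln (T / (2 * pi)) + T / (2 * pi) = count_error T"
    by (simp add: count_error_def smooth_count_def)
  have T0: "T > 0" using T by simp
  show ?thesis
    unfolding log_pow_main_eq[OF T0] q b stieltjes_const_def mult.commute[of "ln T ^ n / T" "count_error T"]
    using eq by linarith
qed

section \<open>Continuation of the secondary zeta function\<close>

lemma of_real_powr_has_vector_derivative:
  assumes t: "t > 0"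
  shows "((\<lambda>t. complex_of_real t powr z) has_vector_derivative (z * of_real t powr (z - 1))) (at t)"
proof -
  have "((\<lambda>x. x powr z) has_field_derivative (z * of_real t powr (z - 1))) (at (complex_of_real t))"
    using t by (intro has_field_derivative_powr) (auto simp: complex_nonpos_Reals_iff)
  moreover have "(complex_of_real has_vector_derivative 1) (at t)"
    by (auto intro!: derivative_eq_intros)
  ultimately have "((\<lambda>x. x powr z) \<circ> of_real has_vector_derivative 1 * (z * complex_of_real t powr (z - 1))) (at t)"
    by (intro field_vector_diff_chain_at)
  thus ?thesis by (simp add: o_def)
qed

text \<open>
  The part of the Laurent expansion at s = 1 with negative exponents, in the variable w = s - 1.
\<close>
definition polar_part :: "complex \<Rightarrow> complex" where
  "polar_part w = (1 / w\<^sup>2 - of_real (ln (2 * pi)) / w) / of_real (2 * pi)"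

lemma polar_part_integral:
  assumes T: "T \<ge> 1" and w: "w \<noteq> 0"
  shows "((\<lambda>t. (ln (t / (2 * pi)) / (2 * pi)) *\<^sub>R complex_of_real t powr (- (1 + w))) has_integral
     (polar_part w - of_real T powr (- w) * ((of_real (ln T) - of_real (ln (2 * pi))) / w + 1 / w\<^sup>2) / of_real (2 * pi))) {1..T}"
proof -
  define c where "c = complex_of_real (ln (2 * pi))"
  define P where "P = complex_of_real (2 * pi)"
  have P: "P \<noteq> 0" by (simp add: P_def)
  define G where "G = (\<lambda>t. - (complex_of_real t powr (- w) * ((of_real (ln t) - c) / w + 1 / w\<^sup>2)) / P)"
  have "((\<lambda>t. (ln (t / (2 * pi)) / (2 * pi)) *\<^sub>R complex_of_real t powr (- (1 + w))) has_integral (G T - G 1)) {1..T}"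
  proof (rule fundamental_theorem_of_calculus)
    fix t assume t: "t \<in> {1..T}"
    have t0: "t > 0" using t by simp
    define u where "u = complex_of_real t powr (- w - 1)"
    have tu: "complex_of_real t powr (- w) = of_real t * u"
      using t0 powr_add[of "complex_of_real t" "- w - 1" 1] by (simp add: u_def mult.commute)
    have d1: "((\<lambda>t. complex_of_real t powr (- w)) has_vector_derivative (- w * u)) (at t)"
      unfolding u_def by (rule of_real_powr_has_vector_derivative[OF t0])
    have "((\<lambda>t. of_real (ln t)) has_vector_derivative complex_of_real (1 / t)) (at t)"
      using t0 by (intro has_vector_derivative_of_real) (auto intro!: derivative_eq_intros)
    hence d2: "((\<lambda>t. (of_real (ln t) - c) * (1 / w) + 1 / w\<^sup>2) has_vector_derivative (complex_of_real (1 / t) - 0) * (1 / w) + 0) (at t)"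
      by (intro has_vector_derivative_add has_vector_derivative_mult_left has_vector_derivative_diff has_vector_derivative_const)
    have d: "((\<lambda>t. complex_of_real t powr (- w) * ((of_real (ln t) - c) * (1 / w) + 1 / w\<^sup>2)) has_vector_derivative
       (complex_of_real t powr (- w) * ((complex_of_real (1 / t) - 0) * (1 / w) + 0) + (- w * u) * ((of_real (ln t) - c) * (1 / w) + 1 / w\<^sup>2))) (at t)"
      by (rule has_vector_derivative_mult[OF d1 d2])
    have "complex_of_real t powr (- w) * ((complex_of_real (1 / t) - 0) * (1 / w) + 0) + (- w * u) * ((of_real (ln t) - c) * (1 / w) + 1 / w\<^sup>2)
        = - ((of_real (ln t) - c) * u)"
    proof -
      have "x * u * ((1 / x - 0) * (1 / w) + 0) + (- w * u) * (l * (1 / w) + 1 / w\<^sup>2) = - (l * u)" if "x \<noteq> 0" for x l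
        using that w by (simp add: field_simps power2_eq_square)
      from this[of "of_real t"] show ?thesis unfolding tu using t0 by simp
    qed
    from has_vector_derivative_mult_left[OF d[unfolded this], of "- (1 / P)"]
    have "(G has_vector_derivative (- ((of_real (ln t) - c) * u) * - (1 / P))) (at t)"
      by (simp add: G_def)
    also have "- ((of_real (ln t) - c) * u) * - (1 / P) = (ln (t / (2 * pi)) / (2 * pi)) *\<^sub>R complex_of_real t powr (- (1 + w))"
    proof -
      have e: "ln (t / (2 * pi)) = ln t - ln (2 * pi)" using t0 by (intro ln_divide_pos) auto
      have "- (1 + w) = - w - 1" by simp
      thus ?thesis unfolding e scaleR_conv_of_real by (simp only: u_def[symmetric]) (simp add: c_def P_def)
    qed
    finally show "(G has_vector_derivative (ln (t / (2 * pi)) / (2 * pi)) *\<^sub>R complex_of_real t powr (- (1 + w))) (at t within {1..T})"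
      by (rule has_vector_derivative_at_within)
  qed (use T in auto)
  moreover have "G T - G 1 = polar_part w - of_real T powr (- w) * ((of_real (ln T) - of_real (ln (2 * pi))) / w + 1 / w\<^sup>2) / of_real (2 * pi)"
  proof -
    have "G 1 = - polar_part w" by (simp add: G_def polar_part_def c_def P_def)
    thus ?thesis by (simp add: G_def c_def P_def)
  qed
  ultimately show ?thesis by simp
qed

lemma of_real_powr_tendsto_0:
  assumes "Re w > 0"
  shows "((\<lambda>T. complex_of_real T powr (- w) * ((of_real (ln T) - a) / w + b) / c) \<longlongrightarrow> 0) at_top"
proof -
  have 1: "((\<lambda>T. complex_of_real T powr (- w)) \<longlongrightarrow> 0) at_top"
  proof (rule Lim_null_comparison)
    show "\<forall>\<^sub>F T in at_top. norm (complex_of_real T powr (- w)) \<le> T powr (- Re w)"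
      using eventually_gt_at_top[of 0] by eventually_elim (simp add: norm_powr_real_powr)
    show "((\<lambda>T. T powr (- Re w)) \<longlongrightarrow> 0) at_top"
      using assms by (intro tendsto_neg_powr filterlim_ident) auto
  qed
  define r where "r = Re w / 2"
  have r: "r > 0" using assms by (simp add: r_def)
  have 2: "((\<lambda>T. complex_of_real T powr (- w) * of_real (ln T)) \<longlongrightarrow> 0) at_top"
  proof (rule Lim_null_comparison)
    show "\<forall>\<^sub>F T in at_top. norm (complex_of_real T powr (- w) * of_real (ln T)) \<le> 1 / r * T powr (- r)"
      using eventually_ge_at_top[of 1]
    proof eventually_elim
      case (elim T)
      have "r * ln T = ln (T powr r)" using elim by (simp add: ln_powr)
      also have "\<dots> \<le> T powr r - 1" using elim by (intro ln_le_minus_one) auto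
      finally have "ln T \<le> T powr r / r" using r by (simp add: field_simps)
      hence "T powr (- Re w) * ln T \<le> T powr (- Re w) * (T powr r / r)" by (intro mult_left_mono) auto
      also have "\<dots> = 1 / r * (T powr (- Re w) * T powr r)" by simp
      also have "T powr (- Re w) * T powr r = T powr (- r)" by (simp add: r_def flip: powr_add)
      finally show ?case using elim by (simp add: norm_mult norm_powr_real_powr)
    qed
    show "((\<lambda>T. 1 / r * T powr (- r)) \<longlongrightarrow> 0) at_top"
      using r by (intro tendsto_mult_right_zero tendsto_neg_powr filterlim_ident) auto
  qed
  have "((\<lambda>T. (complex_of_real T powr (- w) * of_real (ln T)) / w / c + complex_of_real T powr (- w) * ((b - a / w) / c)) \<longlongrightarrow> 0 / w / c + 0 * ((b - a / w) / c)) at_top"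
    by (intro tendsto_add tendsto_mult 1 tendsto_const) (intro tendsto_divide_zero 2 | simp only: div_0)+
  also have "(\<lambda>T. (complex_of_real T powr (- w) * of_real (ln T)) / w / c + complex_of_real T powr (- w) * ((b - a / w) / c)) =
     (\<lambda>T. complex_of_real T powr (- w) * ((of_real (ln T) - a) / w + b) / c)"
    by (simp add: diff_divide_distrib add_divide_distrib algebra_simps)
  finally show ?thesis by simp
qed

text \<open>
  The Mellin transform of Q over [1,\<infinity>).
\<close>
definition error_mellin :: "complex \<Rightarrow> complex" where
  "error_mellin z = integral {1..} (\<lambda>t. of_real (count_error t) * of_real t powr z)"

lemma count_error_powr_integrable:
  assumes RH: "riemann_hypothesis" and "\<sigma> < - 19/10"
  shows "(\<lambda>t. count_error t * t powr \<sigma>) absolutely_integrable_on {1..}"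
proof -
  have "(\<lambda>t. count_error t *\<^sub>R t powr \<sigma>) absolutely_integrable_on {1..}"
  proof (rule count_error_integrable[OF RH _ assms(2)])
    show "(\<lambda>t::real. t powr \<sigma>) \<in> borel_measurable (lebesgue_on {1..})"
      by (rule continuous_imp_measurable_on_sets_lebesgue) (auto intro!: continuous_intros)
    show "norm (t powr \<sigma>) \<le> 1 * t powr \<sigma>" if "t \<ge> 1" for t using that by simp
  qed
  thus ?thesis by simp
qed

lemma error_mellin_integrable:
  assumes RH: "riemann_hypothesis" and "Re z < - 19/10"
  shows "(\<lambda>t. of_real (count_error t) * complex_of_real t powr z) absolutely_integrable_on {1..}"
proof -
  have "{1..} \<subseteq> {0::real<..}" by auto
  from mellin_expansion(1)[OF _ this, of count_error z 0 0] count_error_powr_integrable[OF assms]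
  show ?thesis by auto
qed

lemma error_mellin_holomorphic:
  assumes RH: "riemann_hypothesis"
  shows "error_mellin holomorphic_on {z. Re z < - 19/10}"
proof -
  have "(\<lambda>z. integral {1..} (\<lambda>t. of_real (count_error t) * complex_of_real t powr z)) holomorphic_on {z. Re z \<in> {..<- 19/10}}"
    by (rule mellin_holomorphic; (rule count_error_powr_integrable[OF RH])?) auto
  thus ?thesis by (simp add: error_mellin_def[abs_def])
qed

text \<open>
  The correction for ordinates below 1.
\<close>
definition low_sum :: "complex \<Rightarrow> complex" where
  "low_sum s = zero_vsum (\<lambda>t. of_real t powr (- s) - of_real 1 powr (- s)) 1"

text \<open>
  The holomorphic part of the secondary zeta function on Re s > 9/10.
\<close>
definition regular_part :: "complex \<Rightarrow> complex" where
  "regular_part s = low_sum s + of_real (smooth_count 1) + s * error_mellin (- s - 1)"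

text \<open>
  Convergence of the ordered partial sums. Unconditional summability is a consequence: for real s the terms
  are nonnegative.
\<close>
lemma zero_vsum_powr_tendsto:
  assumes RH: "riemann_hypothesis" and s: "Re s > 1"
  shows "((\<lambda>T. zero_vsum (\<lambda>t. complex_of_real t powr (- s)) T) \<longlongrightarrow> polar_part (s - 1) + regular_part s) at_top"
proof -
  define w where "w = s - 1"
  have w: "w \<noteq> 0" "Re w > 0" "s = 1 + w" using s by (auto simp: w_def)
  let ?\<phi> = "\<lambda>t. complex_of_real t powr (- s)"
  let ?\<phi>' = "\<lambda>t. (- s) * complex_of_real t powr (- s - 1)"
  let ?r = "\<lambda>T. of_real T powr (- w) * ((of_real (ln T) - of_real (ln (2 * pi))) / w + 1 / w\<^sup>2) / complex_of_real (2 * pi)"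
  have d: "(?\<phi> has_vector_derivative ?\<phi>' t) (at t)" if "t \<ge> 1" for t
    using that by (intro of_real_powr_has_vector_derivative) auto
  have I: "(\<lambda>t. of_real (count_error t) * complex_of_real t powr (- s - 1)) absolutely_integrable_on {1..}"
    using s by (intro error_mellin_integrable RH) auto
  have eq: "zero_vsum ?\<phi> T = count_error T *\<^sub>R ?\<phi> T + of_real (smooth_count 1) + (polar_part w - ?r T) + low_sum s
      + s * integral {1..T} (\<lambda>t. of_real (count_error t) * complex_of_real t powr (- s - 1))" if T: "T \<ge> 1" for T
  proof -
    have "((\<lambda>t. (ln (t / (2 * pi)) / (2 * pi)) *\<^sub>R ?\<phi> t) has_integral (polar_part w - ?r T)) {1..T}"
      unfolding w(3) by (rule polar_part_integral[OF T w(1)])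
    from zero_vsum_stieltjes[OF RH T d this]
    have "integral {1..T} (\<lambda>t. count_error t *\<^sub>R ?\<phi>' t) =
       count_error T *\<^sub>R ?\<phi> T + smooth_count 1 *\<^sub>R ?\<phi> 1 + (polar_part w - ?r T) - zero_vsum ?\<phi> T + low_sum s"
      unfolding low_sum_def by (intro integral_unique) simp
    moreover have "integral {1..T} (\<lambda>t. count_error t *\<^sub>R ?\<phi>' t) = - s * integral {1..T} (\<lambda>t. of_real (count_error t) * complex_of_real t powr (- s - 1))"
      unfolding integral_mult_right[symmetric] by (simp add: scaleR_conv_of_real mult_ac)
    moreover have "smooth_count 1 *\<^sub>R ?\<phi> 1 = of_real (smooth_count 1)" by (simp add: scaleR_conv_of_real)
    moreover have "z = a + e + b + l + s * y" if "x = a + e + b - z + l" "x = - s * y" for x a e b l y z :: complex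
    proof -
      have "z = a + e + b + l - x" using that(1) by (simp only: add_diff_eq diff_add_eq diff_diff_eq2 add_diff_cancel_left' add_diff_cancel_right')
      thus ?thesis using that(2) by simp
    qed
    ultimately show ?thesis by (simp only:)
  qed
  obtain C where C: "C \<ge> 0" "\<And>t. t \<ge> 1 \<Longrightarrow> \<bar>count_error t\<bar> \<le> C * t powr (9/10)"
    using zero_count_estimate[OF RH] unfolding count_error_def by metis
  have "((\<lambda>T. count_error T *\<^sub>R ?\<phi> T) \<longlongrightarrow> 0) at_top"
  proof (rule Lim_null_comparison)
    show "\<forall>\<^sub>F T in at_top. norm (count_error T *\<^sub>R ?\<phi> T) \<le> C * T powr (9/10 - Re s)"
      using eventually_ge_at_top[of 1]
    proof eventually_elim
      case (elim T)
      have "norm (count_error T *\<^sub>R ?\<phi> T) \<le> (C * T powr (9/10)) * T powr (- Re s)"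
      proof -
        have "norm (?\<phi> T) = T powr Re (- s)" using elim by (subst norm_powr_real_powr) (simp_all only: Reals_of_real Re_complex_of_real)
        hence "norm (count_error T *\<^sub>R ?\<phi> T) = \<bar>count_error T\<bar> * T powr (- Re s)"
          by (simp only: norm_scaleR uminus_complex.sel)
        also have "\<dots> \<le> (C * T powr (9/10)) * T powr (- Re s)"
          by (rule mult_right_mono[OF C(2)[OF elim] powr_ge_zero])
        finally show ?thesis .
      qed
      also have "\<dots> = C * T powr (9/10 - Re s)" by (simp only: mult.assoc powr_add[symmetric] add_uminus_conv_diff)
      finally show ?case .
    qed
    show "((\<lambda>T. C * T powr (9/10 - Re s)) \<longlongrightarrow> 0) at_top"
      using s by (intro tendsto_mult_right_zero tendsto_neg_powr filterlim_ident) auto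
  qed
  moreover have "(?r \<longlongrightarrow> 0) at_top" by (rule of_real_powr_tendsto_0[OF w(2)])
  moreover have "((\<lambda>T. integral {1..T} (\<lambda>t. of_real (count_error t) * complex_of_real t powr (- s - 1))) \<longlongrightarrow> error_mellin (- s - 1)) at_top"
    unfolding error_mellin_def by (rule integral_tail_tendsto[OF I])
  ultimately have "((\<lambda>T. count_error T *\<^sub>R ?\<phi> T + of_real (smooth_count 1) + (polar_part w - ?r T) + low_sum s
      + s * integral {1..T} (\<lambda>t. of_real (count_error t) * complex_of_real t powr (- s - 1))) \<longlongrightarrow>
      0 + of_real (smooth_count 1) + (polar_part w - 0) + low_sum s + s * error_mellin (- s - 1)) at_top"
    by (intro tendsto_intros)
  also have "0 + of_real (smooth_count 1) + (polar_part w - 0) + low_sum s + s * error_mellin (- s - 1) = polar_part (s - 1) + regular_part s"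
    by (simp add: regular_part_def w_def)
  finally show ?thesis
    by (rule Lim_transform_eventually) (rule eventually_mono[OF eventually_ge_at_top[of 1]], rule eq[symmetric])
qed

text \<open>
  The summand of the secondary zeta function that belongs to a zero \<rho>.
\<close>
definition zeta_zero_term :: "complex \<Rightarrow> complex \<Rightarrow> complex" where
  "zeta_zero_term s \<rho> = of_int (zorder riemann_zeta \<rho>) * of_real (Im \<rho>) powr (- s)"

lemma zero_vsum_zeta_zero_term:
  "zero_vsum (\<lambda>t. complex_of_real t powr (- s)) T = (\<Sum>\<rho>\<in>{\<rho>\<in>nontrivial_zeros. 0 < Im \<rho> \<and> Im \<rho> < T}. zeta_zero_term s \<rho>)"
  by (simp add: zero_vsum_def zeta_zero_term_def scaleR_conv_of_real)

lemma finite_subset_zeros_bounded: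
  assumes "finite F" "F \<subseteq> {\<rho>\<in>nontrivial_zeros. Im \<rho> > 0}"
  obtains U where "\<And>T. T \<ge> U \<Longrightarrow> F \<subseteq> {\<rho>\<in>nontrivial_zeros. 0 < Im \<rho> \<and> Im \<rho> < T}"
proof -
  define U where "U = Max (insert 0 (Im ` F)) + 1"
  have "Im \<rho> < U" if "\<rho> \<in> F" for \<rho>
  proof -
    have "Im \<rho> \<le> Max (insert 0 (Im ` F))" using that assms(1) by (intro Max_ge) auto
    thus ?thesis by (simp add: U_def)
  qed
  hence "F \<subseteq> {\<rho>\<in>nontrivial_zeros. 0 < Im \<rho> \<and> Im \<rho> < T}" if "T \<ge> U" for T
    using that assms(2) by fastforce
  thus ?thesis using that by blast
qed

lemma zeta_zero_term_summable:
  assumes RH: "riemann_hypothesis" and s: "Re s > 1"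
  shows "zeta_zero_term s summable_on {\<rho>\<in>nontrivial_zeros. Im \<rho> > 0}"
proof -
  let ?A = "{\<rho>\<in>nontrivial_zeros. Im \<rho> > 0}"
  define f where "f = (\<lambda>\<rho>. norm (zeta_zero_term s \<rho>))"
  define \<sigma> where "\<sigma> = complex_of_real (Re s)"
  have f: "zeta_zero_term \<sigma> \<rho> = of_real (f \<rho>)" if "\<rho> \<in> ?A" for \<rho>
    using that zorder_nontrivial_zero_pos[OF RH, of \<rho>]
    by (simp add: f_def zeta_zero_term_def norm_mult norm_powr_real_powr \<sigma>_def powr_of_real[symmetric])
  define l where "l = Re (polar_part (\<sigma> - 1) + regular_part \<sigma>)"
  have "((\<lambda>T. Re (zero_vsum (\<lambda>t. complex_of_real t powr (- \<sigma>)) T)) \<longlongrightarrow> l) at_top"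
    unfolding l_def using s by (intro tendsto_Re zero_vsum_powr_tendsto RH) (auto simp: \<sigma>_def)
  moreover have "Re (zero_vsum (\<lambda>t. complex_of_real t powr (- \<sigma>)) T) = (\<Sum>\<rho>\<in>{\<rho>\<in>nontrivial_zeros. 0 < Im \<rho> \<and> Im \<rho> < T}. f \<rho>)" for T
    unfolding zero_vsum_zeta_zero_term by (simp add: f)
  ultimately have lim: "((\<lambda>T. (\<Sum>\<rho>\<in>{\<rho>\<in>nontrivial_zeros. 0 < Im \<rho> \<and> Im \<rho> < T}. f \<rho>)) \<longlongrightarrow> l) at_top"
    by simp
  have "f summable_on ?A"
  proof (rule nonneg_bdd_above_summable_on)
    show "f x \<ge> 0" for x by (simp add: f_def)
    show "bdd_above (sum f ` {F. F \<subseteq> ?A \<and> finite F})"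
    proof (rule bdd_aboveI2)
      fix F assume F: "F \<in> {F. F \<subseteq> ?A \<and> finite F}"
      then obtain U where U: "\<And>T. T \<ge> U \<Longrightarrow> F \<subseteq> {\<rho>\<in>nontrivial_zeros. 0 < Im \<rho> \<and> Im \<rho> < T}"
        using finite_subset_zeros_bounded[of F] by blast
      have "\<forall>\<^sub>F T in at_top. sum f F \<le> (\<Sum>\<rho>\<in>{\<rho>\<in>nontrivial_zeros. 0 < Im \<rho> \<and> Im \<rho> < T}. f \<rho>)"
        using eventually_ge_at_top[of U]
        by eventually_elim (intro sum_mono2 finite_zero_index_set RH U, auto simp: f_def)
      thus "sum f F \<le> l" by (rule tendsto_lowerbound[OF lim]) simp
    qed
  qed
  thus ?thesis unfolding f_def by (rule abs_summable_summable)
qed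

lemma zeta_zero_term_infsum:
  assumes RH: "riemann_hypothesis" and s: "Re s > 1"
  shows "(\<Sum>\<^sub>\<infinity>\<rho>\<in>{\<rho>\<in>nontrivial_zeros. Im \<rho> > 0}. of_int (zorder riemann_zeta \<rho>) * of_real (Im \<rho>) powr (- s))
     = polar_part (s - 1) + regular_part s"
proof -
  let ?A = "{\<rho>\<in>nontrivial_zeros. Im \<rho> > 0}"
  have "(sum (zeta_zero_term s) \<longlongrightarrow> infsum (zeta_zero_term s) ?A) (finite_subsets_at_top ?A)"
    using zeta_zero_term_summable[OF assms] by (simp add: has_sum_infsum flip: has_sum_def)
  moreover have "filterlim (\<lambda>T. {\<rho>\<in>nontrivial_zeros. 0 < Im \<rho> \<and> Im \<rho> < T}) (finite_subsets_at_top ?A) at_top"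
    unfolding filterlim_finite_subsets_at_top
  proof (intro allI impI)
    fix F assume F: "finite F \<and> F \<subseteq> ?A"
    then obtain U where U: "\<And>T. T \<ge> U \<Longrightarrow> F \<subseteq> {\<rho>\<in>nontrivial_zeros. 0 < Im \<rho> \<and> Im \<rho> < T}"
      using finite_subset_zeros_bounded[of F] by blast
    show "\<forall>\<^sub>F T in at_top. finite {\<rho>\<in>nontrivial_zeros. 0 < Im \<rho> \<and> Im \<rho> < T} \<and> F \<subseteq> {\<rho>\<in>nontrivial_zeros. 0 < Im \<rho> \<and> Im \<rho> < T} \<and>
        {\<rho>\<in>nontrivial_zeros. 0 < Im \<rho> \<and> Im \<rho> < T} \<subseteq> ?A"
      using eventually_ge_at_top[of U] by eventually_elim (use U finite_zero_index_set[OF RH] in auto)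
  qed
  ultimately have "((\<lambda>T. zero_vsum (\<lambda>t. complex_of_real t powr (- s)) T) \<longlongrightarrow> infsum (zeta_zero_term s) ?A) at_top"
    unfolding zero_vsum_zeta_zero_term by (rule filterlim_compose)
  from tendsto_unique[OF _ this zero_vsum_powr_tendsto[OF assms]] show ?thesis
    by (simp add: zeta_zero_term_def[abs_def])
qed

lemma regular_part_holomorphic:
  assumes RH: "riemann_hypothesis"
  shows "regular_part holomorphic_on {s. Re s > 9/10}"
proof -
  have "(error_mellin \<circ> (\<lambda>s. - s - 1)) holomorphic_on {s. Re s > 9/10}"
    by (rule holomorphic_on_compose_gen[OF _ error_mellin_holomorphic[OF RH]]) (auto intro!: holomorphic_intros)
  hence "(\<lambda>s. error_mellin (- s - 1)) holomorphic_on {s. Re s > 9/10}" by (simp add: o_def)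
  moreover have "low_sum holomorphic_on {s. Re s > 9/10}"
    unfolding low_sum_def[abs_def] zero_vsum_def scaleR_conv_of_real by (intro holomorphic_intros)
  ultimately show ?thesis unfolding regular_part_def[abs_def] by (intro holomorphic_intros)
qed

lemma secondary_zeta_eq:
  assumes RH: "riemann_hypothesis" and s: "Re s > 9/10" "s \<noteq> 1"
  shows "secondary_zeta s = polar_part (s - 1) + regular_part s"
  unfolding secondary_zeta_def
proof (rule continuation_eq[where a = "9/10"])
  let ?B = "{- (2 * of_nat k + 1) |k::nat. True} :: complex set"
  have B: "?B = range (\<lambda>k::nat. - (2 * of_nat k + 1))" by auto
  show "countable (insert 1 ?B)" unfolding B by simp
  show "closed (insert 1 ?B)" by (rule closed_subset_Ints) auto
  show "(\<lambda>s. polar_part (s - 1) + regular_part s) holomorphic_on ({z. 9/10 < Re z} - insert 1 ?B)"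
    unfolding polar_part_def
    by (intro holomorphic_intros holomorphic_on_subset[OF regular_part_holomorphic[OF RH]]) auto
  show "polar_part (z - 1) + regular_part z = (\<Sum>\<^sub>\<infinity>\<rho>\<in>{\<rho>\<in>nontrivial_zeros. Im \<rho> > 0}. of_int (zorder riemann_zeta \<rho>) * of_real (Im \<rho>) powr (- z))"
    if "1 < Re z" for z using zeta_zero_term_infsum[OF RH that] by simp
  show "s \<notin> insert 1 ?B" using s by auto
qed (use s in auto)

section \<open>The Laurent coefficients\<close>

text \<open>
  The n-th Taylor coefficient of the regular part at s = 1.
\<close>
definition regular_coeff :: "nat \<Rightarrow> real" where
  "regular_coeff n = (-1) ^ n / fact n * stieltjes_const n"

lemma low_sum_expansion:
  "(\<lambda>n. of_real ((-1) ^ n / fact n * zero_sum (\<lambda>t. ln t ^ n / t - ln 1 ^ n / 1) 1) * w ^ n) sums low_sum (1 + w)"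
proof -
  let ?A = "{\<rho>\<in>nontrivial_zeros. 0 < Im \<rho> \<and> Im \<rho> < 1}"
  let ?m = "\<lambda>\<rho>. real_of_int (zorder riemann_zeta \<rho>)"
  have e: "(\<lambda>n. of_real ((-1) ^ n / fact n * (ln t ^ n / t)) * w ^ n) sums of_real t powr (- (1 + w))" if t: "t > 0" for t
  proof -
    have "(\<lambda>n. of_real (1 / t) * ((- w * of_real (ln t)) ^ n /\<^sub>R fact n)) sums (of_real (1 / t) * exp (- w * of_real (ln t)))"
      by (intro sums_mult exp_converges)
    also have "of_real (1 / t) * exp (- w * of_real (ln t)) = of_real t powr (- (1 + w))"
    proof -
      have "complex_of_real t powr (- (1 + w)) = exp (- (1 + w) * of_real (ln t))"
        using t by (simp add: powr_def Ln_of_real)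
      also have "\<dots> = exp (- of_real (ln t)) * exp (- w * of_real (ln t))"
        by (simp only: exp_add[symmetric]) (simp add: algebra_simps)
      also have "exp (- complex_of_real (ln t)) = of_real (1 / t)"
        using t by (simp add: exp_minus exp_of_real inverse_eq_divide)
      finally show ?thesis by simp
    qed
    also have "(\<lambda>n. of_real (1 / t) * ((- w * of_real (ln t)) ^ n /\<^sub>R fact n)) = (\<lambda>n. of_real ((-1) ^ n / fact n * (ln t ^ n / t)) * w ^ n)"
    proof
      fix n
      have "(- w * complex_of_real (ln t)) ^ n = (-1) ^ n * w ^ n * of_real (ln t) ^ n"
        by (simp only: power_mult_distrib[symmetric]) simp
      thus "of_real (1 / t) * ((- w * of_real (ln t)) ^ n /\<^sub>R fact n) = of_real ((-1) ^ n / fact n * (ln t ^ n / t)) * w ^ n"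
        by (simp add: scaleR_conv_of_real divide_inverse)
    qed
    finally show ?thesis .
  qed
  have "(\<lambda>n. \<Sum>\<rho>\<in>?A. of_real (?m \<rho>) * (of_real ((-1) ^ n / fact n * (ln (Im \<rho>) ^ n / Im \<rho>)) * w ^ n - of_real ((-1) ^ n / fact n * (ln 1 ^ n / 1)) * w ^ n))
     sums (\<Sum>\<rho>\<in>?A. of_real (?m \<rho>) * (of_real (Im \<rho>) powr (- (1 + w)) - of_real 1 powr (- (1 + w))))"
    by (intro sums_sum sums_mult sums_diff e) auto
  also have "(\<lambda>n. \<Sum>\<rho>\<in>?A. of_real (?m \<rho>) * (of_real ((-1) ^ n / fact n * (ln (Im \<rho>) ^ n / Im \<rho>)) * w ^ n - of_real ((-1) ^ n / fact n * (ln 1 ^ n / 1)) * w ^ n)) =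
     (\<lambda>n. of_real ((-1) ^ n / fact n * zero_sum (\<lambda>t. ln t ^ n / t - ln 1 ^ n / 1) 1) * w ^ n)"
  proof
    fix n
    have "of_real m * (of_real (c * x) * v - of_real (c * y) * v) = of_real (c * (m * (x - y))) * v" for m c x y and v :: complex
      by (simp add: algebra_simps)
    hence "(\<Sum>\<rho>\<in>?A. of_real (?m \<rho>) * (of_real ((-1) ^ n / fact n * (ln (Im \<rho>) ^ n / Im \<rho>)) * w ^ n - of_real ((-1) ^ n / fact n * (ln 1 ^ n / 1)) * w ^ n)) =
      (\<Sum>\<rho>\<in>?A. of_real ((-1) ^ n / fact n * (?m \<rho> * (ln (Im \<rho>) ^ n / Im \<rho> - ln 1 ^ n / 1))) * w ^ n)" by (simp only:)
    also have "\<dots> = of_real ((-1) ^ n / fact n * zero_sum (\<lambda>t. ln t ^ n / t - ln 1 ^ n / 1) 1) * w ^ n"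
      by (simp only: zero_sum_def sum_distrib_left of_real_sum sum_distrib_right)
    finally show "(\<Sum>\<rho>\<in>?A. of_real (?m \<rho>) * (of_real ((-1) ^ n / fact n * (ln (Im \<rho>) ^ n / Im \<rho>)) * w ^ n - of_real ((-1) ^ n / fact n * (ln 1 ^ n / 1)) * w ^ n)) =
      of_real ((-1) ^ n / fact n * zero_sum (\<lambda>t. ln t ^ n / t - ln 1 ^ n / 1) 1) * w ^ n" .
  qed
  also have "(\<Sum>\<rho>\<in>?A. of_real (?m \<rho>) * (of_real (Im \<rho>) powr (- (1 + w)) - of_real 1 powr (- (1 + w)))) = low_sum (1 + w)"
    by (simp only: low_sum_def zero_vsum_def scaleR_conv_of_real)
  finally show ?thesis .
qed

lemma error_mellin_expansion:
  assumes RH: "riemann_hypothesis" and w: "norm w \<le> 1/20"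
  shows "(\<lambda>n. of_real ((-1) ^ n / fact n * error_moment n) * w ^ n) sums error_mellin (- 2 - w)"
proof -
  have pos: "{1..} \<subseteq> {0::real<..}" by auto
  have "(\<lambda>k. integral {1..} (\<lambda>x. of_real (count_error x) * of_real x powr (- 2) * of_real (ln x) ^ k) / fact k * (- w) ^ k) sums
           integral {1..} (\<lambda>x. of_real (count_error x) * complex_of_real x powr (- 2 + (- w)))"
    \<comment> \<open>For r < 1/10 both exponents -2 + r and -2 - r lie below -19/10.\<close>
    by (rule mellin_expansion(2)[OF _ pos, where r = "1/20"])
       (use w in \<open>auto intro!: count_error_powr_integrable[OF RH]\<close>)
  also have "integral {1..} (\<lambda>x. of_real (count_error x) * complex_of_real x powr (- 2 + (- w))) = error_mellin (- 2 - w)"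
    by (simp add: error_mellin_def)
  also have "(\<lambda>k. integral {1..} (\<lambda>x. of_real (count_error x) * of_real x powr (- 2) * of_real (ln x) ^ k) / fact k * (- w) ^ k) =
    (\<lambda>n. of_real ((-1) ^ n / fact n * error_moment n) * w ^ n)"
  proof
    fix k
    have "((\<lambda>t. count_error t *\<^sub>R (t powr (- 2) * ln t ^ k)) has_integral error_moment k) {1..}"
      using error_moment_integrable[OF RH, of k] unfolding error_moment_def by (auto simp: absolutely_integrable_on_def)
    hence "((\<lambda>t. complex_of_real (count_error t *\<^sub>R (t powr (- 2) * ln t ^ k))) has_integral of_real (error_moment k)) {1..}"
      by (rule has_integral_of_real)
    hence "((\<lambda>x. of_real (count_error x) * complex_of_real x powr (- 2) * of_real (ln x) ^ k) has_integral of_real (error_moment k)) {1..}"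
    proof (rule has_integral_eq[rotated])
      fix t :: real assume t: "t \<in> {1..}"
      have "complex_of_real t powr (- 2) = of_real (t powr (- 2))"
        using t powr_of_real[of t "- 2"] by simp
      thus "complex_of_real (count_error t *\<^sub>R (t powr (- 2) * ln t ^ k)) = of_real (count_error t) * complex_of_real t powr (- 2) * of_real (ln t) ^ k"
        by (simp only: real_scaleR_def of_real_mult of_real_power mult.assoc)
    qed
    hence i: "integral {1..} (\<lambda>x. of_real (count_error x) * complex_of_real x powr (- 2) * of_real (ln x) ^ k) = of_real (error_moment k)"
      by (rule integral_unique)
    have "(- w) ^ k = (-1) ^ k * w ^ k" by (rule power_minus)
    thus "integral {1..} (\<lambda>x. of_real (count_error x) * of_real x powr (- 2) * of_real (ln x) ^ k) / fact k * (- w) ^ k =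
        of_real ((-1) ^ k / fact k * error_moment k) * w ^ k" unfolding i by simp
  qed
  finally show ?thesis .
qed

lemma regular_part_expansion:
  assumes RH: "riemann_hypothesis" and w: "norm w \<le> 1/20"
  shows "(\<lambda>n. of_real (regular_coeff n) * w ^ n) sums regular_part (1 + w)"
proof -
  define a where "a = (\<lambda>n. (-1) ^ n / fact n * error_moment n)"
  define b where "b = (\<lambda>n. case n of 0 \<Rightarrow> 0 | Suc k \<Rightarrow> a k)"
  have M: "(\<lambda>n. of_real (a n) * w ^ n) sums error_mellin (- 2 - w)"
    unfolding a_def by (rule error_mellin_expansion[OF assms])
  have "(\<lambda>n. w * (of_real (a n) * w ^ n)) sums (w * error_mellin (- 2 - w))" by (intro sums_mult M)
  hence "(\<lambda>n. of_real (b (Suc n)) * w ^ Suc n) sums (w * error_mellin (- 2 - w))" by (simp add: b_def mult_ac)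
  hence wM: "(\<lambda>n. of_real (b n) * w ^ n) sums (w * error_mellin (- 2 - w))"
    by (subst (asm) sums_Suc_iff) (simp add: b_def)
  have S: "(\<lambda>n. of_real ((-1) ^ n / fact n * (smooth_count 1 * (ln 1 ^ n / 1))) * w ^ n) sums of_real (smooth_count 1)"
  proof -
    have "(\<lambda>n. if n = 0 then complex_of_real (smooth_count 1) else 0) sums of_real (smooth_count 1)"
      by (rule sums_single)
    also have "(\<lambda>n. if n = 0 then complex_of_real (smooth_count 1) else 0) = (\<lambda>n. of_real ((-1) ^ n / fact n * (smooth_count 1 * (ln 1 ^ n / 1))) * w ^ n)"
      by (auto simp: fun_eq_iff)
    finally show ?thesis .
  qed
  note sums_add[OF sums_add[OF low_sum_expansion S] sums_add[OF M wM]]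
  also have "low_sum (1 + w) + of_real (smooth_count 1) + (error_mellin (- 2 - w) + w * error_mellin (- 2 - w)) = regular_part (1 + w)"
  proof -
    have "- (1 + w) - 1 = - 2 - w" by simp
    thus ?thesis unfolding regular_part_def by (simp only: distrib_right mult_1_left)
  qed
  also have "(\<lambda>n. of_real ((-1) ^ n / fact n * zero_sum (\<lambda>t. ln t ^ n / t - ln 1 ^ n / 1) 1) * w ^ n +
       of_real ((-1) ^ n / fact n * (smooth_count 1 * (ln 1 ^ n / 1))) * w ^ n + (of_real (a n) * w ^ n + of_real (b n) * w ^ n)) =
       (\<lambda>n. of_real (regular_coeff n) * w ^ n)"
  proof
    fix n
    have b: "b n = - ((-1) ^ n / fact n * (real n * error_moment (n - 1)))"
      by (cases n) (simp_all add: b_def a_def del: of_nat_Suc)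
    have "c * x + c * y + (c * z - c * u) = c * (x + y - (u - z))" for c x y z u :: real
      by (simp add: algebra_simps)
    hence "(-1) ^ n / fact n * zero_sum (\<lambda>t. ln t ^ n / t - ln 1 ^ n / 1) 1 + (-1) ^ n / fact n * (smooth_count 1 * (ln 1 ^ n / 1)) + (a n + b n) = regular_coeff n"
      unfolding b a_def regular_coeff_def stieltjes_const_def add_uminus_conv_diff .
    thus "of_real ((-1) ^ n / fact n * zero_sum (\<lambda>t. ln t ^ n / t - ln 1 ^ n / 1) 1) * w ^ n +
       of_real ((-1) ^ n / fact n * (smooth_count 1 * (ln 1 ^ n / 1))) * w ^ n + (of_real (a n) * w ^ n + of_real (b n) * w ^ n) = of_real (regular_coeff n) * w ^ n"
      by (simp only: distrib_right[symmetric] of_real_add[symmetric])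
  qed
  finally show ?thesis .
qed

lemma secondary_zeta_coeff_eq:
  assumes RH: "riemann_hypothesis"
  shows "secondary_zeta_coeff n = of_real ((-1) ^ n * stieltjes_const n)"
proof -
  define B where "B = Abs_fps (\<lambda>n. complex_of_real (regular_coeff n))"
  define P where "P = fls_const (1 / complex_of_real (2 * pi)) * (fls_X_inv ^ 2 - fls_const (of_real (ln (2 * pi))) * fls_X_inv)"
  have B: "(\<lambda>n. fps_nth B n * w ^ n) sums regular_part (1 + w)" if "norm w \<le> 1/20" for w
    unfolding B_def using regular_part_expansion[OF RH that] by simp
  have "(\<lambda>w. regular_part (1 + w)) has_fps_expansion B"
  proof (rule has_fps_expansionI)
    have "\<forall>\<^sub>F w in nhds 0. norm (w :: complex) < 1/20"
      using eventually_nhds_in_open[of "ball (0::complex) (1/20)" 0] by simp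
    thus "\<forall>\<^sub>F w in nhds 0. (\<lambda>n. fps_nth B n * w ^ n) sums regular_part (1 + w)"
      by eventually_elim (rule B, simp)
  qed
  hence "(\<lambda>w. regular_part (1 + w)) has_laurent_expansion fps_to_fls B" by (rule has_laurent_expansion_fps)
  moreover have "polar_part has_laurent_expansion P"
  proof -
    have "(\<lambda>w. 1 / complex_of_real (2 * pi) * (inverse w ^ 2 - of_real (ln (2 * pi)) * inverse w)) has_laurent_expansion
         fls_const (1 / complex_of_real (2 * pi)) * (inverse fls_X ^ 2 - fls_const (of_real (ln (2 * pi))) * inverse fls_X)"
      by (intro has_laurent_expansion_cmult_left has_laurent_expansion_diff has_laurent_expansion_power
        has_laurent_expansion_inverse has_laurent_expansion_fps_X)
    moreover have "(\<lambda>w. 1 / complex_of_real (2 * pi) * (inverse w ^ 2 - of_real (ln (2 * pi)) * inverse w)) = polar_part"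
    proof
      fix w
      have "1 / c * (inverse w ^ 2 - l * inverse w) = (1 / w\<^sup>2 - l / w) / c" for c l :: complex
        by (simp only: divide_inverse power_inverse mult_1_left mult.commute)
      thus "1 / complex_of_real (2 * pi) * (inverse w ^ 2 - of_real (ln (2 * pi)) * inverse w) = polar_part w"
        unfolding polar_part_def .
    qed
    ultimately show ?thesis by (simp only: P_def fls_inverse_X)
  qed
  ultimately have "(\<lambda>w. polar_part w + regular_part (1 + w)) has_laurent_expansion P + fps_to_fls B"
    by (intro has_laurent_expansion_add)
  also have "?this \<longleftrightarrow> (\<lambda>w. secondary_zeta (1 + w)) has_laurent_expansion P + fps_to_fls B"
  proof (rule has_laurent_expansion_cong[OF _ refl])
    have "\<forall>\<^sub>F w in at 0. w \<in> ball (0::complex) (1/10) - {0}"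
      by (rule eventually_at_in_open) auto
    thus "\<forall>\<^sub>F w in at 0. polar_part w + regular_part (1 + w) = secondary_zeta (1 + w)"
    proof eventually_elim
      case (elim w)
      have "- Re w \<le> norm w" using abs_Re_le_cmod[of w] by linarith
      hence "Re (1 + w) > 9/10" "1 + w \<noteq> 1" using elim by auto
      from secondary_zeta_eq[OF RH this] show ?case by simp
    qed
  qed
  finally have "laurent_expansion secondary_zeta 1 = P + fps_to_fls B" by (rule laurent_expansion_eqI)
  moreover have "fls_nth P (int n) = 0"
    unfolding P_def fls_mult_const_nth fls_minus_nth fls_X_inv_power_nth fls_X_inv_nth by simp
  ultimately have "secondary_zeta_coeff n = fact n * of_real (regular_coeff n)"
    by (simp add: secondary_zeta_coeff_def B_def)
  also have "\<dots> = of_real ((-1) ^ n * stieltjes_const n)" by (simp add: regular_coeff_def)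
  finally show ?thesis .
qed

theorem theorem2:
  fixes n :: nat
  assumes "riemann_hypothesis"
  shows "((\<lambda>T::real. complex_of_real
            ((-1) ^ n *
              (zero_sum (\<lambda>t. ln t ^ n / t) T
               - 1 / (2 * pi * (real n + 1) * (real n + 2)) * ln T ^ (n + 1)
                   * ln (T ^ (n + 1) / (2 * pi) ^ (n + 2))
               - ln T ^ n / T
                   * (zero_count T - 7 / 8 - T / (2 * pi) * ln (T / (2 * pi)) + T / (2 * pi))
               + bpt_remainder (\<lambda>t. ln t ^ n / t) T)))
          \<longlongrightarrow> secondary_zeta_coeff n)
          (inf at_top (principal (- ordinates)))"
\<comment> \<open>The bracket is constant for all T >= 1, whether or not T is an ordinate.\<close>
proof (rule tendsto_eventually, rule filter_leD[OF inf_le1])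
  show "\<forall>\<^sub>F T in at_top. complex_of_real
            ((-1) ^ n *
              (zero_sum (\<lambda>t. ln t ^ n / t) T
               - 1 / (2 * pi * (real n + 1) * (real n + 2)) * ln T ^ (n + 1)
                   * ln (T ^ (n + 1) / (2 * pi) ^ (n + 2))
               - ln T ^ n / T
                   * (zero_count T - 7 / 8 - T / (2 * pi) * ln (T / (2 * pi)) + T / (2 * pi))
               + bpt_remainder (\<lambda>t. ln t ^ n / t) T)) = secondary_zeta_coeff n"
    using eventually_ge_at_top[of 1]
    by eventually_elim (simp only: bracket_constant[OF assms] secondary_zeta_coeff_eq[OF assms])
qed

end
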